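(* Let $\mathcal{R}=\mathbb{C}[\partial]A\oplus\mathbb{C}[\partial]B$ be the direct sum of two Virasoro conformal algebras, and let $V_{\delta,\alpha,\beta}=\mathbb{C}[\partial]v$ and $V_{\bar\delta,\bar\alpha,\bar\beta}=\mathbb{C}[\partial]\bar v$ be nontrivial finite irreducible $\mathcal{R}$-modules. Consider extensions of $\mathcal{R}$-modules of the form $$0\longrightarrow V_{\delta,\alpha,\beta}\longrightarrow E\longrightarrow V_{\bar\delta,\bar\alpha,\bar\beta}\longrightarrow 0 .\qquad(\ast)$$ Every such $E$ is, as a $\mathbb{C}[\partial]$-module, $\mathbb{C}[\partial]v\oplus\mathbb{C}[\partial]\bar v$ with $$A_\lambda v=\delta_1(\partial+\alpha_1\lambda+\beta_1)v,\quad B_\lambda v=\delta_2(\partial+\alpha_2\lambda+\beta_2)v,$$ $$A_\lambda\bar v=\bar\delta_1(\partial+\bar\alpha_1\lambda+\bar\beta_1)\bar v+f(\partial,\lambda)v,\quad B_\lambda\bar v=\bar\delta_2(\partial+\bar\alpha_2\lambda+\bar\beta_2)\bar v+g(\partial,\lambda)v\qquad(\ast\ast)$$ for some $f,g\in\mathbb{C}[\partial,\lambda]$. Nontrivial extensions of the form $(\ast)$ exist only in the following cases, and they are given (up to equivalence) by $(\ast\ast)$ with the following data: (1) $\delta_1=\bar\delta_1=1$, $\delta_2=\bar\delta_2=0$, $\alpha_2,\beta_2,\bar\alpha_2,\bar\beta_2$ arbitrary, $g(\partial,\lambda)=0$, $\beta_1=\bar\beta_1$, $\bar\alpha_1-\alpha_1\in\{0,1,2,3,4,5,6\}$,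 $\alpha_1,\bar\alpha_1\neq0$, and (i) $\bar\alpha_1=\alpha_1$, $f(\partial,\lambda)=s_0+s_1\lambda$, where $(s_0,s_1)\neq(0,0)$; (ii) $\bar\alpha_1-\alpha_1=2$, $f(\partial,\lambda)=s\lambda^2(2(\partial+\beta_1)+\lambda)$, where $s\neq0$; (iii) $\bar\alpha_1-\alpha_1=3$, $f(\partial,\lambda)=s(\partial+\beta_1)\lambda^2(\partial+\beta_1+\lambda)$, where $s\neq0$; (iv) $\bar\alpha_1-\alpha_1=4$, $f(\partial,\lambda)=s\lambda^2\big(4(\partial+\beta_1)^3+6(\partial+\beta_1)^2\lambda-(\partial+\beta_1)\lambda^2+\alpha_1\lambda^3\big)$, where $s\neq0$; (v) $\bar\alpha_1=1$ and $\alpha_1=-4$, $f(\partial,\lambda)=s\big((\partial+\beta_1)^4\lambda^2-10(\partial+\beta_1)^2\lambda^4-17(\partial+\beta_1)\lambda^5-8\lambda^6\big)$, where $s\neq0$; (vi) $\bar\alpha_1=\frac72\pm\frac{\sqrt{19}}2$ and $\alpha_1=-\frac52\pm\frac{\sqrt{19}}2$ (same sign), $f(\partial,\lambda)=s\big((\partial+\beta_1)^4\lambda^3-(2\alpha_1+3)(\partial+\beta_1)^3\lambda^4-3\alpha_1(\partial+\beta_1)^2\lambda^5-(3\alpha_1+1)(\partial+\beta_1)\lambda^6-(\alpha_1+\frac9{28})\lambda^7\big)$, where $s\neq0$. The value of $\dim\mathrm{Ext}(V_{\bar\delta,\bar\alpha,\bar\beta},V_{\delta,\alpha,\beta})$ is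 $2$ in subcase (i) and $1$ in subcases (ii)–(vi). (2) $\delta_1=\bar\delta_1=0$, $\delta_2=\bar\delta_2=1$, $\alpha_1,\beta_1,\bar\alpha_1,\bar\beta_1$ arbitrary, $f(\partial,\lambda)=0$, $\beta_2=\bar\beta_2$, $\bar\alpha_2-\alpha_2\in\{0,1,2,3,4,5,6\}$, $\alpha_2,\bar\alpha_2\neq0$, and (i) $\bar\alpha_2=\alpha_2$, $g(\partial,\lambda)=t_0+t_1\lambda$, where $(t_0,t_1)\neq(0,0)$; (ii) $\bar\alpha_2-\alpha_2=2$, $g(\partial,\lambda)=t\lambda^2(2(\partial+\beta_2)+\lambda)$, where $t\neq0$; (iii) $\bar\alpha_2-\alpha_2=3$, $g(\partial,\lambda)=t(\partial+\beta_2)\lambda^2(\partial+\beta_2+\lambda)$, where $t\neq0$; (iv) $\bar\alpha_2-\alpha_2=4$, $g(\partial,\lambda)=t\lambda^2\big(4(\partial+\beta_2)^3+6(\partial+\beta_2)^2\lambda-(\partial+\beta_2)\lambda^2+\alpha_2\lambda^3\big)$, where $t\neq0$; (v) $\bar\alpha_2=1$ and $\alpha_2=-4$, $g(\partial,\lambda)=t\big((\partial+\beta_2)^4\lambda^2-10(\partial+\beta_2)^2\lambda^4-17(\partial+\beta_2)\lambda^5-8\lambda^6\big)$, where $t\neq0$; (vi) $\bar\alpha_2=\frac72\pm\frac{\sqrt{19}}2$ and $\alpha_2=-\frac52\pm\frac{\sqrt{19}}2$ (same sign), $g(\partial,\lambda)=t\big((\partial+\beta_2)^4\lambda^3-(2\alpha_2+3)(\partial+\beta_2)^3\lambda^4-3\alpha_2(\partial+\beta_2)^2\lambda^5-(3\alpha_2+1)(\partial+\beta_2)\lambda^6-(\alpha_2+\frac9{28})\lambda^7\big)$,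 where $t\neq0$. The value of $\dim\mathrm{Ext}(V_{\bar\delta,\bar\alpha,\bar\beta},V_{\delta,\alpha,\beta})$ is $2$ in subcase (i) and $1$ in subcases (ii)–(vi).
   Context: Everything is over $\mathbb{C}$. A Lie conformal algebra $\mathcal{R}$ is a $\mathbb{C}[\partial]$-module with a $\mathbb{C}$-linear $\lambda$-bracket $\mathcal{R}\otimes\mathcal{R}\to\mathcal{R}[\lambda]$, $a\otimes b\mapsto[a_\lambda b]$, satisfying $[\partial a_\lambda b]=-\lambda[a_\lambda b]$, $[a_\lambda\partial b]=(\partial+\lambda)[a_\lambda b]$, $[a_\lambda b]=-[b_{-\lambda-\partial}a]$ and $[a_\lambda[b_\mu c]]=[[a_\lambda b]_{\lambda+\mu}c]+[b_\mu[a_\lambda c]]$. A conformal $\mathcal{R}$-module $V$ is a $\mathbb{C}[\partial]$-module with a $\mathbb{C}$-linear map $\mathcal{R}\otimes V\to V[\lambda]$, $a\otimes v\mapsto a_\lambda v$, satisfying $(\partial a)_\lambda v=-\lambda(a_\lambda v)$, $a_\lambda(\partial v)=(\partial+\lambda)a_\lambda v$, $a_\lambda(b_\mu v)=[a_\lambda b]_{\lambda+\mu}v+b_\mu(a_\lambda v)$. An extension of $W$ by $V$ is an exact sequence of modules $0\to V\to E\to W\to0$. Two extensions $E,E'$ are equivalent if there is a module homomorphism $E\to E'$ compatible with the identity maps of $V$ and $W$. An extension is trivial if it is equivalent to $V\oplus W$. $\mathrm{Ext}(W,V)$ is the vector space of extension cocycles modulo those equivalent to the trivial extension, and $\dim\mathrm{Ext}(W,V)$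 is its dimension. The direct sum of two Virasoro conformal algebras has free basis $\{A,B\}$ over $\mathbb{C}[\partial]$ with $[A_\lambda A]=(\partial+2\lambda)A$, $[A_\lambda B]=0$, $[B_\lambda B]=(\partial+2\lambda)B$. Its nontrivial finite irreducible modules are $V_{\delta,\alpha,\beta}=\mathbb{C}[\partial]v$ (free of rank one) with $A_\lambda v=\delta_1(\partial+\alpha_1\lambda+\beta_1)v$, $B_\lambda v=\delta_2(\partial+\alpha_2\lambda+\beta_2)v$, where $\delta_i\in\{0,1\}$, $\delta_1^2+\delta_2^2=1$, $\beta_i\in\mathbb{C}$, $0\neq\alpha_i\in\mathbb{C}$ ($i=1,2$); $V_{\bar\delta,\bar\alpha,\bar\beta}$ is defined in the same way with barred parameters. *)

theory Defs
  imports
    Complex_Main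
    "HOL-Computational_Algebra.Polynomial"
    "HOL-Library.Product_Plus"
    "HOL-Library.Function_Algebras"
    "HOL-Library.Set_Algebras"
begin

section \<open>Polynomials in \<open>\<lambda>\<close> with coefficients in a \<open>\<complex>[\<partial>]\<close>-module\<close>

text \<open>
  A \<open>\<complex>[\<partial>]\<close>-module is a module in the sense of \<^locale>\<open>module\<close> whose scalars are
  \<^typ>\<open>complex poly\<close>, the variable of the scalars being \<open>\<partial>\<close>.  An element of \<open>M[\<lambda>]\<close> is a
  polynomial over the type of \<open>M\<close>.  The operation below substitutes a polynomial \<open>t\<close> in \<open>\<partial>\<close>
  for \<open>\<lambda>\<close>.  The two substitutions that occur are a complex number \<open>z\<close> (\<open>t = [:z:]\<close>) and the
  operator \<open>- z - \<partial>\<close> (\<open>t = [:-z, -1:]\<close>), where powers of \<open>\<partial>\<close> act on the coefficients.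

  Identities in \<open>M[\<lambda>]\<close> and \<open>M[\<lambda>,\<mu>]\<close> are stated below as identities of the values at all
  complex numbers.  Since \<open>\<complex>\<close> is infinite this is the same as the identity of polynomials, see
  \<open>subst_lam_eqI\<close>.
\<close>

definition subst_lam :: "(complex poly \<Rightarrow> 'm \<Rightarrow> 'm) \<Rightarrow> complex poly \<Rightarrow> 'm poly \<Rightarrow> 'm::ab_group_add"
  where "subst_lam sc t p = (\<Sum>i\<le>degree p. sc (t ^ i) (coeff p i))"

lemma power_sums_zero_imp_zero:
  fixes sc :: "complex poly \<Rightarrow> 'm \<Rightarrow> 'm::ab_group_add" and c :: "nat \<Rightarrow> 'm"
  assumes "module sc" and "\<forall>z. (\<Sum>i<n. sc ([:z:] ^ i) (c i)) = 0" and "i < n"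
  shows "c i = 0"
  using assms(2,3)
proof (induction n arbitrary: c i)
  case 0
  then show ?case by simp
next
  case (Suc n)
  interpret module sc by (rule assms(1))
  have low: "c i = 0" if "i < n" for i
  proof -
    let ?d = "\<lambda>i. sc ([:2:] ^ i - [:2:] ^ n) (c i)"
    have "(\<Sum>i<n. sc ([:z:] ^ i) (?d i)) = 0" for z :: complex
    proof -
      have "0 = (\<Sum>i<Suc n. sc ([:2 * z:] ^ i) (c i))
          - sc ([:2:] ^ n) (\<Sum>i<Suc n. sc ([:z:] ^ i) (c i))"
        using Suc.prems(1) by simp
      also have "\<dots> = (\<Sum>i<Suc n. sc ([:2 * z:] ^ i - [:2:] ^ n * [:z:] ^ i) (c i))"
        by (simp only: scale_sum_right scale_scale sum_subtractf scale_left_diff_distrib)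
      also have "\<dots> = (\<Sum>i<n. sc ([:2 * z:] ^ i - [:2:] ^ n * [:z:] ^ i) (c i))"
        by (simp add: poly_const_pow power_mult_distrib)
      also have "\<dots> = (\<Sum>i<n. sc ([:z:] ^ i) (?d i))"
      proof (rule sum.cong)
        fix i
        have "[:2 * z:] ^ i - [:2:] ^ n * [:z:] ^ i = [:z:] ^ i * ([:2:] ^ i - [:2:] ^ n)"
          by (simp add: poly_const_pow power_mult_distrib algebra_simps)
        then show "sc ([:2 * z:] ^ i - [:2:] ^ n * [:z:] ^ i) (c i) = sc ([:z:] ^ i) (?d i)"
          by (simp only: scale_scale)
      qed simp
      finally show ?thesis by simp
    qed
    then have d0: "?d i = 0"
      using Suc.IH[of ?d i] that by blast
    have ne: "(2::complex) ^ i - 2 ^ n \<noteq> 0"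
    proof
      assume "(2::complex) ^ i - 2 ^ n = 0"
      then have "(of_nat (2 ^ i) :: complex) = of_nat (2 ^ n)" by simp
      then have "(2::nat) ^ i = 2 ^ n" using of_nat_eq_iff by blast
      then show False using that by simp
    qed
    have "c i = sc ([:inverse (2 ^ i - 2 ^ n):] * ([:2:] ^ i - [:2:] ^ n)) (c i)"
      using ne by (simp add: poly_const_pow flip: one_pCons)
    then show ?thesis using d0 by (simp only: scale_scale[symmetric] scale_zero_right)
  qed
  have "(\<Sum>i<Suc n. sc ([:1:] ^ i) (c i)) = 0" using Suc.prems(1) by blast
  then have "c n = 0" using low by (simp flip: one_pCons)
  then show ?case using low Suc.prems(2) by (cases "i = n") auto
qed

lemma subst_lam_eqI:
  fixes sc :: "complex poly \<Rightarrow> 'm \<Rightarrow> 'm::ab_group_add" and p q :: "'m poly"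
  assumes "module sc" and "\<And>z. subst_lam sc [:z:] p = subst_lam sc [:z:] q"
  shows "p = q"
proof -
  interpret module sc by (rule assms(1))
  let ?n = "Suc (max (degree p) (degree q))"
  have ext: "subst_lam sc [:z:] r = (\<Sum>i<?n. sc ([:z:] ^ i) (coeff r i))"
    if "degree r < ?n" for r :: "'m poly" and z
    unfolding subst_lam_def using that
    by (intro sum.mono_neutral_left) (auto simp: not_le coeff_eq_0)
  have z0: "\<forall>z. (\<Sum>i<?n. sc ([:z:] ^ i) (coeff p i - coeff q i)) = 0"
  proof
    fix z
    have "(\<Sum>i<?n. sc ([:z:] ^ i) (coeff p i)) = (\<Sum>i<?n. sc ([:z:] ^ i) (coeff q i))"
      using assms(2)[of z] ext[of p z] ext[of q z] by simp
    then show "(\<Sum>i<?n. sc ([:z:] ^ i) (coeff p i - coeff q i)) = 0"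
      by (simp only: scale_right_diff_distrib sum_subtractf) simp
  qed
  have "coeff p i - coeff q i = 0" for i
    using power_sums_zero_imp_zero[OF assms(1) z0, of i]
    by (cases "i < ?n") (auto simp: coeff_eq_0)
  then show ?thesis by (simp add: poly_eq_iff)
qed

text \<open>\<open>\<complex>[\<partial>,\<lambda>]\<close> is rendered as \<open>\<complex>[\<partial>][\<lambda>]\<close>: the outer variable is \<open>\<lambda>\<close>, the inner one \<open>\<partial>\<close>.\<close>

abbreviation cst :: "complex \<Rightarrow> complex poly poly" where "cst c \<equiv> [:[:c:]:]"
abbreviation del :: "complex poly poly" where "del \<equiv> [:[:0, 1:]:]"
abbreviation lam :: "complex poly poly" where "lam \<equiv> [:0, 1:]"

definition app_poly :: "(complex poly \<Rightarrow> 'm \<Rightarrow> 'm) \<Rightarrow> complex poly poly \<Rightarrow> 'm \<Rightarrow> 'm::ab_group_add poly"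
  where "app_poly sc f v = map_poly (\<lambda>p. sc p v) f"

definition free_basis :: "(complex poly \<Rightarrow> 'm \<Rightarrow> 'm) \<Rightarrow> 'm::ab_group_add set \<Rightarrow> bool"
  where "free_basis sc X \<longleftrightarrow> \<not> module.dependent sc X \<and> module.span sc X = UNIV"

definition poly_bilinear ::
  "(complex poly \<Rightarrow> 'r \<Rightarrow> 'r) \<Rightarrow> (complex poly \<Rightarrow> 'm \<Rightarrow> 'm) \<Rightarrow> ('r::ab_group_add \<Rightarrow> 'm::ab_group_add \<Rightarrow> 'm poly) \<Rightarrow> bool"
  where "poly_bilinear scr scm F \<longleftrightarrow>
    (\<forall>a b x. F (a + b) x = F a x + F b x) \<and>
    (\<forall>a x y. F a (x + y) = F a x + F a y) \<and>
    (\<forall>c a x. F (scr [:c:] a) x = map_poly (scm [:c:]) (F a x)) \<and>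
    (\<forall>c a x. F a (scm [:c:] x) = map_poly (scm [:c:]) (F a x))"


section \<open>Lie conformal algebras and conformal modules\<close>

record (overloaded) 'r lca =
  rscale :: "complex poly \<Rightarrow> 'r \<Rightarrow> 'r"
  bracket :: "'r::ab_group_add \<Rightarrow> 'r \<Rightarrow> 'r poly"

definition lie_conformal_algebra :: "'r::ab_group_add lca \<Rightarrow> bool"
  where "lie_conformal_algebra R \<longleftrightarrow>
    module (rscale R) \<and>
    poly_bilinear (rscale R) (rscale R) (bracket R) \<and>
    (let D = rscale R [:0, 1:]; br = (\<lambda>t a b. subst_lam (rscale R) t (bracket R a b)) in
      (\<forall>z a b. br [:z:] (D a) b = rscale R [:-z:] (br [:z:] a b)) \<and>
      (\<forall>z a b. br [:z:] a (D b) = rscale R [:z, 1:] (br [:z:] a b)) \<and>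
      (\<forall>z a b. br [:z:] a b = - br [:-z, -1:] b a) \<and>
      (\<forall>z w a b c. br [:z:] a (br [:w:] b c) =
         br [:z + w:] (br [:z:] a b) c + br [:w:] b (br [:z:] a c)))"

record (overloaded) ('r, 'm) cmod =
  mscale :: "complex poly \<Rightarrow> 'm \<Rightarrow> 'm"
  act :: "'r::ab_group_add \<Rightarrow> 'm::ab_group_add \<Rightarrow> 'm poly"

definition conformal_module :: "'r::ab_group_add lca \<Rightarrow> ('r, 'm::ab_group_add) cmod \<Rightarrow> bool"
  where "conformal_module R M \<longleftrightarrow>
    module (mscale M) \<and>
    poly_bilinear (rscale R) (mscale M) (act M) \<and>
    (let D = mscale M [:0, 1:]; ac = (\<lambda>z a x. subst_lam (mscale M) [:z:] (act M a x));
         br = (\<lambda>z a b. subst_lam (rscale R) [:z:] (bracket R a b)) in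
      (\<forall>z a x. ac z (rscale R [:0, 1:] a) x = mscale M [:-z:] (ac z a x)) \<and>
      (\<forall>z a x. ac z a (D x) = mscale M [:z, 1:] (ac z a x)) \<and>
      (\<forall>z w a b x. ac z a (ac w b x) = ac (z + w) (br z a b) x + ac w b (ac z a x)))"

definition conformal_hom ::
  "('r::ab_group_add, 'm::ab_group_add) cmod \<Rightarrow> ('r, 'n::ab_group_add) cmod \<Rightarrow> ('m \<Rightarrow> 'n) \<Rightarrow> bool"
  where "conformal_hom M N h \<longleftrightarrow>
    module_hom (mscale M) (mscale N) h \<and>
    (\<forall>a x. act N a (h x) = map_poly h (act M a x))"


section \<open>Extensions\<close>

record (overloaded) ('r, 'v, 'w, 'e) extension =
  emod :: "('r::ab_group_add, 'e::ab_group_add) cmod"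
  einj :: "'v::ab_group_add \<Rightarrow> 'e"
  eproj :: "'e \<Rightarrow> 'w::ab_group_add"

definition is_extension ::
  "'r::ab_group_add lca \<Rightarrow> ('r, 'w::ab_group_add) cmod \<Rightarrow> ('r, 'v::ab_group_add) cmod
    \<Rightarrow> ('r, 'v, 'w, 'e::ab_group_add) extension \<Rightarrow> bool"
  where "is_extension R W V E \<longleftrightarrow>
    conformal_module R (emod E) \<and>
    conformal_hom V (emod E) (einj E) \<and> conformal_hom (emod E) W (eproj E) \<and>
    inj (einj E) \<and> surj (eproj E) \<and> range (einj E) = {x. eproj E x = 0}"

definition equivalent_ext ::
  "('r::ab_group_add, 'v::ab_group_add, 'w::ab_group_add, 'e::ab_group_add) extension
    \<Rightarrow> ('r, 'v, 'w, 'f::ab_group_add) extension \<Rightarrow> bool"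
  where "equivalent_ext E F \<longleftrightarrow>
    (\<exists>h. conformal_hom (emod E) (emod F) h \<and>
      (\<forall>x. h (einj E x) = einj F x) \<and> (\<forall>x. eproj F (h x) = eproj E x))"

text \<open>
  The structure on \<open>V \<oplus> W\<close> with \<open>a\<^sub>\<lambda>(x, y) = (a\<^sub>\<lambda>x + \<phi>\<^sub>\<lambda>(a, y), a\<^sub>\<lambda>y)\<close>, for a map
  \<open>\<phi> : R \<times> W \<rightarrow> V[\<lambda>]\<close>.  The map \<open>\<phi>\<close> is an extension cocycle if this is a conformal module.
\<close>

definition cocycle_ext ::
  "('r::ab_group_add, 'w::ab_group_add) cmod \<Rightarrow> ('r, 'v::ab_group_add) cmod
    \<Rightarrow> ('r \<Rightarrow> 'w \<Rightarrow> 'v poly) \<Rightarrow> ('r, 'v, 'w, 'v \<times> 'w) extension"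
  where "cocycle_ext W V \<phi> =
    \<lparr> emod = \<lparr> mscale = (\<lambda>p (x, y). (mscale V p x, mscale W p y)),
               act = (\<lambda>a (x, y). map_poly (\<lambda>x'. (x', 0)) (act V a x + \<phi> a y)
                                + map_poly (\<lambda>y'. (0, y')) (act W a y)) \<rparr>,
      einj = (\<lambda>x. (x, 0)), eproj = snd \<rparr>"

abbreviation direct_sum_ext ::
  "('r::ab_group_add, 'w::ab_group_add) cmod \<Rightarrow> ('r, 'v::ab_group_add) cmod \<Rightarrow> ('r, 'v, 'w, 'v \<times> 'w) extension"
  where "direct_sum_ext W V \<equiv> cocycle_ext W V (\<lambda>a y. 0)"

definition trivial_ext ::
  "('r::ab_group_add, 'w::ab_group_add) cmod \<Rightarrow> ('r, 'v::ab_group_add) cmod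
    \<Rightarrow> ('r, 'v, 'w, 'e::ab_group_add) extension \<Rightarrow> bool"
  where "trivial_ext W V E \<longleftrightarrow> equivalent_ext E (direct_sum_ext W V)"

definition cocycles ::
  "'r::ab_group_add lca \<Rightarrow> ('r, 'w::ab_group_add) cmod \<Rightarrow> ('r, 'v::ab_group_add) cmod
    \<Rightarrow> ('r \<Rightarrow> 'w \<Rightarrow> 'v poly) set"
  where "cocycles R W V = {\<phi>. conformal_module R (emod (cocycle_ext W V \<phi>))}"

definition trivial_cocycles ::
  "'r::ab_group_add lca \<Rightarrow> ('r, 'w::ab_group_add) cmod \<Rightarrow> ('r, 'v::ab_group_add) cmod
    \<Rightarrow> ('r \<Rightarrow> 'w \<Rightarrow> 'v poly) set"
  where "trivial_cocycles R W V = {\<phi> \<in> cocycles R W V. trivial_ext W V (cocycle_ext W V \<phi>)}"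

text \<open>
  A complex vector space given by carrier, addition, zero and scalar multiplication has
  dimension \<open>n\<close> if it has a basis of length \<open>n\<close>, i.e. a list of vectors in terms of which
  each vector is a linear combination with unique coefficients.
\<close>

definition has_dimension ::
  "'x set \<Rightarrow> ('x \<Rightarrow> 'x \<Rightarrow> 'x) \<Rightarrow> 'x \<Rightarrow> (complex \<Rightarrow> 'x \<Rightarrow> 'x) \<Rightarrow> nat \<Rightarrow> bool"
  where "has_dimension X add zero sc n \<longleftrightarrow>
    (\<exists>bs. length bs = n \<and> set bs \<subseteq> X \<and>
      (\<forall>x\<in>X. \<exists>!cs. length cs = n \<and> x = foldr add (map2 sc cs bs) zero))"

text \<open>
  \<open>Ext(W, V)\<close> is the quotient of the cocycles by the trivial cocycles.  Its elements are the cosets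
  \<open>\<phi> +o trivial_cocycles R W V\<close>; cosets are added as sets, and the trivial cocycles are added
  to a scalar multiple so that multiplication by \<open>0\<close> gives the whole zero coset.
\<close>

definition Ext ::
  "'r::ab_group_add lca \<Rightarrow> ('r, 'w::ab_group_add) cmod \<Rightarrow> ('r, 'v::ab_group_add) cmod
    \<Rightarrow> ('r \<Rightarrow> 'w \<Rightarrow> 'v poly) set set"
  where "Ext R W V = (\<lambda>\<phi>. \<phi> +o trivial_cocycles R W V) ` cocycles R W V"

definition Ext_scale ::
  "'r::ab_group_add lca \<Rightarrow> ('r, 'w::ab_group_add) cmod \<Rightarrow> ('r, 'v::ab_group_add) cmod
    \<Rightarrow> complex \<Rightarrow> ('r \<Rightarrow> 'w \<Rightarrow> 'v poly) set \<Rightarrow> ('r \<Rightarrow> 'w \<Rightarrow> 'v poly) set"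
  where "Ext_scale R W V c X =
    (\<lambda>\<phi> a y. map_poly (mscale V [:c:]) (\<phi> a y)) ` X + trivial_cocycles R W V"

definition dim_Ext_is ::
  "'r::ab_group_add lca \<Rightarrow> ('r, 'w::ab_group_add) cmod \<Rightarrow> ('r, 'v::ab_group_add) cmod \<Rightarrow> nat \<Rightarrow> bool"
  where "dim_Ext_is R W V n \<longleftrightarrow>
    has_dimension (Ext R W V) (+) (trivial_cocycles R W V) (Ext_scale R W V) n"


section \<open>The direct sum of two Virasoro conformal algebras and its rank one modules\<close>

definition virasoro_sum :: "'r::ab_group_add lca \<Rightarrow> 'r \<Rightarrow> 'r \<Rightarrow> bool"
  where "virasoro_sum R A B \<longleftrightarrow>
    lie_conformal_algebra R \<and> A \<noteq> B \<and> free_basis (rscale R) {A, B} \<and>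
    bracket R A A = app_poly (rscale R) (del + 2 * lam) A \<and>
    bracket R A B = 0 \<and>
    bracket R B B = app_poly (rscale R) (del + 2 * lam) B"

definition rank_one_module ::
  "'r::ab_group_add lca \<Rightarrow> 'r \<Rightarrow> 'r \<Rightarrow> complex \<Rightarrow> complex \<Rightarrow> complex \<Rightarrow> complex \<Rightarrow> complex \<Rightarrow> complex
    \<Rightarrow> ('r, 'v::ab_group_add) cmod \<Rightarrow> 'v \<Rightarrow> bool"
  where "rank_one_module R A B \<delta>1 \<alpha>1 \<beta>1 \<delta>2 \<alpha>2 \<beta>2 V v \<longleftrightarrow>
    conformal_module R V \<and> free_basis (mscale V) {v} \<and>
    act V A v = app_poly (mscale V) (cst \<delta>1 * (del + cst \<alpha>1 * lam + cst \<beta>1)) v \<and>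
    act V B v = app_poly (mscale V) (cst \<delta>2 * (del + cst \<alpha>2 * lam + cst \<beta>2)) v"

text \<open>
  The parameters for which this module is nontrivial and irreducible.  If \<open>\<delta>\<^sub>i = 0\<close>, then
  \<open>\<alpha>\<^sub>i\<close> and \<open>\<beta>\<^sub>i\<close> do not enter the module structure, and they are left arbitrary.
\<close>

definition irreducible_params :: "complex \<Rightarrow> complex \<Rightarrow> complex \<Rightarrow> complex \<Rightarrow> bool"
  where "irreducible_params \<delta>1 \<alpha>1 \<delta>2 \<alpha>2 \<longleftrightarrow>
    \<delta>1 \<in> {0, 1} \<and> \<delta>2 \<in> {0, 1} \<and> \<delta>1\<^sup>2 + \<delta>2\<^sup>2 = 1 \<and>
    (\<delta>1 = 1 \<longrightarrow> \<alpha>1 \<noteq> 0) \<and> (\<delta>2 = 1 \<longrightarrow> \<alpha>2 \<noteq> 0)"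

text \<open>
  \<open>E = \<complex>[\<partial>]v \<oplus> \<complex>[\<partial>]u\<close> where \<open>u\<close> is a lift of the generator of the quotient, and the
  action is
  \<open>A\<^sub>\<lambda>u = \<delta>\<^sub>1'(\<partial> + \<alpha>\<^sub>1'\<lambda> + \<beta>\<^sub>1')u + f(\<partial>,\<lambda>)v\<close> and
  \<open>B\<^sub>\<lambda>u = \<delta>\<^sub>2'(\<partial> + \<alpha>\<^sub>2'\<lambda> + \<beta>\<^sub>2')u + g(\<partial>,\<lambda>)v\<close>,
  together with the given action on \<open>v\<close>.  The primed parameters belong to the quotient.
\<close>

definition given_by ::
  "'r::ab_group_add \<Rightarrow> 'r \<Rightarrow> complex \<Rightarrow> complex \<Rightarrow> complex \<Rightarrow> complex \<Rightarrow> complex \<Rightarrow> complex \<Rightarrow> 'v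
    \<Rightarrow> complex \<Rightarrow> complex \<Rightarrow> complex \<Rightarrow> complex \<Rightarrow> complex \<Rightarrow> complex \<Rightarrow> 'w
    \<Rightarrow> ('r, 'v::ab_group_add, 'w::ab_group_add, 'e::ab_group_add) extension
    \<Rightarrow> complex poly poly \<Rightarrow> complex poly poly \<Rightarrow> bool"
  where "given_by A B \<delta>1 \<alpha>1 \<beta>1 \<delta>2 \<alpha>2 \<beta>2 v \<delta>1' \<alpha>1' \<beta>1' \<delta>2' \<alpha>2' \<beta>2' w E f g \<longleftrightarrow>
    (\<exists>u. eproj E u = w \<and>
      (let sc = mscale (emod E); ac = act (emod E); v' = einj E v in
        v' \<noteq> u \<and> free_basis sc {v', u} \<and>
        ac A v' = app_poly sc (cst \<delta>1 * (del + cst \<alpha>1 * lam + cst \<beta>1)) v' \<and>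
        ac B v' = app_poly sc (cst \<delta>2 * (del + cst \<alpha>2 * lam + cst \<beta>2)) v' \<and>
        ac A u = app_poly sc (cst \<delta>1' * (del + cst \<alpha>1' * lam + cst \<beta>1')) u + app_poly sc f v' \<and>
        ac B u = app_poly sc (cst \<delta>2' * (del + cst \<alpha>2' * lam + cst \<beta>2')) u + app_poly sc g v'))"


section \<open>The subcases\<close>

datatype subcase = Sub_i | Sub_ii | Sub_iii | Sub_iv | Sub_v | Sub_vi

text \<open>Here \<open>\<alpha>'\<close> is the parameter of the quotient.\<close>

fun subcase_params :: "subcase \<Rightarrow> complex \<Rightarrow> complex \<Rightarrow> bool" where
  "subcase_params Sub_i \<alpha> \<alpha>' \<longleftrightarrow> \<alpha>' = \<alpha>"
| "subcase_params Sub_ii \<alpha> \<alpha>' \<longleftrightarrow> \<alpha>' - \<alpha> = 2"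
| "subcase_params Sub_iii \<alpha> \<alpha>' \<longleftrightarrow> \<alpha>' - \<alpha> = 3"
| "subcase_params Sub_iv \<alpha> \<alpha>' \<longleftrightarrow> \<alpha>' - \<alpha> = 4"
| "subcase_params Sub_v \<alpha> \<alpha>' \<longleftrightarrow> \<alpha>' = 1 \<and> \<alpha> = - 4"
| "subcase_params Sub_vi \<alpha> \<alpha>' \<longleftrightarrow>
    (\<exists>\<epsilon>\<in>{1, - 1}. \<alpha>' = 7 / 2 + \<epsilon> * of_real (sqrt 19) / 2 \<and> \<alpha> = - 5 / 2 + \<epsilon> * of_real (sqrt 19) / 2)"

fun subcase_polys :: "subcase \<Rightarrow> complex \<Rightarrow> complex \<Rightarrow> complex poly poly set" where
  "subcase_polys Sub_i \<alpha> \<beta> = {cst s0 + cst s1 * lam | s0 s1. (s0, s1) \<noteq> (0, 0)}"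
| "subcase_polys Sub_ii \<alpha> \<beta> =
    {cst s * lam^2 * (2 * (del + cst \<beta>) + lam) | s. s \<noteq> 0}"
| "subcase_polys Sub_iii \<alpha> \<beta> =
    {cst s * (del + cst \<beta>) * lam^2 * (del + cst \<beta> + lam) | s. s \<noteq> 0}"
| "subcase_polys Sub_iv \<alpha> \<beta> =
    {cst s * lam^2 * (4 * (del + cst \<beta>)^3 + 6 * (del + cst \<beta>)^2 * lam
       - (del + cst \<beta>) * lam^2 + cst \<alpha> * lam^3) | s. s \<noteq> 0}"
| "subcase_polys Sub_v \<alpha> \<beta> =
    {cst s * ((del + cst \<beta>)^4 * lam^2 - 10 * (del + cst \<beta>)^2 * lam^4
       - 17 * (del + cst \<beta>) * lam^5 - 8 * lam^6) | s. s \<noteq> 0}"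
| "subcase_polys Sub_vi \<alpha> \<beta> =
    {cst s * ((del + cst \<beta>)^4 * lam^3 - cst (2 * \<alpha> + 3) * (del + cst \<beta>)^3 * lam^4
       - cst (3 * \<alpha>) * (del + cst \<beta>)^2 * lam^5 - cst (3 * \<alpha> + 1) * (del + cst \<beta>) * lam^6
       - cst (\<alpha> + 9 / 28) * lam^7) | s. s \<noteq> 0}"

fun subcase_dim :: "subcase \<Rightarrow> nat" where
  "subcase_dim Sub_i = 2"
| "subcase_dim Sub_ii = 1"
| "subcase_dim Sub_iii = 1"
| "subcase_dim Sub_iv = 1"
| "subcase_dim Sub_v = 1"
| "subcase_dim Sub_vi = 1"

text \<open>
  The parameters for which the \<open>a\<close>-summand of the algebra acts nontrivially on both the
  submodule (unprimed) and the quotient (primed) while the \<open>b\<close>-summand acts trivially on both,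
  and an extension as in subcase \<open>k\<close> occurs.
\<close>

definition extension_case ::
  "complex \<Rightarrow> complex \<Rightarrow> complex \<Rightarrow> complex \<Rightarrow> complex \<Rightarrow> complex \<Rightarrow> complex \<Rightarrow> complex \<Rightarrow> subcase \<Rightarrow> bool"
  where "extension_case \<delta>a \<alpha>a \<beta>a \<delta>a' \<alpha>a' \<beta>a' \<delta>b \<delta>b' k \<longleftrightarrow>
    \<delta>a = 1 \<and> \<delta>a' = 1 \<and> \<delta>b = 0 \<and> \<delta>b' = 0 \<and> \<beta>a = \<beta>a' \<and>
    \<alpha>a' - \<alpha>a \<in> {0, 1, 2, 3, 4, 5, 6} \<and> \<alpha>a \<noteq> 0 \<and> \<alpha>a' \<noteq> 0 \<and>
    subcase_params k \<alpha>a \<alpha>a'"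

end

theory Submission
  imports Defs
begin

text \<open>
  Choose a lift \<open>u\<close> of the generator of the quotient.  The extension is then determined by two
  polynomials \<open>f\<close> and \<open>g\<close> in \<open>\<partial>\<close> and \<open>\<lambda>\<close>, the \<open>v\<close>-components of \<open>A\<^sub>\<lambda>u\<close> and \<open>B\<^sub>\<lambda>u\<close>.  The module axioms
  are three polynomial identities for this pair, one for each of the brackets \<open>[A, A]\<close>, \<open>[A, B]\<close>,
  \<open>[B, B]\<close> (\<^term>\<open>pair_cocycle_for\<close>), and another lift changes the pair by a coboundary.  Hence
  extensions up to equivalence, and the space Ext, are the solutions of these identities modulo
  coboundaries (\<open>equivalent_cocycle_ext\<close>, \<open>lifted_trivial_ext_iff\<close>, \<open>dim_Ext_from_basis\<close>), and what
  remains is algebra of polynomials.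

  If different summands of the algebra act on the two modules, the identity for \<open>[A, B]\<close> at
  \<open>\<lambda> = 0\<close> is a divisibility which exhibits the pair as a coboundary (\<open>mixed_summands_coboundary\<close>).
  If the same summand acts on both, say that of \<open>A\<close>, the identity for \<open>[B, B]\<close> forces \<open>g = 0\<close>, and
  \<open>f\<close> is a cocycle of a single Virasoro algebra.

  The equation of such a cocycle \<open>f(\<partial>, \<lambda>)\<close>, in the variables \<open>\<partial>, \<lambda>, \<mu>\<close>, is solved by comparing
  coefficients.  Primes denote the parameters of the quotient.  Setting \<open>\<mu> = 0\<close> shows that \<open>f\<close> is a
  coboundary if \<open>\<beta>' \<noteq> \<beta>\<close>; otherwise \<open>\<partial>\<close> may be shifted so that \<open>\<beta> = \<beta>' = 0\<close>.  The coefficient of \<open>\<mu>\<close>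
  is an equation of Euler type: modulo coboundaries, \<open>f\<close> is homogeneous of degree
  \<open>\<alpha>' - \<alpha> + 1\<close>, and it is divisible by \<open>\<lambda>\<^sup>2\<close> unless \<open>\<alpha>' = \<alpha>\<close>, where \<open>f\<close> is a polynomial of degree at most
  one in \<open>\<lambda>\<close> alone (\<open>cocycle_normal_form\<close>).

  Let \<open>k = \<alpha>' - \<alpha> \<ge> 1\<close> and \<open>f = \<Sum> a\<^sub>i \<partial>\<^bsup>k+1-i\<^esup>\<lambda>\<^sup>i\<close>.  The coefficients of \<open>\<lambda>\<^sup>i\<mu>\<^sup>2\<close> for \<open>i \<ge> 3\<close> express \<open>a\<^bsub>i+1\<^esub>\<close>
  by \<open>a\<^sub>2\<close> and \<open>a\<^sub>i\<close>, so that \<open>f\<close> is determined by \<open>a\<^sub>2\<close> and \<open>a\<^sub>3\<close>.  The coboundary of \<open>\<partial>\<^sup>k\<close> is a nonzero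
  homogeneous cocycle, so at most one further dimension is left.  For \<open>k = 1\<close> nothing is left, and
  for \<open>k = 2, 3, 4\<close> the listed polynomials fill it.  For \<open>k \<ge> 5\<close> put \<open>y = 2\<alpha> + k - 1\<close>.  If \<open>y \<noteq> 0\<close>, one
  may subtract a coboundary to obtain \<open>a\<^sub>2 = 0\<close>; then the recursion is a product formula, and the
  coefficient of \<open>\<lambda>\<^sup>3\<mu>\<^sup>4\<close> becomes \<open>y\<^sup>2 = 3k + 1\<close>.  For \<open>k \<ge> 7\<close> the coefficient of \<open>\<lambda>\<^sup>4\<mu>\<^sup>5\<close> gives a cubic
  equation for \<open>y\<close> which contradicts this.  If \<open>y = 0\<close>, one may obtain \<open>a\<^sub>3 = 0\<close>, and the coefficient of
  \<open>\<lambda>\<^sup>3\<mu>\<^sup>4\<close> excludes \<open>a\<^sub>2 \<noteq> 0\<close>.  There remain \<open>k = 5\<close>, \<open>y = \<plusminus>4\<close> and \<open>k = 6\<close>, \<open>y\<^sup>2 = 19\<close>, which are the two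
  exceptional cases, as \<open>\<alpha> \<noteq> 0\<close>.
\<close>

section \<open>Polynomials in two variables as functions\<close>

definition ev :: "complex poly poly \<Rightarrow> complex \<Rightarrow> complex \<Rightarrow> complex" where
  "ev F x l = poly (poly F [:l:]) x"

lemma ev_simps [simp]:
  "ev (F + G) x l = ev F x l + ev G x l"
  "ev (F - G) x l = ev F x l - ev G x l"
  "ev (- F) x l = - ev F x l"
  "ev (F * G) x l = ev F x l * ev G x l"
  "ev (F ^ n) x l = ev F x l ^ n"
  "ev 0 x l = 0" "ev 1 x l = 1" "ev (numeral k) x l = numeral k"
  by (simp_all add: ev_def)

lemma ev_pCons_smult [simp]:
  "ev (pCons p F) x l = poly p x + l * ev F x l"
  "ev (smult p F) x l = poly p x * ev F x l"
  by (simp_all add: ev_def)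

lemma ev_sum: "ev (sum F I) x l = (\<Sum>i\<in>I. ev (F i) x l)"
  by (simp add: ev_def poly_sum)

text \<open>
  A nonzero polynomial has finitely many roots, also when its coefficients are polynomials, and the
  constants are already infinitely many.
\<close>

lemma poly_zero_at_constants:
  fixes P :: "'a::{idom,ring_char_0} poly poly"
  assumes "\<And>z. poly P [:z:] = 0"
  shows "P = 0"
proof (rule ccontr)
  assume "P \<noteq> 0"
  then have "finite {x. poly P x = 0}" by (rule poly_roots_finite)
  moreover have "range (\<lambda>z::'a. [:z:]) \<subseteq> {x. poly P x = 0}" using assms by auto
  moreover have "infinite (range (\<lambda>z::'a. [:z:]))"
    by (rule range_inj_infinite[of "\<lambda>n. [:of_nat n :: 'a:]", THEN infinite_super[rotated]])
       (auto simp: inj_def)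
  ultimately show False using finite_subset by blast
qed

lemma ev_eqI:
  assumes "\<And>x l. ev F x l = ev G x l"
  shows "F = G"
proof -
  have "F - G = 0"
  proof (rule poly_zero_at_constants)
    fix z
    show "poly (F - G) [:z:] = 0"
      using assms by (intro poly_ext) (simp add: ev_def)
  qed
  then show ?thesis by simp
qed

lemma poly_as_sum:
  fixes p :: "'a::comm_semiring_1 poly"
  assumes "degree p \<le> N"
  shows "poly p x = (\<Sum>i\<le>N. coeff p i * x ^ i)"
  unfolding poly_altdef using assms
  by (intro sum.mono_neutral_left) (auto simp: not_le coeff_eq_0)

text \<open>
  A crude common bound for the exponents of both variables; only finiteness matters.
\<close>

definition bideg :: "complex poly poly \<Rightarrow> nat" where
  "bideg F = degree F + (\<Sum>i\<le>degree F. degree (coeff F i))"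

lemma bideg_bounds: "degree F \<le> bideg F" "degree (coeff F i) \<le> bideg F"
proof -
  show "degree F \<le> bideg F" by (simp add: bideg_def)
  show "degree (coeff F i) \<le> bideg F"
  proof (cases "i \<le> degree F")
    case True
    then have "degree (coeff F i) \<le> (\<Sum>i\<le>degree F. degree (coeff F i))"
      by (intro member_le_sum) auto
    then show ?thesis by (simp add: bideg_def)
  qed (simp add: coeff_eq_0)
qed

lemma coeff_beyond_bideg: "bideg F < q \<or> bideg F < r \<Longrightarrow> coeff (coeff F r) q = 0"
  by (metis bideg_bounds coeff_0 coeff_eq_0 le_less_trans)

lemma ev_as_sum:
  "ev F x l = (\<Sum>q\<le>bideg F. \<Sum>r\<le>bideg F. coeff (coeff F r) q * (x ^ q * l ^ r))"
proof -
  have "ev F x l = poly (\<Sum>r\<le>bideg F. coeff F r * [:l:] ^ r) x"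
    unfolding ev_def by (subst poly_as_sum[OF bideg_bounds(1)]) simp
  also have "\<dots> = (\<Sum>r\<le>bideg F. (\<Sum>q\<le>bideg F. coeff (coeff F r) q * x ^ q) * l ^ r)"
    by (simp add: poly_sum poly_as_sum[OF bideg_bounds(2)])
  also have "\<dots> = (\<Sum>r\<le>bideg F. \<Sum>q\<le>bideg F. coeff (coeff F r) q * (x ^ q * l ^ r))"
    by (simp add: sum_distrib_left algebra_simps)
  also have "\<dots> = (\<Sum>q\<le>bideg F. \<Sum>r\<le>bideg F. coeff (coeff F r) q * (x ^ q * l ^ r))"
    by (rule sum.swap)
  finally show ?thesis .
qed

section \<open>Coefficients of polynomials in three variables\<close>

abbreviation X3 :: "complex poly poly poly" where "X3 \<equiv> [:[:[:0, 1:]:]:]"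
abbreviation L3 :: "complex poly poly poly" where "L3 \<equiv> [:[:0, 1:]:]"
abbreviation M3 :: "complex poly poly poly" where "M3 \<equiv> [:0, 1:]"

definition ev3 :: "complex poly poly poly \<Rightarrow> complex \<Rightarrow> complex \<Rightarrow> complex \<Rightarrow> complex" where
  "ev3 P x l m = poly (poly (poly P [:[:m:]:]) [:l:]) x"

definition coeff3 :: "complex poly poly poly \<Rightarrow> nat \<Rightarrow> nat \<Rightarrow> nat \<Rightarrow> complex" where
  "coeff3 P p i j = coeff (coeff (coeff P j) i) p"

text \<open>
  The cocycle equation involves \<open>\<partial>\<close>, \<open>\<lambda>\<close> and \<open>\<mu>\<close>.  It is turned into equations for coefficients
  in \<open>\<complex>[\<partial>][\<lambda>][\<mu>]\<close>; in \<^term>\<open>coeff3 P p i j\<close> the exponents are those of \<open>\<partial>\<close>, \<open>\<lambda>\<close>, \<open>\<mu>\<close>, in this order.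
\<close>

lemma ev3_simps [simp]:
  "ev3 (P + Q) x l m = ev3 P x l m + ev3 Q x l m"
  "ev3 (P - Q) x l m = ev3 P x l m - ev3 Q x l m"
  "ev3 (P * Q) x l m = ev3 P x l m * ev3 Q x l m"
  "ev3 (P ^ n) x l m = ev3 P x l m ^ n"
  "ev3 (sum G I) x l m = (\<Sum>i\<in>I. ev3 (G i) x l m)"
  "ev3 [:[:[:c:]:]:] x l m = c" "ev3 X3 x l m = x" "ev3 L3 x l m = l" "ev3 M3 x l m = m"
  by (simp_all add: ev3_def poly_sum)

lemma ev3_eq_0D:
  assumes "\<And>x l m. ev3 P x l m = 0"
  shows "P = 0"
proof -
  have P: "poly P [:[:m:]:] = 0" for m
  proof (rule poly_zero_at_constants)
    fix z
    show "poly (poly P [:[:m:]:]) [:z:] = 0"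
      using assms by (intro poly_ext) (simp add: ev3_def)
  qed
  show ?thesis
  proof (rule ccontr)
    assume "P \<noteq> 0"
    then have "finite {x. poly P x = 0}" by (rule poly_roots_finite)
    moreover have "range (\<lambda>n. [:[:of_nat n:]:]) \<subseteq> {x. poly P x = 0}" using P by auto
    moreover have "infinite (range (\<lambda>n::nat. [:[:of_nat n :: complex:]:]))"
      by (rule range_inj_infinite) (auto simp: inj_def)
    ultimately show False using finite_subset by blast
  qed
qed

lemma coeff3_linear [simp]:
  "coeff3 (P + Q) p i j = coeff3 P p i j + coeff3 Q p i j"
  "coeff3 (P - Q) p i j = coeff3 P p i j - coeff3 Q p i j"
  "coeff3 (sum G I) p i j = (\<Sum>k\<in>I. coeff3 (G k) p i j)"
  "coeff3 0 p i j = 0"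
  "coeff3 ([:[:[:c:]:]:] * P) p i j = c * coeff3 P p i j"
  by (simp_all add: coeff3_def coeff_sum)

lemma coeff3_times_X: "coeff3 (X3 * P) p i j = (if p = 0 then 0 else coeff3 P (p - 1) i j)"
  by (cases p) (simp_all add: coeff3_def)

lemma coeff3_times_L: "coeff3 (L3 * P) p i j = (if i = 0 then 0 else coeff3 P p (i - 1) j)"
  by (cases i) (simp_all add: coeff3_def)

lemma coeff3_times_M: "coeff3 (M3 * P) p i j = (if j = 0 then 0 else coeff3 P p i (j - 1))"
  by (cases j) (simp_all add: coeff3_def)

lemma pCons_0_1_power: "[:0, 1::'a::comm_semiring_1:] ^ n = monom 1 n"
  by (simp add: monom_altdef)

text \<open>
  These products, with an additional factor \<open>\<partial>\<close>, \<open>\<lambda>\<close> or \<open>\<mu>\<close>, are the terms of the cocycle equation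
  of a monomial.
\<close>

lemma coeff3_XL_M: "coeff3 ((X3 + L3) ^ q * M3 ^ r) p i j
    = (if q = p + i \<and> r = j then of_nat (q choose i) else 0)"
proof -
  have "(X3 + L3) ^ q * M3 ^ r = monom ([:[:0, 1:], 1:] ^ q) r"
    by (simp add: pCons_0_1_power poly_const_pow smult_monom)
  then show ?thesis
    by (cases "i \<le> q") (auto simp: coeff3_def coeff_linear_poly_power pCons_0_1_power
        of_nat_poly coeff_eq_0 degree_linear_power)
qed

lemma coeff3_XM_L: "coeff3 ((X3 + M3) ^ q * L3 ^ r) p i j
    = (if q = p + j \<and> r = i then of_nat (q choose j) else 0)"
proof -
  have "(X3 + M3) ^ q * L3 ^ r = smult (monom 1 r) ([:[:[:0, 1:]:], 1:] ^ q)"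
    by (simp add: pCons_0_1_power poly_const_pow)
  then show ?thesis
    by (cases "j \<le> q") (auto simp: coeff3_def coeff_linear_poly_power pCons_0_1_power
        of_nat_poly coeff_eq_0 degree_linear_power poly_const_pow)
qed

lemma coeff3_X_LM: "coeff3 (X3 ^ q * (L3 + M3) ^ r) p i j
    = (if q = p \<and> r = i + j then of_nat (r choose j) else 0)"
proof -
  have "X3 ^ q * (L3 + M3) ^ r = smult [:monom 1 q:] ([:[:0, 1:], 1:] ^ r)"
    by (simp add: pCons_0_1_power poly_const_pow)
  then show ?thesis
    by (cases "j \<le> r") (auto simp: coeff3_def coeff_linear_poly_power pCons_0_1_power
        of_nat_poly coeff_eq_0 degree_linear_power poly_const_pow)
qed

lemma coeff3_X_L: "coeff3 (X3 ^ q * L3 ^ r) p i j = (if q = p \<and> r = i \<and> j = 0 then 1 else 0)"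
  by (cases j) (auto simp: coeff3_def pCons_0_1_power poly_const_pow smult_monom)

lemma coeff3_X_M: "coeff3 (X3 ^ q * M3 ^ r) p i j = (if q = p \<and> r = j \<and> i = 0 then 1 else 0)"
  by (cases i) (auto simp: coeff3_def pCons_0_1_power poly_const_pow smult_monom)

section \<open>Cocycles and coboundaries of one Virasoro algebra\<close>

text \<open>
  The condition that \<open>A\<^sub>\<lambda>u = (\<partial> + \<alpha>'\<lambda> + \<beta>')u + F(\<partial>, \<lambda>)v\<close>, together with
  \<open>A\<^sub>\<lambda>v = (\<partial> + \<alpha>\<lambda> + \<beta>)v\<close>, is compatible with \<open>[A\<^sub>\<lambda>A] = (\<partial> + 2\<lambda>)A\<close>.
\<close>

definition vir_cocycle :: "complex \<Rightarrow> complex \<Rightarrow> complex \<Rightarrow> complex \<Rightarrow> complex poly poly \<Rightarrow> bool" where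
  "vir_cocycle \<alpha> \<beta> \<alpha>' \<beta>' F \<longleftrightarrow> (\<forall>x l m.
     (x + l + \<alpha>' * m + \<beta>') * ev F x l + (x + \<alpha> * l + \<beta>) * ev F (x + l) m
     - (x + m + \<alpha>' * l + \<beta>') * ev F x m - (x + \<alpha> * m + \<beta>) * ev F (x + m) l
     = (l - m) * ev F x (l + m))"

text \<open>
  The polynomial \<open>p(\<partial> + \<lambda>)\<close>, which arises from \<open>A\<^sub>\<lambda>(p(\<partial>)v) = p(\<partial> + \<lambda>)A\<^sub>\<lambda>v\<close>.
\<close>

definition translate :: "complex poly \<Rightarrow> complex poly poly" where
  "translate p = pcompose (map_poly (\<lambda>c. [:c:]) p) [:[:0, 1:], 1:]"

lemma ev_translate [simp]: "ev (translate p) x l = poly p (x + l)"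
  unfolding translate_def ev_def poly_pcompose
  by (induction p) (simp_all add: map_poly_pCons algebra_simps)

definition vir_coboundary :: "complex \<Rightarrow> complex \<Rightarrow> complex \<Rightarrow> complex \<Rightarrow> complex poly \<Rightarrow> complex poly poly" where
  "vir_coboundary \<alpha> \<beta> \<alpha>' \<beta>' \<phi> =
     (del + cst \<alpha> * lam + cst \<beta>) * translate \<phi> - (del + cst \<alpha>' * lam + cst \<beta>') * [:\<phi>:]"

lemma ev_vir_coboundary [simp]:
  "ev (vir_coboundary \<alpha> \<beta> \<alpha>' \<beta>' \<phi>) x l
    = (x + \<alpha> * l + \<beta>) * poly \<phi> (x + l) - (x + \<alpha>' * l + \<beta>') * poly \<phi> x"
  by (simp add: vir_coboundary_def algebra_simps)

lemma vir_coboundary_is_cocycle: "vir_cocycle \<alpha> \<beta> \<alpha>' \<beta>' (vir_coboundary \<alpha> \<beta> \<alpha>' \<beta>' \<phi>)"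
  unfolding vir_cocycle_def ev_vir_coboundary by (auto simp: algebra_simps)

lemma vir_coboundary_linear:
  "vir_coboundary \<alpha> \<beta> \<alpha>' \<beta>' (\<phi> + \<psi>) = vir_coboundary \<alpha> \<beta> \<alpha>' \<beta>' \<phi> + vir_coboundary \<alpha> \<beta> \<alpha>' \<beta>' \<psi>"
  "vir_coboundary \<alpha> \<beta> \<alpha>' \<beta>' (smult s \<phi>) = cst s * vir_coboundary \<alpha> \<beta> \<alpha>' \<beta>' \<phi>"
  by (rule ev_eqI, simp add: algebra_simps)+

text \<open>
  The difference of the two sides of the cocycle equation; that it is linear in \<open>F\<close> and commutes with
  translations of \<open>\<partial>\<close> gives the corresponding properties of cocycles.
\<close>

definition vir_defect where
  "vir_defect \<alpha> \<beta> \<alpha>' \<beta>' F x l m =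
     (x + l + \<alpha>' * m + \<beta>') * ev F x l + (x + \<alpha> * l + \<beta>) * ev F (x + l) m
     - (x + m + \<alpha>' * l + \<beta>') * ev F x m - (x + \<alpha> * m + \<beta>) * ev F (x + m) l
     - (l - m) * ev F x (l + m)"

lemma vir_cocycle_iff_defect: "vir_cocycle \<alpha> \<beta> \<alpha>' \<beta>' F \<longleftrightarrow> (\<forall>x l m. vir_defect \<alpha> \<beta> \<alpha>' \<beta>' F x l m = 0)"
  by (simp add: vir_cocycle_def vir_defect_def)

lemma vir_defect_linear:
  "vir_defect \<alpha> \<beta> \<alpha>' \<beta>' (F + G) x l m = vir_defect \<alpha> \<beta> \<alpha>' \<beta>' F x l m + vir_defect \<alpha> \<beta> \<alpha>' \<beta>' G x l m"
  "vir_defect \<alpha> \<beta> \<alpha>' \<beta>' (F - G) x l m = vir_defect \<alpha> \<beta> \<alpha>' \<beta>' F x l m - vir_defect \<alpha> \<beta> \<alpha>' \<beta>' G x l m"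
  "vir_defect \<alpha> \<beta> \<alpha>' \<beta>' (cst s * F) x l m = s * vir_defect \<alpha> \<beta> \<alpha>' \<beta>' F x l m"
  "vir_defect \<alpha> \<beta> \<alpha>' \<beta>' 0 x l m = 0"
  by (simp_all add: vir_defect_def algebra_simps)

lemma vir_cocycle_linear:
  "vir_cocycle \<alpha> \<beta> \<alpha>' \<beta>' F \<Longrightarrow> vir_cocycle \<alpha> \<beta> \<alpha>' \<beta>' G \<Longrightarrow> vir_cocycle \<alpha> \<beta> \<alpha>' \<beta>' (F + G)"
  "vir_cocycle \<alpha> \<beta> \<alpha>' \<beta>' F \<Longrightarrow> vir_cocycle \<alpha> \<beta> \<alpha>' \<beta>' G \<Longrightarrow> vir_cocycle \<alpha> \<beta> \<alpha>' \<beta>' (F - G)"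
  "vir_cocycle \<alpha> \<beta> \<alpha>' \<beta>' F \<Longrightarrow> vir_cocycle \<alpha> \<beta> \<alpha>' \<beta>' (cst s * F)"
  "vir_cocycle \<alpha> \<beta> \<alpha>' \<beta>' 0"
  unfolding vir_cocycle_iff_defect vir_defect_linear by simp_all

definition shift_del :: "complex \<Rightarrow> complex poly poly \<Rightarrow> complex poly poly" where
  "shift_del b F = map_poly (\<lambda>p. pcompose p [:b, 1:]) F"

lemma ev_shift_del [simp]: "ev (shift_del b F) x l = ev F (x + b) l"
  unfolding shift_del_def ev_def
  by (induction F) (simp_all add: map_poly_pCons poly_pcompose algebra_simps)

text \<open>
  The parameter \<open>\<beta>\<close> occurs only in the combination \<open>\<partial> + \<beta>\<close> and can be removed by a translation.
\<close>

lemma vir_cocycle_shift: "vir_cocycle \<alpha> \<beta> \<alpha>' \<beta> F \<longleftrightarrow> vir_cocycle \<alpha> 0 \<alpha>' 0 (shift_del (- \<beta>) F)"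
proof -
  have "vir_defect \<alpha> 0 \<alpha>' 0 (shift_del (- \<beta>) F) x l m = vir_defect \<alpha> \<beta> \<alpha>' \<beta> F (x - \<beta>) l m" for x l m
    by (simp add: vir_defect_def algebra_simps)
  then show ?thesis unfolding vir_cocycle_iff_defect by (metis add_diff_cancel)
qed

lemma shift_coboundary:
  "shift_del \<beta> (vir_coboundary \<alpha> 0 \<alpha>' 0 \<phi>) = vir_coboundary \<alpha> \<beta> \<alpha>' \<beta> (pcompose \<phi> [:\<beta>, 1:])"
  by (rule ev_eqI) (simp add: poly_pcompose algebra_simps)

section \<open>The cocycle equation in coefficients\<close>

text \<open>
  The coefficient of \<open>\<partial>\<^sup>p\<lambda>\<^bsup>i+2\<^esup>\<mu>\<^bsup>j+1\<^esup>\<close> in the cocycle equation.  For these exponents the term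
  \<open>(\<partial> + \<mu> + \<alpha>'\<lambda>)F(\<partial>, \<mu>)\<close> does not contribute, and \<open>(\<partial> + \<lambda> + \<alpha>'\<mu>)F(\<partial>, \<lambda>)\<close> contributes only if \<open>j = 0\<close>.
\<close>

lemma cocycle_coeff_identity:
  fixes F defines "c \<equiv> (\<lambda>p i. coeff (coeff F i) p)"
  assumes "vir_cocycle \<alpha> 0 \<alpha>' 0 F"
  shows "(if j = 0 then \<alpha>' * c p (i + 2) else 0)
      + c (p + i + 1) (j + 1) * (of_nat ((p + i + 1) choose (i + 2)) + \<alpha> * of_nat ((p + i + 1) choose (i + 1)))
      - c (p + j) (i + 2) * (of_nat ((p + j) choose (j + 1)) + \<alpha> * of_nat ((p + j) choose j))
    = c p (i + j + 2) * (of_nat ((i + j + 2) choose (j + 1)) - of_nat ((i + j + 2) choose j))"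
proof -
  let ?N = "bideg F"
  \<comment> \<open>The cocycle equation is linear; this is its left side minus its right side for the
    monomial \<open>\<partial>\<^sup>q\<lambda>\<^sup>r\<close>.\<close>
  define T where "T q r =
      (X3 + L3 + [:[:[:\<alpha>':]:]:] * M3) * (X3 ^ q * L3 ^ r) + (X3 + [:[:[:\<alpha>:]:]:] * L3) * ((X3 + L3) ^ q * M3 ^ r)
      - (X3 + M3 + [:[:[:\<alpha>':]:]:] * L3) * (X3 ^ q * M3 ^ r) - (X3 + [:[:[:\<alpha>:]:]:] * M3) * ((X3 + M3) ^ q * L3 ^ r)
      - (L3 - M3) * (X3 ^ q * (L3 + M3) ^ r)" for q r :: nat
  define P where "P = (\<Sum>q\<le>?N. \<Sum>r\<le>?N. [:[:[:c q r:]:]:] * T q r)"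
  have "P = 0"
  proof (rule ev3_eq_0D)
    fix x l m
    have term_eq: "c q r * ev3 (T q r) x l m = (x + l + \<alpha>' * m) * (c q r * (x ^ q * l ^ r))
        + (x + \<alpha> * l) * (c q r * ((x + l) ^ q * m ^ r))
        - (x + m + \<alpha>' * l) * (c q r * (x ^ q * m ^ r)) - (x + \<alpha> * m) * (c q r * ((x + m) ^ q * l ^ r))
        - (l - m) * (c q r * (x ^ q * (l + m) ^ r))" for q r
      unfolding T_def ev3_simps by (simp only: algebra_simps)
    have "ev3 P x l m = (\<Sum>q\<le>?N. \<Sum>r\<le>?N. c q r * ev3 (T q r) x l m)"
      unfolding P_def ev3_simps by simp
    also have "\<dots> = (x + l + \<alpha>' * m) * ev F x l + (x + \<alpha> * l) * ev F (x + l) m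
     - (x + m + \<alpha>' * l) * ev F x m - (x + \<alpha> * m) * ev F (x + m) l - (l - m) * ev F x (l + m)"
      unfolding term_eq sum.distrib sum_subtractf sum_distrib_left[symmetric]
      by (simp add: ev_as_sum c_def)
    finally have "ev3 P x l m = (x + l + \<alpha>' * m) * ev F x l + (x + \<alpha> * l) * ev F (x + l) m
     - (x + m + \<alpha>' * l) * ev F x m - (x + \<alpha> * m) * ev F (x + m) l - (l - m) * ev F x (l + m)" .
    then show "ev3 P x l m = 0"
      using assms(2) by (simp add: vir_cocycle_def)
  qed
  then have "coeff3 P p (i + 2) (j + 1) = 0" by simp
  moreover
  have coeffT: "coeff3 (T q r) p (i + 2) (j + 1) =
     (if q = p \<and> r = i + 2 then (if j = 0 then \<alpha>' else 0) else 0)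
   + ((if q = p + i + 1 \<and> r = j + 1 then of_nat ((p + i + 1) choose (i + 2)) else 0)
     + (if q = p + i + 1 \<and> r = j + 1 then \<alpha> * of_nat ((p + i + 1) choose (i + 1)) else 0))
   - ((if q = p + j \<and> r = i + 2 then of_nat ((p + j) choose (j + 1)) else 0)
     + (if q = p + j \<and> r = i + 2 then \<alpha> * of_nat ((p + j) choose j) else 0))
   - ((if q = p \<and> r = i + j + 2 then of_nat ((i + j + 2) choose (j + 1)) else 0)
     - (if q = p \<and> r = i + j + 2 then of_nat ((i + j + 2) choose j) else 0))"
    for q r
  proof -
    have 1: "coeff3 ((X3 + L3 + [:[:[:\<alpha>':]:]:] * M3) * (X3 ^ q * L3 ^ r)) p (i + 2) (j + 1)
      = (if q = p \<and> r = i + 2 then (if j = 0 then \<alpha>' else 0) else 0)"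
      unfolding distrib_right mult.assoc coeff3_linear coeff3_times_X coeff3_times_L coeff3_times_M coeff3_X_L
      by auto
    have 2: "coeff3 (X3 * ((X3 + L3) ^ q * M3 ^ r)) p (i + 2) (j + 1)
      = (if q = p + i + 1 \<and> r = j + 1 then of_nat ((p + i + 1) choose (i + 2)) else 0)"
      unfolding coeff3_times_X coeff3_XL_M
      by (cases p) (auto simp: binomial_eq_0 simp del: binomial_Suc_Suc)
    have 3: "coeff3 (L3 * ((X3 + L3) ^ q * M3 ^ r)) p (i + 2) (j + 1)
      = (if q = p + i + 1 \<and> r = j + 1 then of_nat ((p + i + 1) choose (i + 1)) else 0)"
      unfolding coeff3_times_L coeff3_XL_M by auto
    have 4: "coeff3 ((X3 + M3 + [:[:[:\<alpha>':]:]:] * L3) * (X3 ^ q * M3 ^ r)) p (i + 2) (j + 1) = 0"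
      unfolding distrib_right mult.assoc coeff3_linear coeff3_times_X coeff3_times_L coeff3_times_M coeff3_X_M
      by auto
    have 5: "coeff3 (X3 * ((X3 + M3) ^ q * L3 ^ r)) p (i + 2) (j + 1)
      = (if q = p + j \<and> r = i + 2 then of_nat ((p + j) choose (j + 1)) else 0)"
      unfolding coeff3_times_X coeff3_XM_L
      by (cases p) (auto simp: binomial_eq_0 simp del: binomial_Suc_Suc)
    have 6: "coeff3 (M3 * ((X3 + M3) ^ q * L3 ^ r)) p (i + 2) (j + 1)
      = (if q = p + j \<and> r = i + 2 then of_nat ((p + j) choose j) else 0)"
      unfolding coeff3_times_M coeff3_XM_L by auto
    have 7: "coeff3 (L3 * (X3 ^ q * (L3 + M3) ^ r)) p (i + 2) (j + 1)
      = (if q = p \<and> r = i + j + 2 then of_nat ((i + j + 2) choose (j + 1)) else 0)"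
      unfolding coeff3_times_L coeff3_X_LM by auto
    have 8: "coeff3 (M3 * (X3 ^ q * (L3 + M3) ^ r)) p (i + 2) (j + 1)
      = (if q = p \<and> r = i + j + 2 then of_nat ((i + j + 2) choose j) else 0)"
      unfolding coeff3_times_M coeff3_X_LM by auto
    have if_mult: "z * (if Q then k else 0) = (if Q then z * k else 0)" for z k :: complex and Q
      by simp
    show ?thesis
      unfolding T_def coeff3_linear(2) 1 4 distrib_right[of X3 "[:[:[:\<alpha>:]:]:] * L3"]
        distrib_right[of X3 "[:[:[:\<alpha>:]:]:] * M3"] left_diff_distrib mult.assoc coeff3_linear(1,5)
        2 3 5 6 7 8 if_mult by simp
  qed
  moreover
  have collapse: "(\<Sum>q\<le>?N. \<Sum>r\<le>?N. c q r * (if q = a \<and> r = b then k else 0)) = c a b * k" for a b k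
  proof -
    have "(\<Sum>q\<le>?N. \<Sum>r\<le>?N. c q r * (if q = a \<and> r = b then k else 0))
        = (\<Sum>q\<le>?N. \<Sum>r\<le>?N. if r = b then if q = a then c a b * k else 0 else 0)"
      by (intro sum.cong refl) simp
    also have "\<dots> = (\<Sum>q\<le>?N. if q = a then if b \<le> ?N then c a b * k else 0 else 0)"
      by (intro sum.cong refl) simp
    also have "\<dots> = c a b * k"
      using coeff_beyond_bideg[of F a b] by (auto simp: c_def not_le)
    finally show ?thesis .
  qed
  ultimately have "0 = c p (i + 2) * (if j = 0 then \<alpha>' else 0)
      + c (p + i + 1) (j + 1) * (of_nat ((p + i + 1) choose (i + 2)) + \<alpha> * of_nat ((p + i + 1) choose (i + 1)))
      - c (p + j) (i + 2) * (of_nat ((p + j) choose (j + 1)) + \<alpha> * of_nat ((p + j) choose j))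
      - c p (i + j + 2) * (of_nat ((i + j + 2) choose (j + 1)) - of_nat ((i + j + 2) choose j))"
    unfolding P_def coeff3_linear coeffT
    by (simp only: distrib_left right_diff_distrib sum.distrib sum_subtractf collapse)
  then show ?thesis by (auto simp: algebra_simps)
qed

section \<open>Reduction to a homogeneous cocycle\<close>

abbreviation cf :: "complex poly poly \<Rightarrow> nat \<Rightarrow> nat \<Rightarrow> complex" where
  "cf F p i \<equiv> coeff (coeff F i) p"

lemma cf_linear [simp]:
  "cf (F + G) p i = cf F p i + cf G p i" "cf (F - G) p i = cf F p i - cf G p i"
  "cf (cst s * F) p i = s * cf F p i"
  by simp_all

lemma cf_eqI: "(\<And>p i. cf F p i = cf G p i) \<Longrightarrow> F = G"
  by (simp add: poly_eq_iff)

lemma translate_pCons: "translate (pCons a p) = [:[:a:]:] + (del + lam) * translate p"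
  by (rule ev_eqI) (simp add: algebra_simps)

lemma translate_0 [simp]: "translate 0 = 0"
  by (rule ev_eqI) simp

lemma cf_del_times: "cf (del * F) p i = (if p = 0 then 0 else cf F (p - 1) i)"
  by (cases p) simp_all

lemma cf_lam_times: "cf (lam * F) p i = (if i = 0 then 0 else cf F p (i - 1))"
  by (cases i) simp_all

lemma cf_translate: "cf (translate \<phi>) p i = of_nat ((p + i) choose i) * coeff \<phi> (p + i)"
proof (induction \<phi> arbitrary: p i)
  case 0
  then show ?case by simp
next
  case (pCons a q)
  have "cf (translate (pCons a q)) p i = (if p = 0 \<and> i = 0 then a else 0)
      + (if p = 0 then 0 else of_nat ((p - 1 + i) choose i) * coeff q (p - 1 + i))
      + (if i = 0 then 0 else of_nat ((p + (i - 1)) choose (i - 1)) * coeff q (p + (i - 1)))"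
    unfolding translate_pCons distrib_right cf_linear cf_del_times cf_lam_times pCons.IH
    by (cases p; cases i) simp_all
  also have "\<dots> = of_nat ((p + i) choose i) * coeff (pCons a q) (p + i)"
    by (cases p; cases i) (simp_all add: algebra_simps)
  finally show ?case .
qed

lemma
  defines "D \<equiv> \<lambda>\<alpha> \<alpha>' \<phi>. vir_coboundary \<alpha> 0 \<alpha>' 0 \<phi>"
  shows cf_coboundary_0: "cf (D \<alpha> \<alpha>' \<phi>) p 0 = 0" (is ?c0)
    and cf_coboundary_1: "cf (D \<alpha> \<alpha>' \<phi>) p 1 = coeff \<phi> p * (of_nat p + \<alpha> - \<alpha>')" (is ?c1)
    and cf_coboundary_ge2: "cf (D \<alpha> \<alpha>' \<phi>) p (i + 2)
      = coeff \<phi> (p + i + 1) * (of_nat ((p + i + 1) choose (i + 2)) + \<alpha> * of_nat ((p + i + 1) choose (i + 1)))" (is ?c2)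
proof -
  have eq: "D \<alpha> \<alpha>' \<phi> = del * translate \<phi> + cst \<alpha> * (lam * translate \<phi>) - (del * [:\<phi>:] + cst \<alpha>' * (lam * [:\<phi>:]))"
    unfolding D_def by (rule ev_eqI) (simp add: algebra_simps)
  note cfs = eq cf_linear cf_del_times cf_lam_times cf_translate
  show ?c0
    unfolding cfs by (cases p) simp_all
  show ?c1
    unfolding cfs by (cases p) (simp_all add: algebra_simps)
  show ?c2
    unfolding cfs by (cases p) (simp_all add: algebra_simps binomial_eq_0 del: binomial_Suc_Suc)
qed

text \<open>
  At \<open>\<mu> = 0\<close> the cocycle equation reads \<open>(\<partial> + \<alpha>\<lambda>)p(\<partial> + \<lambda>) = (\<partial> + \<alpha>'\<lambda>)p(\<partial>)\<close> for \<open>p(\<partial>) = F(\<partial>, 0)\<close>.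
  If \<open>\<alpha>' \<noteq> \<alpha>\<close>, the choice \<open>\<partial> = - \<alpha>\<lambda>\<close> shows that \<open>p = 0\<close>; if \<open>\<alpha>' = \<alpha>\<close>, the choice \<open>\<partial> = 0\<close> shows that \<open>p\<close>
  is constant.
\<close>

lemma cocycle_at_lambda_0:
  assumes F: "vir_cocycle \<alpha> 0 \<alpha>' 0 F" and "\<alpha> \<noteq> 0"
  obtains c where "coeff F 0 = [:c:]" "c = 0 \<or> \<alpha>' = \<alpha>"
proof -
  let ?p = "coeff F 0"
  have ev0: "ev F x 0 = poly ?p x" for x
    by (simp add: ev_def poly_0_coeff_0)
  have eq: "(x + \<alpha> * l) * poly ?p (x + l) = (x + \<alpha>' * l) * poly ?p x" for x l
    using F[unfolded vir_cocycle_def, rule_format, of x l 0] unfolding ev0[symmetric]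
    by (simp add: algebra_simps)
  show thesis
  proof (cases "\<alpha>' = \<alpha>")
    case True
    have "poly ?p l = poly [:poly ?p 0:] l" for l
      using eq[of 0 l] \<open>\<alpha> \<noteq> 0\<close> True by (cases "l = 0") auto
    then have "?p = [:poly ?p 0:]" by (intro poly_ext)
    then show thesis using that True by blast
  next
    case False
    have "poly ?p x * x = 0" for x
      using eq[of x "- x / \<alpha>"] \<open>\<alpha> \<noteq> 0\<close> False by (auto simp: field_simps)
    then have "?p * [:0, 1:] = 0" by (intro poly_ext) (simp add: mult.commute)
    then show thesis using that[of 0] by simp
  qed
qed

text \<open>
  The coefficient of \<open>\<mu>\<close> in the cocycle equation expresses \<open>(\<alpha>' - \<alpha> - q)\<close> times the part of \<open>F\<close> of
  degree \<open>q + 1\<close> by the coefficient of \<open>\<partial>\<^sup>q\<lambda>\<close>, in the same way as the coboundary of \<open>\<partial>\<^sup>q\<close> is expressed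
  by its own.  So all parts with \<open>q \<noteq> \<alpha>' - \<alpha>\<close> can be removed at once.  If \<open>q = \<alpha>' - \<alpha> \<ge> 1\<close>, the same
  equation for \<open>\<lambda>\<^bsup>q+1\<^esup>\<close> shows that the coefficient of \<open>\<partial>\<^sup>q\<lambda>\<close> is zero, because \<open>\<alpha> \<noteq> 0\<close>.
\<close>

lemma cocycle_normal_form:
  assumes F: "vir_cocycle \<alpha> 0 \<alpha>' 0 F" and "\<alpha> \<noteq> 0"
  obtains \<phi> G where "F = G + vir_coboundary \<alpha> 0 \<alpha>' 0 \<phi>" "vir_cocycle \<alpha> 0 \<alpha>' 0 G"
    "\<And>p i. cf G p i \<noteq> 0 \<Longrightarrow>
       i \<ge> 2 \<and> \<alpha>' = \<alpha> + of_nat (p + i - 1) \<or> p = 0 \<and> i \<le> 1 \<and> \<alpha>' = \<alpha>"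
proof -
  \<comment> \<open>The coboundary of \<open>\<partial>\<^sup>q\<close> has the coefficient \<open>q + \<alpha> - \<alpha>'\<close> at \<open>\<partial>\<^sup>q\<lambda>\<close>, so \<open>d q\<close> makes it cancel
    that of \<open>F\<close>.\<close>
  define d where "d q = (if \<alpha>' - \<alpha> = of_nat q then 0 else - cf F q 1 / (\<alpha>' - \<alpha> - of_nat q))" for q
  define \<phi> where "\<phi> = (\<Sum>q\<le>bideg F. monom (d q) q)"
  have d: "coeff \<phi> q = d q" for q
    using coeff_beyond_bideg[of F q 1]
    by (auto simp: \<phi>_def coeff_sum d_def not_le)
  define G where "G = F - vir_coboundary \<alpha> 0 \<alpha>' 0 \<phi>"
  have G: "vir_cocycle \<alpha> 0 \<alpha>' 0 G"
    unfolding G_def by (rule vir_cocycle_linear(2)[OF F vir_coboundary_is_cocycle])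
  have deriv: "(\<alpha>' - \<alpha> - of_nat (p + i + 1)) * cf F p (i + 2)
      = - cf F (p + i + 1) 1 * (of_nat ((p + i + 1) choose (i + 2)) + \<alpha> * of_nat ((p + i + 1) choose (i + 1)))" for p i
    using cocycle_coeff_identity[OF F, where j = 0 and p = p and i = i] by (simp add: algebra_simps del: binomial_Suc_Suc)
  have supp: "i \<ge> 2 \<and> \<alpha>' = \<alpha> + of_nat (p + i - 1) \<or> p = 0 \<and> i \<le> 1 \<and> \<alpha>' = \<alpha>" if nz: "cf G p i \<noteq> 0" for p i
  proof -
    have "i = 0 \<or> i = 1 \<or> (\<exists>j. i = j + 2)" by presburger
    then consider "i = 0" | "i = 1" | j where "i = j + 2" by blast
    then show ?thesis
    proof cases
      case 1
      obtain c where "coeff F 0 = [:c:]" "c = 0 \<or> \<alpha>' = \<alpha>"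
        by (rule cocycle_at_lambda_0[OF F \<open>\<alpha> \<noteq> 0\<close>]) blast
      then show ?thesis
        using nz unfolding G_def cf_linear 1 cf_coboundary_0 by (auto simp: coeff_pCons split: nat.splits)
    next
      case 2
      have k: "\<alpha>' - \<alpha> = of_nat p"
      proof (rule ccontr)
        assume ne: "\<alpha>' - \<alpha> \<noteq> of_nat p"
        define u where "u = \<alpha>' - \<alpha> - of_nat p"
        have "of_nat p + \<alpha> - \<alpha>' = - u" "u \<noteq> 0" "d p = - cf F p 1 / u"
          using ne by (simp_all add: u_def d_def)
        then have "d p * (of_nat p + \<alpha> - \<alpha>') = cf F p 1" by simp
        then show False using nz unfolding G_def cf_linear 2 cf_coboundary_1 d by simp
      qed
      then have "cf F p 1 \<noteq> 0"
        using nz unfolding G_def cf_linear 2 cf_coboundary_1 d d_def by auto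
      have "p = 0"
      proof (rule ccontr)
        assume "p \<noteq> 0"
        then obtain r where r: "p = Suc r" using not0_implies_Suc by blast
        show False
          using deriv[of 0 r] k \<open>cf F p 1 \<noteq> 0\<close> \<open>\<alpha> \<noteq> 0\<close> by (simp add: r binomial_eq_0 del: binomial_Suc_Suc)
      qed
      then show ?thesis using k 2 by simp
    next
      case 3
      have "\<alpha>' - \<alpha> = of_nat (p + j + 1)"
      proof (rule ccontr)
        assume ne: "\<alpha>' - \<alpha> \<noteq> of_nat (p + j + 1)"
        have "cf F p (j + 2) = - cf F (p + j + 1) 1 / (\<alpha>' - \<alpha> - of_nat (p + j + 1))
          * (of_nat ((p + j + 1) choose (j + 2)) + \<alpha> * of_nat ((p + j + 1) choose (j + 1)))"
          using deriv[of p j] ne by (simp add: field_simps del: binomial_Suc_Suc of_nat_add of_nat_Suc)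
        then show False
          using nz ne unfolding G_def cf_linear 3 cf_coboundary_ge2 d d_def by simp
      qed
      then show ?thesis using 3 by (simp add: algebra_simps)
    qed
  qed
  show thesis by (rule that[of G \<phi>]) (use G supp in \<open>auto simp: G_def\<close>)
qed

section \<open>Homogeneous cocycles\<close>

text \<open>
  The degree is \<open>k + 1\<close> because \<open>k\<close> is the difference \<open>\<alpha>' - \<alpha>\<close>, and also the degree of the
  polynomial whose coboundary is homogeneous in this sense.  Divisibility by \<open>\<lambda>\<^sup>2\<close> is part of the
  definition, as it is what \<open>cocycle_normal_form\<close> achieves.
\<close>

definition homogeneous :: "nat \<Rightarrow> complex poly poly \<Rightarrow> bool" where
  "homogeneous k G \<longleftrightarrow> (\<forall>p i. cf G p i \<noteq> 0 \<longrightarrow> i \<ge> 2 \<and> p + i = k + 1)"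

abbreviation hcocycle :: "nat \<Rightarrow> complex \<Rightarrow> complex poly poly \<Rightarrow> bool" where
  "hcocycle k \<alpha> G \<equiv> homogeneous k G \<and> vir_cocycle \<alpha> 0 (\<alpha> + of_nat k) 0 G"

lemma hcocycle_comb:
  assumes "hcocycle k \<alpha> F" "hcocycle k \<alpha> G"
  shows "hcocycle k \<alpha> (F - cst s * G)"
proof
  show "homogeneous k (F - cst s * G)"
    unfolding homogeneous_def cf_linear
  proof (intro allI impI)
    fix p i
    assume "cf F p i - s * cf G p i \<noteq> 0"
    then have "cf F p i \<noteq> 0 \<or> cf G p i \<noteq> 0" by auto
    then show "i \<ge> 2 \<and> p + i = k + 1" using assms unfolding homogeneous_def by blast
  qed
  show "vir_cocycle \<alpha> 0 (\<alpha> + of_nat k) 0 (F - cst s * G)"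
    by (intro vir_cocycle_linear) (use assms in blast)+
qed

text \<open>
  The coefficient of \<open>\<partial>\<^sup>p\<lambda>\<^sup>i\<mu>\<^sup>j\<close> for \<open>i, j \<ge> 2\<close>.  The indices are constrained by equations, so that
  instances with numerals match syntactically.
\<close>

lemma cocycle_relation:
  assumes "vir_cocycle \<alpha> 0 \<alpha>' 0 G" and "i' \<ge> 1" "j' \<ge> 1"
    and [simp]: "i = i' + 1" "j = j' + 1" "q = p + i'" "s = p + j'" "r = i' + j' + 1"
  shows "cf G q j * (of_nat (q choose i) + \<alpha> * of_nat (q choose i'))
      - cf G s i * (of_nat (s choose j) + \<alpha> * of_nat (s choose j'))
    = cf G p r * (of_nat (r choose j) - of_nat (r choose j'))"
proof -
  obtain i2 where i': "i' = i2 + 1" using assms(2) by (metis add.commute le_Suc_ex plus_1_eq_Suc)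
  show ?thesis
    using cocycle_coeff_identity[OF assms(1), where j = j' and p = p and i = i2] assms(3)
    by (simp add: i' ac_simps del: binomial_Suc_Suc)
qed

lemma choose_numeral_formulas:
  "of_nat (N choose 2) = (of_nat N * (of_nat N - 1) / 2 :: complex)"
  "of_nat (N choose 3) = (of_nat N * (of_nat N - 1) * (of_nat N - 2) / 6 :: complex)"
  "of_nat (N choose 4) = (of_nat N * (of_nat N - 1) * (of_nat N - 2) * (of_nat N - 3) / 24 :: complex)"
  "of_nat (N choose 5) = (of_nat N * (of_nat N - 1) * (of_nat N - 2) * (of_nat N - 3) * (of_nat N - 4) / 120 :: complex)"
  unfolding binomial_gbinomial
  by (simp_all add: gbinomial_prod_rev numeral_eq_Suc atLeast0_lessThan_Suc fact_Suc)

text \<open>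
  By the coefficient of \<open>\<lambda>\<^sup>i\<mu>\<^sup>2\<close>, the coefficient of \<open>\<lambda>\<^bsup>i+1\<^esup>\<close> is determined by those of \<open>\<lambda>\<^sup>2\<close> and \<open>\<lambda>\<^sup>i\<close>:
  the factor \<open>(i + 1)(i - 2) / 2\<close> in front of it is nonzero for \<open>i \<ge> 3\<close>.
\<close>

lemma hcocycle_eq_0:
  assumes G: "hcocycle k \<alpha> G" and a2: "cf G (k - 1) 2 = 0" and a3: "cf G (k - 2) 3 = 0"
  shows "G = 0"
proof -
  have "cf G p i = 0" if "p + i = k + 1" "i \<ge> 2" for p i
    using that
  proof (induction i arbitrary: p rule: less_induct)
    case (less i)
    have "i = 2 \<or> i = 3 \<or> (\<exists>j. i = j + 4)" using less.prems(2) by presburger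
    then consider "i = 2" | "i = 3" | j where "i = j + 4" by blast
    then show ?case
    proof cases
      case 1
      then have "p = k - 1" using less.prems by simp
      then show ?thesis using 1 a2 by simp
    next
      case 2
      then have "p = k - 2" using less.prems by simp
      then show ?thesis using 2 a3 by simp
    next
      case 3
      have "cf G (p + (j + 1) + 1) 2 = 0" "cf G (p + 1) (j + 3) = 0"
        using less.IH[of 2 "p + (j + 1) + 1"] less.IH[of "j + 3" "p + 1"] less.prems 3 by simp_all
      then have "cf G p (j + 4) * (of_nat ((j + 4) choose 2) - of_nat ((j + 4) choose 1)) = 0"
        using cocycle_relation[OF conjunct2[OF G], where p = p and i = "j + 3" and j = 2 and i' = "j + 2" and j' = 1
            and q = "p + (j + 1) + 1" and s = "p + 1" and r = "j + 4"] by simp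
      moreover have eq: "of_nat ((j + 4) choose 2) - of_nat ((j + 4) choose 1) = (of_nat ((j + 4) * (j + 1)) / 2 :: complex)"
        by (simp add: choose_numeral_formulas field_simps)
      have "of_nat ((j + 4) choose 2) - of_nat ((j + 4) choose 1) \<noteq> (0::complex)"
        unfolding eq by (simp del: of_nat_mult of_nat_add)
      ultimately show ?thesis using 3 by (metis mult_eq_0_iff)
    qed
  qed
  then have "cf G p i = 0" for p i
    using conjunct1[OF G] unfolding homogeneous_def by blast
  then show ?thesis by (intro cf_eqI) simp
qed

abbreviation basic_coboundary :: "complex \<Rightarrow> nat \<Rightarrow> complex poly poly" where
  "basic_coboundary \<alpha> k \<equiv> vir_coboundary \<alpha> 0 (\<alpha> + of_nat k) 0 (monom 1 k)"

lemma hcocycle_basic_coboundary: "hcocycle k \<alpha> (basic_coboundary \<alpha> k)"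
proof -
  have "i \<ge> 2 \<and> p + i = k + 1" if nz: "cf (basic_coboundary \<alpha> k) p i \<noteq> 0" for p i
  proof -
    have "i = 0 \<or> i = 1 \<or> (\<exists>j. i = j + 2)" by presburger
    then consider "i = 0" | "i = 1" | j where "i = j + 2" by blast
    then show ?thesis
    proof cases
      case 3
      then show ?thesis using nz unfolding 3 cf_coboundary_ge2 by (auto split: if_splits)
    qed (use nz in \<open>auto simp only: cf_coboundary_0 cf_coboundary_1, auto split: if_splits\<close>)
  qed
  then show ?thesis by (simp add: homogeneous_def vir_coboundary_is_cocycle)
qed

lemma cf_basic_coboundary:
  assumes "i = i' + 1" "i' \<ge> 1" "p + i' = k"
  shows "cf (basic_coboundary \<alpha> k) p i = of_nat (k choose i) + \<alpha> * of_nat (k choose i')"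
proof -
  obtain j where "i' = j + 1" using assms(2) by (metis add.commute le_Suc_ex plus_1_eq_Suc)
  then show ?thesis
    using assms cf_coboundary_ge2[where p = p and i = j and \<alpha> = \<alpha> and \<alpha>' = "\<alpha> + of_nat k" and \<phi> = "monom 1 k"]
    by (simp del: binomial_Suc_Suc)
qed

text \<open>
  These two coefficients decide which of them can be removed by subtracting a coboundary: the first
  vanishes exactly for \<open>2\<alpha> + k - 1 = 0\<close>, if \<open>k \<ge> 1\<close>.
\<close>

lemma basic_coboundary_2_3:
  shows "k \<ge> 1 \<Longrightarrow> cf (basic_coboundary \<alpha> k) (k - 1) 2 = of_nat k * (2 * \<alpha> + of_nat k - 1) / 2"
    and "k \<ge> 2 \<Longrightarrow> cf (basic_coboundary \<alpha> k) (k - 2) 3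
      = of_nat k * (of_nat k - 1) * (of_nat k - 2 + 3 * \<alpha>) / 6"
  by (subst cf_basic_coboundary[where i' = 1], simp_all add: choose_numeral_formulas field_simps)
     (subst cf_basic_coboundary[where i' = 2], simp_all add: choose_numeral_formulas field_simps)

section \<open>Homogeneous cocycles of high degree\<close>

text \<open>
  With \<open>k = m + 5\<close> and \<open>a\<^sub>i\<close> the coefficient of \<open>\<lambda>\<^sup>i\<close>, these are the coefficients of \<open>\<lambda>\<^sup>3\<mu>\<^sup>2\<close>, \<open>\<lambda>\<^sup>4\<mu>\<^sup>2\<close>,
  \<open>\<lambda>\<^sup>5\<mu>\<^sup>2\<close> and \<open>\<lambda>\<^sup>3\<mu>\<^sup>4\<close>.  In terms of \<open>y = 2\<alpha> + k - 1\<close> instead of \<open>\<alpha>\<close> the combinations of binomial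
  coefficients split into linear factors.
\<close>

lemma hcocycle_relations:
  assumes G: "hcocycle (m + 5) \<alpha> G"
  defines "M \<equiv> of_nat m :: complex"
  defines "y \<equiv> 2 * \<alpha> + M + 4"
  defines "a \<equiv> \<lambda>i. cf G (m + 6 - i) i"
  shows "a 2 * ((M + 4) * (M + 3) * (3 * y - M - 8) / 12) - a 3 * ((M + 3) * (y - 2) / 2) = 2 * a 4" (is ?e1)
    and "a 2 * ((M + 4) * (M + 3) * (M + 2) * (2 * y - M - 7) / 24) - a 4 * ((M + 2) * (y - 3) / 2) = 5 * a 5" (is ?e2)
    and "a 2 * ((M + 4) * (M + 3) * (M + 2) * (M + 1) * (5 * y - 3 * M - 20) / 240) - a 5 * ((M + 1) * (y - 4) / 2) = 9 * a 6" (is ?e3)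
    and "a 4 * ((M + 2) * (M + 1) * (3 * y - M - 12) / 12) - a 3 * ((M + 3) * (M + 2) * (M + 1) * (2 * y - M - 8) / 24) = - 5 * a 6" (is ?e4)
proof -
  have al: "\<alpha> = (y - M - 4) / 2" by (simp add: y_def)
  note rel = cocycle_relation[OF conjunct2[OF G]]
  have chooses: "(4 choose 2) = (6::nat)" "(5 choose 2) = (10::nat)" "(6 choose 2) = (15::nat)"
    "(6 choose 4) = (15::nat)" "(6 choose 3) = (20::nat)"
    by (simp_all add: numeral_eq_Suc)
  have a: "a 2 = cf G (m + 4) 2" "a 3 = cf G (m + 3) 3" "a 4 = cf G (m + 2) 4" "a 5 = cf G (m + 1) 5" "a 6 = cf G m 6"
    by (simp_all add: a_def add.commute)
  have coeffs: "of_nat ((m + 4) choose 3) + \<alpha> * of_nat ((m + 4) choose 2) = (M + 4) * (M + 3) * (3 * y - M - 8) / 12"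
    "of_nat ((m + 3) choose 2) + \<alpha> * of_nat ((m + 3) choose 1) = (M + 3) * (y - 2) / 2"
    "of_nat ((m + 4) choose 4) + \<alpha> * of_nat ((m + 4) choose 3) = (M + 4) * (M + 3) * (M + 2) * (2 * y - M - 7) / 24"
    "of_nat ((m + 2) choose 2) + \<alpha> * of_nat ((m + 2) choose 1) = (M + 2) * (y - 3) / 2"
    "of_nat ((m + 4) choose 5) + \<alpha> * of_nat ((m + 4) choose 4) = (M + 4) * (M + 3) * (M + 2) * (M + 1) * (5 * y - 3 * M - 20) / 240"
    "of_nat ((m + 1) choose 2) + \<alpha> * of_nat ((m + 1) choose 1) = (M + 1) * (y - 4) / 2"
    "of_nat ((m + 2) choose 3) + \<alpha> * of_nat ((m + 2) choose 2) = (M + 2) * (M + 1) * (3 * y - M - 12) / 12"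
    "of_nat ((m + 3) choose 4) + \<alpha> * of_nat ((m + 3) choose 3) = (M + 3) * (M + 2) * (M + 1) * (2 * y - M - 8) / 24"
    unfolding choose_numeral_formulas al by (simp_all add: M_def[symmetric] field_simps)
  have "a 2 * (of_nat ((m + 4) choose 3) + \<alpha> * of_nat ((m + 4) choose 2))
      - a 3 * (of_nat ((m + 3) choose 2) + \<alpha> * of_nat ((m + 3) choose 1)) = a 4 * (of_nat (4 choose 2) - of_nat (4 choose 1))"
    unfolding a by (rule rel[where p = "m + 2"]) simp_all
  then show ?e1
    unfolding coeffs chooses by simp
  have "a 2 * (of_nat ((m + 4) choose 4) + \<alpha> * of_nat ((m + 4) choose 3))
      - a 4 * (of_nat ((m + 2) choose 2) + \<alpha> * of_nat ((m + 2) choose 1)) = a 5 * (of_nat (5 choose 2) - of_nat (5 choose 1))"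
    unfolding a by (rule rel[where p = "m + 1"]) simp_all
  then show ?e2
    unfolding coeffs chooses by simp
  have "a 2 * (of_nat ((m + 4) choose 5) + \<alpha> * of_nat ((m + 4) choose 4))
      - a 5 * (of_nat ((m + 1) choose 2) + \<alpha> * of_nat ((m + 1) choose 1)) = a 6 * (of_nat (6 choose 2) - of_nat (6 choose 1))"
    unfolding a by (rule rel[where p = "m"]) simp_all
  then show ?e3
    unfolding coeffs chooses by simp
  have "a 4 * (of_nat ((m + 2) choose 3) + \<alpha> * of_nat ((m + 2) choose 2))
      - a 3 * (of_nat ((m + 3) choose 4) + \<alpha> * of_nat ((m + 3) choose 3)) = a 6 * (of_nat (6 choose 4) - of_nat (6 choose 3))"
    unfolding a by (rule rel[where p = "m"]) simp_all
  then show ?e4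
    unfolding coeffs chooses by simp
qed

lemma choose_values: "(7 choose 2) = (21::nat)" "(8 choose 2) = (28::nat)" "(8 choose 5) = (56::nat)" "(8 choose 4) = (70::nat)"
  by (simp_all add: numeral_eq_Suc)

text \<open>
  With \<open>k = r + 7\<close> and \<open>a\<^sub>2 = 0\<close>, the coefficients of \<open>\<lambda>\<^sup>6\<mu>\<^sup>2\<close>, \<open>\<lambda>\<^sup>7\<mu>\<^sup>2\<close> and \<open>\<lambda>\<^sup>4\<mu>\<^sup>5\<close>; again \<open>y = 2\<alpha> + k - 1\<close>.
\<close>

lemma hcocycle_relations_high:
  assumes G: "hcocycle (r + 7) \<alpha> G" and a2: "cf G (r + 6) 2 = 0"
  defines "N \<equiv> of_nat r :: complex"
  defines "y \<equiv> 2 * \<alpha> + N + 6"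
  shows "- cf G (r + 2) 6 * ((N + 2) * (y - 5) / 2) = 14 * cf G (r + 1) 7" (is ?e1)
    and "- cf G (r + 1) 7 * ((N + 1) * (y - 6) / 2) = 20 * cf G r 8" (is ?e2)
    and "cf G (r + 3) 5 * ((N + 3) * (N + 2) * (N + 1) * (2 * y - N - 12) / 24)
       - cf G (r + 4) 4 * ((N + 4) * (N + 3) * (N + 2) * (N + 1) * (5 * y - 3 * N - 30) / 240) = - 14 * cf G r 8" (is ?e3)
proof -
  have al: "\<alpha> = (y - N - 6) / 2" by (simp add: y_def)
  note rel = cocycle_relation[OF conjunct2[OF G]]
  have coeffs: "of_nat ((r + 2) choose 2) + \<alpha> * of_nat ((r + 2) choose 1) = (N + 2) * (y - 5) / 2"
    "of_nat ((r + 1) choose 2) + \<alpha> * of_nat ((r + 1) choose 1) = (N + 1) * (y - 6) / 2"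
    "of_nat ((r + 3) choose 4) + \<alpha> * of_nat ((r + 3) choose 3) = (N + 3) * (N + 2) * (N + 1) * (2 * y - N - 12) / 24"
    "of_nat ((r + 4) choose 5) + \<alpha> * of_nat ((r + 4) choose 4) = (N + 4) * (N + 3) * (N + 2) * (N + 1) * (5 * y - 3 * N - 30) / 240"
    unfolding choose_numeral_formulas al by (simp_all add: N_def[symmetric] field_simps)
  have "cf G (r + 6) 2 * (of_nat ((r + 6) choose 6) + \<alpha> * of_nat ((r + 6) choose 5))
      - cf G (r + 2) 6 * (of_nat ((r + 2) choose 2) + \<alpha> * of_nat ((r + 2) choose 1))
      = cf G (r + 1) 7 * (of_nat (7 choose 2) - of_nat (7 choose 1))"
    by (rule rel[where p = "r + 1"]) simp_all
  then show ?e1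
    unfolding coeffs a2 choose_values by simp
  have "cf G (r + 6) 2 * (of_nat ((r + 6) choose 7) + \<alpha> * of_nat ((r + 6) choose 6))
      - cf G (r + 1) 7 * (of_nat ((r + 1) choose 2) + \<alpha> * of_nat ((r + 1) choose 1))
      = cf G r 8 * (of_nat (8 choose 2) - of_nat (8 choose 1))"
    by (rule rel[where p = r]) simp_all
  then show ?e2
    unfolding coeffs a2 choose_values by simp
  have "cf G (r + 3) 5 * (of_nat ((r + 3) choose 4) + \<alpha> * of_nat ((r + 3) choose 3))
      - cf G (r + 4) 4 * (of_nat ((r + 4) choose 5) + \<alpha> * of_nat ((r + 4) choose 4))
      = cf G r 8 * (of_nat (8 choose 5) - of_nat (8 choose 4))"
    by (rule rel[where p = r]) simp_all
  then show ?e3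
    unfolding coeffs choose_values by simp
qed

lemma of_nat_add_pos: "j > 0 \<Longrightarrow> of_nat m + of_nat j \<noteq> (0 :: complex)"
  by (metis add_gr_0 less_irrefl of_nat_0_eq_iff of_nat_add)

lemmas of_nat_add_numeral_pos =
  of_nat_add_pos[of "numeral k" for k, simplified] of_nat_add_pos[of 1, simplified]

text \<open>
  The coefficient of \<open>\<lambda>\<^sup>4\<mu>\<^sup>5\<close> after the recursion has been solved for \<open>a\<^sub>4, \<dots>, a\<^sub>8\<close> in terms of \<open>a\<^sub>3\<close>,
  where \<open>u\<^sub>i\<close> and \<open>w\<^sub>i\<close> abbreviate the linear factors.  Keeping these factors opaque keeps the
  identity small.
\<close>

lemma ladder_elimination:
  fixes a3 u1 u2 u3 u4 u5 w2 w3 w4 w5 w6 p q :: complex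
  assumes "a4 = - a3 * u5 * w2 / 4" "a5 = - a4 * u4 * w3 / 10" "a6 = - a5 * u3 * w4 / 18"
    "a7 = - a6 * u2 * w5 / 28" "a8 = - a7 * u1 * w6 / 40"
  shows "a5 * (u3 * u2 * u1 * p / 24) - a4 * (u4 * u3 * u2 * u1 * q / 240) + 14 * a8
    = a3 * u5 * u4 * u3 * u2 * u1 * w2 / 57600 * (60 * w3 * p + 60 * q - w3 * w4 * w5 * w6)"
  unfolding assms by (simp add: field_simps)

text \<open>
  If \<open>a\<^sub>2 = 0\<close> and \<open>a\<^sub>3 \<noteq> 0\<close>, the coefficient of \<open>\<lambda>\<^sup>3\<mu>\<^sup>4\<close> is a nonzero multiple of \<open>y(y\<^sup>2 - (3k + 1))\<close>.  If
  \<open>m \<ge> 2\<close>, that is \<open>k \<ge> 7\<close>, the coefficient of \<open>\<lambda>\<^sup>4\<mu>\<^sup>5\<close> is a nonzero multiple of \<open>y(y\<^sup>3 - 18y\<^sup>2 - y + 60k + 18)\<close>.  As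
  \<open>y\<^sup>2 = 3k + 1\<close>, the cubic factor is \<open>(y + 2)(y - 1)(y + 1)\<close>, whose roots have \<open>y\<^sup>2 = 4\<close> or
  \<open>y\<^sup>2 = 1\<close>, whereas \<open>3k + 1 \<ge> 22\<close>.
\<close>

lemma hcocycle_a3_obstruction:
  assumes G: "hcocycle (m + 5) \<alpha> G" and "cf G (m + 4) 2 = 0" "cf G (m + 3) 3 \<noteq> 0"
    and y_nz: "2 * \<alpha> + of_nat m + 4 \<noteq> 0"
  shows "(2 * \<alpha> + of_nat m + 4)\<^sup>2 = 3 * of_nat m + 16" "m \<le> 1"
proof -
  define M :: complex where "M = of_nat m"
  define y where "y = 2 * \<alpha> + M + 4"
  define a3 where "a3 = cf G (m + 3) 3"
  have ix: "cf G (m + 6 - 2) 2 = 0" "m + 6 - 3 = m + 3" "m + 6 - 4 = m + 2" "m + 6 - 5 = m + 1" "m + 6 - 6 = m"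
    using assms(2) by (simp_all add: add.commute)
  note rels = hcocycle_relations[OF G, folded M_def, folded y_def, unfolded ix, folded a3_def]
  have a4: "cf G (m + 2) 4 = - a3 * (M + 3) * (y - 2) / 4"
    using rels(1) by (simp add: field_simps)
  have a5: "cf G (m + 1) 5 = - cf G (m + 2) 4 * (M + 2) * (y - 3) / 10"
    using rels(2) by (simp add: field_simps)
  have a6: "cf G m 6 = - cf G (m + 1) 5 * (M + 1) * (y - 4) / 18"
    using rels(3) by (simp add: field_simps)
  have nz: "a3 \<noteq> 0" "y \<noteq> 0" "M + 1 \<noteq> 0" "M + 2 \<noteq> 0" "M + 3 \<noteq> 0"
    using assms(3) y_nz of_nat_add_numeral_pos by (simp_all add: a3_def y_def M_def)
  have "a3 * (M + 3) * (M + 2) * (M + 1) * y * (y\<^sup>2 - (3 * M + 16)) = 0"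
  proof -
    have "a3 * (M + 3) * (M + 2) * (M + 1) * y * (y\<^sup>2 - (3 * M + 16))
      = - 144 * (cf G (m + 2) 4 * ((M + 2) * (M + 1) * (3 * y - M - 12) / 12)
         - a3 * ((M + 3) * (M + 2) * (M + 1) * (2 * y - M - 8) / 24) + 5 * cf G m 6)"
      unfolding a6 a5 a4 by (simp add: power2_eq_square field_simps)
    then show ?thesis unfolding rels(4) by simp
  qed
  then have y2: "y\<^sup>2 = 3 * M + 16" using nz by simp
  then show "(2 * \<alpha> + of_nat m + 4)\<^sup>2 = 3 * of_nat m + 16" by (simp add: y_def M_def)
  show "m \<le> 1"
  proof (rule ccontr)
    assume "\<not> m \<le> 1"
    then obtain r where m: "m = r + 2" by (metis Suc_1 add.commute le_Suc_ex not_less_eq_eq)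
    define N :: complex where "N = of_nat r"
    have M: "M = N + 2" and r6: "r + 6 = m + 4" by (simp_all add: M_def N_def m)
    have G': "hcocycle (r + 7) \<alpha> G" using G by (simp add: m add.commute)
    have y': "2 * \<alpha> + of_nat r + 6 = y" by (simp add: y_def M_def m)
    have ix: "r + 2 = m" "r + 3 = m + 1" "r + 4 = m + 2" using m by simp_all
    have a2': "cf G (r + 6) 2 = 0" unfolding r6 by (rule assms(2))
    note rels' = hcocycle_relations_high[OF G' a2', unfolded y', folded N_def, unfolded ix]
    have a7: "cf G (r + 1) 7 = - cf G m 6 * (N + 2) * (y - 5) / 28"
      using rels'(1) by (simp add: field_simps)
    have a8: "cf G r 8 = - cf G (r + 1) 7 * (N + 1) * (y - 6) / 40"
      using rels'(2) by (simp add: field_simps)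
    have nz': "N + 1 \<noteq> 0" "N + 2 \<noteq> 0" "N + 3 \<noteq> 0" "N + 4 \<noteq> 0" "N + 5 \<noteq> 0" "N + 6 \<noteq> 0" "N + 7 \<noteq> 0"
      using of_nat_add_numeral_pos by (simp_all add: N_def)
    let ?E = "cf G (m + 1) 5 * ((N + 3) * (N + 2) * (N + 1) * (2 * y - N - 12) / 24)
       - cf G (m + 2) 4 * ((N + 4) * (N + 3) * (N + 2) * (N + 1) * (5 * y - 3 * N - 30) / 240) + 14 * cf G r 8"
    have E1: "?E = a3 * (N + 5) * (N + 4) * (N + 3) * (N + 2) * (N + 1) * (y - 2) / 57600 *
        (60 * (y - 3) * (2 * y - N - 12) + 60 * (5 * y - 3 * N - 30) - (y - 3) * (y - 4) * (y - 5) * (y - 6))"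
      by (rule ladder_elimination[OF _ _ _ a7 a8]) (use a4 a5 a6 in \<open>simp_all add: M add.assoc\<close>)
    have E2: "60 * (y - 3) * (2 * y - N - 12) + 60 * (5 * y - 3 * N - 30) - (y - 3) * (y - 4) * (y - 5) * (y - 6)
        = - y * (y ^ 3 - 18 * y\<^sup>2 - y + 60 * N + 438)"
      by (simp add: power2_eq_square power3_eq_cube algebra_simps)
    have "?E = 0" unfolding rels'(3) by simp
    then have "a3 * (N + 5) * (N + 4) * (N + 3) * (N + 2) * (N + 1) * (y - 2) / 57600
        * (- y * (y ^ 3 - 18 * y\<^sup>2 - y + 60 * N + 438)) = 0"
      unfolding E1 E2 .
    then have "a3 * (N + 5) * (N + 4) * (N + 3) * (N + 2) * (N + 1) * (y - 2) * y
        * (y ^ 3 - 18 * y\<^sup>2 - y + 60 * N + 438) = 0"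
      by simp
    moreover have "y \<noteq> 2"
    proof
      assume "y = 2"
      then have "3 * (N + 6) = 0" using y2 unfolding M by (simp add: algebra_simps)
      then show False using nz' unfolding mult_eq_0_iff by simp
    qed
    ultimately have "y ^ 3 - 18 * y\<^sup>2 - y + 60 * N + 438 = 0" using nz nz' by simp
    moreover have "(y + 2) * (y - 1) * (y + 1)
      = (y ^ 3 - 18 * y\<^sup>2 - y + 60 * N + 438) + 20 * (y\<^sup>2 - (3 * (N + 2) + 16))"
      by (simp add: power2_eq_square power3_eq_cube algebra_simps)
    ultimately have "(y + 2) * (y - 1) * (y + 1) = 0"
      using y2 unfolding M by simp
    then have "y = -2 \<or> y = 1 \<or> y = -1" by (auto simp: eq_neg_iff_add_eq_0)
    then have "y\<^sup>2 = 4 \<or> y\<^sup>2 = 1" by auto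
    moreover have "3 * (N + 6) = y\<^sup>2 - 4" "3 * (N + 7) = y\<^sup>2 - 1"
      using y2 unfolding M by simp_all
    ultimately have "3 * (N + 6) = 0 \<or> 3 * (N + 7) = 0" by (metis right_minus_eq)
    then show False using nz' unfolding mult_eq_0_iff by simp
  qed
qed

text \<open>
  If \<open>y = 0\<close> and \<open>a\<^sub>3 = 0\<close>, the coefficient of \<open>\<lambda>\<^sup>3\<mu>\<^sup>4\<close> is a nonzero multiple of
  \<open>(m + 6)(3m + 16)a\<^sub>2\<close>.
\<close>

lemma hcocycle_a2_obstruction:
  assumes G: "hcocycle (m + 5) \<alpha> G" and a3_0: "cf G (m + 3) 3 = 0"
    and y_0: "2 * \<alpha> + of_nat m + 4 = 0"
  shows "cf G (m + 4) 2 = 0"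
proof -
  define M :: complex where "M = of_nat m"
  define a2 where "a2 = cf G (m + 4) 2"
  have y: "2 * \<alpha> + M + 4 = 0" using y_0 by (simp add: M_def)
  have ix: "m + 6 - 2 = m + 4" "cf G (m + 6 - 3) 3 = 0" "m + 6 - 4 = m + 2" "m + 6 - 5 = m + 1" "m + 6 - 6 = m"
    using a3_0 by (simp_all add: add.commute)
  note rels = hcocycle_relations[OF G, folded M_def, unfolded y, unfolded ix, folded a2_def]
  have a4: "cf G (m + 2) 4 = a2 * ((M + 4) * (M + 3) * (3 * 0 - M - 8) / 12) / 2"
    using rels(1) by simp
  have a5: "cf G (m + 1) 5 = (a2 * ((M + 4) * (M + 3) * (M + 2) * (2 * 0 - M - 7) / 24)
      - cf G (m + 2) 4 * ((M + 2) * (0 - 3) / 2)) / 5"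
    unfolding rels(2) by simp
  have a6: "cf G m 6 = (a2 * ((M + 4) * (M + 3) * (M + 2) * (M + 1) * (5 * 0 - 3 * M - 20) / 240)
      - cf G (m + 1) 5 * ((M + 1) * (0 - 4) / 2)) / 9"
    unfolding rels(3) by simp
  have nz: "M + 1 \<noteq> 0" "M + 2 \<noteq> 0" "M + 3 \<noteq> 0" "M + 4 \<noteq> 0" "M + 6 \<noteq> 0"
    using of_nat_add_numeral_pos by (simp_all add: M_def)
  have nz': "3 * M + 16 \<noteq> 0"
    using of_nat_add_pos[of 16 "3 * m"] by (simp add: M_def)
  have "a2 * (M + 6) * (M + 4) * (M + 3) * (M + 2) * (M + 1) * (3 * M + 16)
    = 864 * (cf G (m + 2) 4 * ((M + 2) * (M + 1) * (3 * 0 - M - 12) / 12)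
         - 0 * ((M + 3) * (M + 2) * (M + 1) * (2 * 0 - M - 8) / 24) + 5 * cf G m 6)"
    unfolding a6 a5 a4 by (simp add: field_simps)
  also have "\<dots> = 0" unfolding rels(4) by simp
  finally show ?thesis using nz nz' by (simp add: a2_def)
qed

text \<open>
  Here \<open>y = 2\<alpha> + m + 4\<close>.  If \<open>y \<noteq> 0\<close>, a multiple of the coboundary removes \<open>a\<^sub>2\<close>, and \<open>a\<^sub>3\<close> cannot vanish
  as well, since the cocycle is nontrivial.  If \<open>y = 0\<close>, the coboundary removes \<open>a\<^sub>3\<close> instead.
\<close>

lemma hcocycle_large_degree:
  assumes G: "hcocycle k \<alpha> G" and "k \<ge> 5" and "\<alpha> \<noteq> 0"
    and nontrivial: "\<And>r. G \<noteq> cst r * basic_coboundary \<alpha> k"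
  shows "k = 5 \<and> \<alpha> = - 4 \<or> k = 6 \<and> (2 * \<alpha> + 5)\<^sup>2 = 19"
proof -
  obtain m where k: "k = m + 5" using \<open>k \<ge> 5\<close> by (metis add.commute le_Suc_ex)
  let ?B = "basic_coboundary \<alpha> k"
  let ?y = "2 * \<alpha> + of_nat m + 4"
  have B: "hcocycle k \<alpha> ?B" by (rule hcocycle_basic_coboundary)
  have b2: "cf ?B (m + 4) 2 = of_nat k * ?y / 2"
    and b3: "cf ?B (m + 3) 3 = of_nat k * (of_nat k - 1) * (of_nat k - 2 + 3 * \<alpha>) / 6"
    using basic_coboundary_2_3[of k \<alpha>] by (simp_all add: k algebra_simps)
  have k0: "of_nat k \<noteq> (0 :: complex)" unfolding k using of_nat_add_numeral_pos by simp
  have zero: "G = cst r * ?B" if "cf (G - cst r * ?B) (m + 4) 2 = 0" "cf (G - cst r * ?B) (m + 3) 3 = 0" for r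
    using hcocycle_eq_0[OF hcocycle_comb[OF G B]] that by (simp add: k add.commute neg_eq_iff_add_eq_0)
  show ?thesis
  proof (cases "?y = 0")
    case True
    have e: "of_nat k - 2 + 3 * \<alpha> = - (of_nat m + 6) / 2"
      using True by (simp add: k field_simps) algebra
    then have b3_nz: "cf ?B (m + 3) 3 \<noteq> 0"
      unfolding b3 e using of_nat_add_numeral_pos[of m] by (simp add: k add.commute neg_eq_iff_add_eq_0)
    define r where "r = cf G (m + 3) 3 / cf ?B (m + 3) 3"
    have 3: "cf (G - cst r * ?B) (m + 3) 3 = 0" unfolding cf_linear r_def using b3_nz by simp
    have "cf (G - cst r * ?B) (m + 4) 2 = 0"
      by (rule hcocycle_a2_obstruction[OF _ 3 True]) (use hcocycle_comb[OF G B] in \<open>simp only: k\<close>)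
    then show ?thesis using zero[OF _ 3] nontrivial by blast
  next
    case False
    define r where "r = cf G (m + 4) 2 / cf ?B (m + 4) 2"
    have 2: "cf (G - cst r * ?B) (m + 4) 2 = 0" unfolding cf_linear r_def b2 using False k0 by simp
    have 3: "cf (G - cst r * ?B) (m + 3) 3 \<noteq> 0" using zero[OF 2] nontrivial by blast
    have H: "hcocycle (m + 5) \<alpha> (G - cst r * ?B)" using hcocycle_comb[OF G B] by (simp only: k)
    have y2: "?y\<^sup>2 = 3 * of_nat m + 16" and "m \<le> 1"
      using hcocycle_a3_obstruction[OF H 2 3 False] by blast+
    then consider "m = 0" | "m = 1" by linarith
    then show ?thesis
    proof cases
      case 1
      then have "4 * (\<alpha> * (\<alpha> + 4)) = 0" using y2 by (simp add: power2_eq_square algebra_simps)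
      then have "\<alpha> = - 4" using \<open>\<alpha> \<noteq> 0\<close> by (simp add: eq_neg_iff_add_eq_0)
      then show ?thesis using 1 k by simp
    next
      case 2
      then show ?thesis using y2 k by (simp add: add.assoc)
    qed
  qed
qed

definition coboundary_det :: "complex \<Rightarrow> nat \<Rightarrow> complex poly poly \<Rightarrow> complex" where
  "coboundary_det \<alpha> k H = cf H (k - 1) 2 * cf (basic_coboundary \<alpha> k) (k - 2) 3
     - cf H (k - 2) 3 * cf (basic_coboundary \<alpha> k) (k - 1) 2"

text \<open>
  A homogeneous cocycle is determined by two coefficients, so two cocycles for which these are
  linearly independent span all of them.
\<close>

lemma hcocycle_span:
  assumes G: "hcocycle k \<alpha> G" and H: "hcocycle k \<alpha> H" and "k \<ge> 2"
    and det: "coboundary_det \<alpha> k H \<noteq> 0"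
  obtains s r where "G = cst s * H + cst r * basic_coboundary \<alpha> k"
proof -
  let ?B = "basic_coboundary \<alpha> k"
  define a b c d e f where defs: "a = cf H (k - 1) 2" "b = cf ?B (k - 1) 2" "c = cf H (k - 2) 3" "d = cf ?B (k - 2) 3"
    "e = cf G (k - 1) 2" "f = cf G (k - 2) 3"
  have D: "a * d - c * b \<noteq> 0" using det by (simp add: defs coboundary_det_def)
  define s where "s = (e * d - f * b) / (a * d - c * b)"
  define r where "r = (a * f - c * e) / (a * d - c * b)"
  have "e = s * a + r * b" "f = s * c + r * d"
    using D by (simp_all add: s_def r_def add_divide_distrib[symmetric] eq_divide_eq) algebra+
  then have "cf (G - cst s * H - cst r * ?B) (k - 1) 2 = 0" "cf (G - cst s * H - cst r * ?B) (k - 2) 3 = 0"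
    unfolding cf_linear defs by simp_all
  then have "G - cst s * H - cst r * ?B = 0"
    using hcocycle_eq_0[OF hcocycle_comb[OF hcocycle_comb[OF G H] hcocycle_basic_coboundary]] by simp
  then show thesis using that[of s r] by (simp add: algebra_simps)
qed

section \<open>The exceptional cocycles\<close>

fun subcase_basis :: "subcase \<Rightarrow> complex \<Rightarrow> complex \<Rightarrow> complex poly poly list" where
  "subcase_basis Sub_i \<alpha> \<beta> = [1, lam]"
| "subcase_basis Sub_ii \<alpha> \<beta> = [lam^2 * (2 * (del + cst \<beta>) + lam)]"
| "subcase_basis Sub_iii \<alpha> \<beta> = [(del + cst \<beta>) * lam^2 * (del + cst \<beta> + lam)]"
| "subcase_basis Sub_iv \<alpha> \<beta> =
    [lam^2 * (4 * (del + cst \<beta>)^3 + 6 * (del + cst \<beta>)^2 * lam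
       - (del + cst \<beta>) * lam^2 + cst \<alpha> * lam^3)]"
| "subcase_basis Sub_v \<alpha> \<beta> =
    [(del + cst \<beta>)^4 * lam^2 - 10 * (del + cst \<beta>)^2 * lam^4
       - 17 * (del + cst \<beta>) * lam^5 - 8 * lam^6]"
| "subcase_basis Sub_vi \<alpha> \<beta> =
    [(del + cst \<beta>)^4 * lam^3 - cst (2 * \<alpha> + 3) * (del + cst \<beta>)^3 * lam^4
       - cst (3 * \<alpha>) * (del + cst \<beta>)^2 * lam^5 - cst (3 * \<alpha> + 1) * (del + cst \<beta>) * lam^6
       - cst (\<alpha> + 9 / 28) * lam^7]"

text \<open>
  The form in which the parameters of this subcase arise from the equation \<open>y\<^sup>2 = 3k + 1\<close> for \<open>k = 6\<close>,
  where \<open>y = 2\<alpha> + 5\<close>.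
\<close>

lemma subcase_vi_params_iff: "subcase_params Sub_vi \<alpha> \<alpha>' \<longleftrightarrow> \<alpha>' = \<alpha> + 6 \<and> (2 * \<alpha> + 5)\<^sup>2 = 19"
proof -
  have sq: "(of_real (sqrt 19) :: complex)\<^sup>2 = 19"
    by (metis of_real_numeral of_real_power real_sqrt_pow2_iff zero_le_numeral)
  show ?thesis
  proof
    assume "subcase_params Sub_vi \<alpha> \<alpha>'"
    then show "\<alpha>' = \<alpha> + 6 \<and> (2 * \<alpha> + 5)\<^sup>2 = 19"
      using sq by (auto simp: power2_eq_square)
  next
    assume a: "\<alpha>' = \<alpha> + 6 \<and> (2 * \<alpha> + 5)\<^sup>2 = 19"
    then have "(2 * \<alpha> + 5)\<^sup>2 = (of_real (sqrt 19))\<^sup>2" using sq by simp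
    then have "2 * \<alpha> + 5 = of_real (sqrt 19) \<or> 2 * \<alpha> + 5 = - of_real (sqrt 19)" by (simp only: power2_eq_iff)
    then have "of_real (sqrt 19) = 2 * \<alpha> + 5 \<or> of_real (sqrt 19) = - (2 * \<alpha> + 5)" by (metis minus_minus)
    then have "\<alpha> = - 5 / 2 + of_real (sqrt 19) / 2 \<or> \<alpha> = - 5 / 2 + (- 1) * of_real (sqrt 19) / 2"
      by (elim disjE) (simp_all add: field_simps)
    then show "subcase_params Sub_vi \<alpha> \<alpha>'" using a by auto
  qed
qed

lemma subcase_basis_cocycle:
  assumes "subcase_params k \<alpha> \<alpha>'" "H \<in> set (subcase_basis k \<alpha> \<beta>)"
  shows "vir_cocycle \<alpha> \<beta> \<alpha>' \<beta> H"
proof -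
  have hd: "H = hd (subcase_basis k \<alpha> \<beta>)" if "k \<noteq> Sub_i"
    using assms(2) that by (cases k) simp_all
  show ?thesis
  proof (cases k)
    case Sub_i
    then show ?thesis using assms by (auto simp: vir_cocycle_def algebra_simps)
  next
    case Sub_ii
    then have al: "\<alpha>' = \<alpha> + 2" and H: "H = lam^2 * (2 * (del + cst \<beta>) + lam)" using assms by (auto simp: algebra_simps)
    show ?thesis unfolding vir_cocycle_def H al by (simp del: mult_pCons_left mult_pCons_right) algebra
  next
    case Sub_iii
    then have al: "\<alpha>' = \<alpha> + 3" and H: "H = (del + cst \<beta>) * lam^2 * (del + cst \<beta> + lam)" using assms by (auto simp: algebra_simps)
    show ?thesis unfolding vir_cocycle_def H al by (simp del: mult_pCons_left mult_pCons_right) algebra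
  next
    case Sub_iv
    then have al: "\<alpha>' = \<alpha> + 4" using assms(1) by (simp add: algebra_simps)
    have H: "ev H x l = l^2 * (4 * (x + \<beta>)^3 + 6 * (x + \<beta>)^2 * l - (x + \<beta>) * l^2 + \<alpha> * l^3)" for x l
      by (subst hd) (simp_all add: Sub_iv algebra_simps)
    show ?thesis unfolding vir_cocycle_def H al by algebra
  next
    case Sub_v
    then have al: "\<alpha>' = 1" "\<alpha> = - 4" using assms(1) by simp_all
    have H: "ev H x l = (x + \<beta>)^4 * l^2 - 10 * (x + \<beta>)^2 * l^4 - 17 * (x + \<beta>) * l^5 - 8 * l^6" for x l
      by (subst hd) (simp_all add: Sub_v algebra_simps)
    show ?thesis unfolding vir_cocycle_def H al by algebra
  next
    case Sub_vi
    then have al: "\<alpha>' = \<alpha> + 6" and sq: "(2 * \<alpha> + 5)\<^sup>2 = 19"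
      using assms(1)[unfolded Sub_vi subcase_vi_params_iff] by blast+
    have "2 * \<alpha>\<^sup>2 + 10 * \<alpha> + 3 = ((2 * \<alpha> + 5)\<^sup>2 - 19) / 2"
      by (simp add: power2_eq_square field_simps)
    then have q: "2 * \<alpha>\<^sup>2 + 10 * \<alpha> + 3 = 0" unfolding sq by simp
    have H: "ev H x l = (x + \<beta>)^4 * l^3 - (2 * \<alpha> + 3) * (x + \<beta>)^3 * l^4
         - (3 * \<alpha>) * (x + \<beta>)^2 * l^5 - (3 * \<alpha> + 1) * (x + \<beta>) * l^6
         - (\<alpha> + 9 / 28) * l^7" for x l
      by (subst hd) (simp_all add: Sub_vi algebra_simps)
    show ?thesis unfolding vir_cocycle_def H al using q by algebra
  qed
qed

lemma subcase_basis_shift: "subcase_basis k \<alpha> \<beta> = map (shift_del \<beta>) (subcase_basis k \<alpha> 0)"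
  by (cases k) (auto intro!: ev_eqI simp: algebra_simps)

text \<open>
  The list contains the coefficients of \<open>\<lambda>\<^sup>2, \<lambda>\<^sup>3, \<dots>, \<lambda>\<^bsup>k+1\<^esup>\<close>.
\<close>

definition homogeneous_poly :: "nat \<Rightarrow> complex list \<Rightarrow> complex poly poly" where
  "homogeneous_poly k as = (\<Sum>i\<in>{2..k+1}. monom (monom (as ! (i - 2)) (k + 1 - i)) i)"

lemma cf_homogeneous_poly: "cf (homogeneous_poly k as) p i = (if 2 \<le> i \<and> p + i = k + 1 then as ! (i - 2) else 0)"
proof -
  have "cf (homogeneous_poly k as) p i = (\<Sum>j\<in>{2..k+1}. if j = i then if p + i = k + 1 then as ! (i - 2) else 0 else 0)"
    unfolding homogeneous_poly_def by (auto simp: coeff_sum intro!: sum.cong)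
  then show ?thesis by auto
qed

lemma ev_homogeneous_poly: "ev (homogeneous_poly k as) x l = (\<Sum>i\<in>{2..k+1}. as ! (i - 2) * x ^ (k + 1 - i) * l ^ i)"
  unfolding homogeneous_poly_def ev_sum by (intro sum.cong) (simp_all add: ev_def poly_monom)

text \<open>
  The determinant shows that the listed cocycle and the coboundary of \<open>\<partial>\<^sup>n\<close> are linearly independent;
  this gives the nontriviality and, with \<open>hcocycle_span\<close>, the completeness of the list.
\<close>

lemma subcase_basis_facts:
  assumes "k \<noteq> Sub_i" "subcase_params k \<alpha> \<alpha>'"
  obtains n H where "subcase_basis k \<alpha> 0 = [H]" "\<alpha>' = \<alpha> + of_nat n" "n \<in> {2..6}" "hcocycle n \<alpha> H"
    "coboundary_det \<alpha> n H \<noteq> 0"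
proof -
  note result = that
  have *: thesis if n: "\<alpha>' = \<alpha> + of_nat n" "n \<in> {2..6}" and H: "subcase_basis k \<alpha> 0 = [homogeneous_poly n as]"
    and det: "as ! 0 * (of_nat n * (of_nat n - 1) * (of_nat n - 2 + 3 * \<alpha>) / 6)
       \<noteq> as ! 1 * (of_nat n * (2 * \<alpha> + of_nat n - 1) / 2)"
    for n as
  proof (rule result[OF H n])
    have "vir_cocycle \<alpha> 0 \<alpha>' 0 (homogeneous_poly n as)"
      by (rule subcase_basis_cocycle[OF assms(2)]) (simp add: H)
    then show "hcocycle n \<alpha> (homogeneous_poly n as)"
      using n by (auto simp: homogeneous_def cf_homogeneous_poly split: if_splits)
    show "coboundary_det \<alpha> n (homogeneous_poly n as) \<noteq> 0"
    proof -
      have h: "cf (homogeneous_poly n as) (n - 1) 2 = as ! 0" "cf (homogeneous_poly n as) (n - 2) 3 = as ! 1"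
        using n by (simp_all add: cf_homogeneous_poly)
      have e: "cf (basic_coboundary \<alpha> n) (n - 2) 3 = of_nat n * (of_nat n - 1) * (of_nat n - 2 + 3 * \<alpha>) / 6"
        "cf (basic_coboundary \<alpha> n) (n - 1) 2 = of_nat n * (2 * \<alpha> + of_nat n - 1) / 2"
        by (rule basic_coboundary_2_3, use n in simp)+
      show ?thesis unfolding coboundary_det_def h e right_minus_eq by (rule det)
    qed
  qed
  have ivl: "{2..3} = {2,3::nat}" "{2..4} = {2,3,4::nat}" "{2..5} = {2,3,4,5::nat}" "{2..6} = {2,3,4,5,6::nat}"
    "{2..7} = {2,3,4,5,6,7::nat}" by auto
  have basis: "subcase_basis Sub_ii \<alpha> 0 = [homogeneous_poly 2 [2, 1]]"
    "subcase_basis Sub_iii \<alpha> 0 = [homogeneous_poly 3 [1, 1, 0]]"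
    "subcase_basis Sub_iv \<alpha> 0 = [homogeneous_poly 4 [4, 6, -1, \<alpha>]]"
    "subcase_basis Sub_v \<alpha> 0 = [homogeneous_poly 5 [1, 0, -10, -17, -8]]"
    "subcase_basis Sub_vi \<alpha> 0 = [homogeneous_poly 6 [0, 1, - (2 * \<alpha> + 3), - (3 * \<alpha>), - (3 * \<alpha> + 1), - (\<alpha> + 9 / 28)]]"
    by (auto simp: ev_homogeneous_poly ivl eval_nat_numeral algebra_simps intro!: ev_eqI)
  show thesis
  proof (cases k)
    case Sub_i
    then show ?thesis using assms by simp
  next
    case Sub_ii
    \<comment> \<open>The determinants in the five subcases are \<open>-1\<close>, \<open>-2\<close>, \<open>-20\<close>, \<open>-30\<close> and \<open>- 3(2\<alpha> + 5)\<close>.\<close>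
    show ?thesis
      by (rule *[OF _ _ basis(1)[folded Sub_ii]]) (use assms Sub_ii in \<open>auto simp: algebra_simps\<close>)
  next
    case Sub_iii
    show ?thesis
      by (rule *[OF _ _ basis(2)[folded Sub_iii]]) (use assms Sub_iii in \<open>auto simp: algebra_simps\<close>)
  next
    case Sub_iv
    show ?thesis
      by (rule *[OF _ _ basis(3)[folded Sub_iv]]) (use assms Sub_iv in \<open>auto simp: algebra_simps\<close>)
  next
    case Sub_v
    show ?thesis
      by (rule *[OF _ _ basis(4)[folded Sub_v]]) (use assms Sub_v in \<open>auto simp: algebra_simps\<close>)
  next
    case Sub_vi
    then have p: "\<alpha>' = \<alpha> + 6" "(2 * \<alpha> + 5)\<^sup>2 = 19" using assms(2) subcase_vi_params_iff by blast+
    then have "2 * \<alpha> + 5 \<noteq> 0" by (metis power_zero_numeral zero_neq_numeral)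
    moreover have "30 + 12 * \<alpha> = 6 * (2 * \<alpha> + 5)" by (simp add: algebra_simps)
    ultimately have p': "30 + 12 * \<alpha> \<noteq> 0" by (metis mult_eq_0_iff zero_neq_numeral)
    show ?thesis
      by (rule *[OF _ _ basis(5)[folded Sub_vi]]) (use p p' Sub_vi in simp_all)
  qed
qed

section \<open>Classification of the cocycles of one Virasoro algebra\<close>

definition lincomb :: "complex list \<Rightarrow> complex poly poly list \<Rightarrow> complex poly poly" where
  "lincomb cs Hs = sum_list (map2 (\<lambda>s H. cst s * H) cs Hs)"

lemma subcase_basis_length [simp]: "length (subcase_basis k \<alpha> \<beta>) = subcase_dim k"
  by (cases k) simp_all

lemma subcase_polys_eq:
  "subcase_polys k \<alpha> \<beta> = {lincomb cs (subcase_basis k \<alpha> \<beta>) | cs. length cs = subcase_dim k \<and> (\<exists>s\<in>set cs. s \<noteq> 0)}"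
proof -
  have 1: "{lincomb cs [H] | cs. length cs = 1 \<and> (\<exists>s\<in>set cs. s \<noteq> 0)} = {cst s * H | s. s \<noteq> 0}" for H
  proof -
    have "lincomb cs [H] \<in> {cst s * H | s. s \<noteq> 0}" if "length cs = 1" "\<exists>s\<in>set cs. s \<noteq> 0" for cs
      using that by (auto simp: lincomb_def length_Suc_conv)
    moreover have "\<exists>cs. cst s * H = lincomb cs [H] \<and> length cs = 1 \<and> (\<exists>s\<in>set cs. s \<noteq> 0)" if "s \<noteq> 0" for s
      using that by (intro exI[of _ "[s]"]) (simp add: lincomb_def)
    ultimately show ?thesis by blast
  qed
  have 2: "{lincomb cs [1, lam] | cs. length cs = 2 \<and> (\<exists>s\<in>set cs. s \<noteq> 0)}
      = {cst s0 + cst s1 * lam | s0 s1. (s0, s1) \<noteq> (0, 0)}"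
  proof -
    have "\<exists>s0 s1. lincomb cs [1, lam] = cst s0 + cst s1 * lam \<and> (s0, s1) \<noteq> (0, 0)"
      if "length cs = 2" "\<exists>s\<in>set cs. s \<noteq> 0" for cs
      using that by (auto simp: lincomb_def length_Suc_conv numeral_2_eq_2)
    moreover have "\<exists>cs. cst s0 + cst s1 * lam = lincomb cs [1, lam] \<and> length cs = 2 \<and> (\<exists>s\<in>set cs. s \<noteq> 0)"
      if "(s0, s1) \<noteq> (0, 0)" for s0 s1
      using that by (intro exI[of _ "[s0, s1]"]) (auto simp: lincomb_def)
    ultimately show ?thesis by blast
  qed
  show ?thesis
    by (cases k) (simp_all only: subcase_polys.simps subcase_basis.simps subcase_dim.simps 1 2 mult.assoc)
qed

lemma hcocycle_classification:
  assumes G: "hcocycle n \<alpha> G" and "n \<ge> 1" "\<alpha> \<noteq> 0"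
  shows "(\<exists>r. G = cst r * basic_coboundary \<alpha> n) \<or>
    (\<exists>k s r. k \<noteq> Sub_i \<and> subcase_params k \<alpha> (\<alpha> + of_nat n)
       \<and> G = cst s * hd (subcase_basis k \<alpha> 0) + cst r * basic_coboundary \<alpha> n)"
proof -
  have special: ?thesis if k: "k \<noteq> Sub_i" "subcase_params k \<alpha> (\<alpha> + of_nat n)" for k
  proof -
    obtain n' H where *: "subcase_basis k \<alpha> 0 = [H]" "\<alpha> + of_nat n = \<alpha> + of_nat n'" "n' \<in> {2..6}" "hcocycle n' \<alpha> H"
      "coboundary_det \<alpha> n' H \<noteq> 0"
      by (rule subcase_basis_facts[OF k])
    then have "n' = n" by simp
    then have "hcocycle n \<alpha> H" "n \<ge> 2"
      and "coboundary_det \<alpha> n H \<noteq> 0"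
      using *(3-5) by simp_all
    then obtain s r where "G = cst s * H + cst r * basic_coboundary \<alpha> n"
      by (rule hcocycle_span[OF G])
    then have "G = cst s * hd (subcase_basis k \<alpha> 0) + cst r * basic_coboundary \<alpha> n"
      using *(1) by (simp only: list.sel)
    then show ?thesis using k by blast
  qed
  consider "n = 1" | "n = 2" | "n = 3" | "n = 4" | "n \<ge> 5" using \<open>n \<ge> 1\<close> by linarith
  then show ?thesis
  proof cases
    case 1
    let ?B = "basic_coboundary \<alpha> n"
    have B: "hcocycle n \<alpha> ?B" by (rule hcocycle_basic_coboundary)
    have b2: "cf ?B (n - 1) 2 = \<alpha>" using basic_coboundary_2_3(1)[of n \<alpha>] 1 by simp
    define r where "r = cf G (n - 1) 2 / \<alpha>"
    have H: "hcocycle n \<alpha> (G - cst r * ?B)" by (rule hcocycle_comb[OF G B])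
    moreover have "cf (G - cst r * ?B) (n - 1) 2 = 0" unfolding cf_linear b2 r_def using \<open>\<alpha> \<noteq> 0\<close> by simp
    moreover have "cf (G - cst r * ?B) (n - 2) 3 = 0"
    proof (rule ccontr)
      assume "cf (G - cst r * ?B) (n - 2) 3 \<noteq> 0"
      then have "n - 2 + 3 = n + 1" using H unfolding homogeneous_def by blast
      then show False using 1 by simp
    qed
    ultimately have "G - cst r * ?B = 0" by (rule hcocycle_eq_0)
    then show ?thesis by auto
  next
    case 2
    then show ?thesis by (intro special[of Sub_ii]) auto
  next
    case 3
    then show ?thesis by (intro special[of Sub_iii]) auto
  next
    case 4
    then show ?thesis by (intro special[of Sub_iv]) auto
  next
    case 5
    show ?thesis
    proof (cases "\<exists>r. G = cst r * basic_coboundary \<alpha> n")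
      case False
      then have "n = 5 \<and> \<alpha> = - 4 \<or> n = 6 \<and> (2 * \<alpha> + 5)\<^sup>2 = 19"
        using hcocycle_large_degree[OF G 5 \<open>\<alpha> \<noteq> 0\<close>] by blast
      then show ?thesis
      proof
        assume "n = 5 \<and> \<alpha> = - 4"
        then show ?thesis by (intro special[of Sub_v]) auto
      next
        assume "n = 6 \<and> (2 * \<alpha> + 5)\<^sup>2 = 19"
        then have "subcase_params Sub_vi \<alpha> (\<alpha> + of_nat n)" unfolding subcase_vi_params_iff by simp
        then show ?thesis by (intro special[of Sub_vi]) simp_all
      qed
    qed blast
  qed
qed

text \<open>
  At \<open>\<mu> = 0\<close> the cocycle equation expresses \<open>(\<beta> - \<beta>')F\<close> as the coboundary of \<open>F(\<partial>, 0)\<close>.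
\<close>

lemma coboundary_different_shift:
  assumes F: "vir_cocycle \<alpha> \<beta> \<alpha>' \<beta>' F" and "\<beta>' \<noteq> \<beta>"
  shows "F = vir_coboundary \<alpha> \<beta> \<alpha>' \<beta>' (smult (1 / (\<beta> - \<beta>')) (coeff F 0))"
proof (rule ev_eqI)
  fix x l
  have ev0: "poly (coeff F 0) x = ev F x 0" for x
    by (simp add: ev_def poly_0_coeff_0)
  have "(x + \<alpha> * l + \<beta>) * ev F (x + l) 0 - (x + \<alpha>' * l + \<beta>') * ev F x 0 = (\<beta> - \<beta>') * ev F x l"
    using F[unfolded vir_cocycle_def, rule_format, of x l 0] by (simp add: algebra_simps)
  then have "ev F x l = ((x + \<alpha> * l + \<beta>) * ev F (x + l) 0 - (x + \<alpha>' * l + \<beta>') * ev F x 0) / (\<beta> - \<beta>')"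
    using \<open>\<beta>' \<noteq> \<beta>\<close> by simp
  also have "\<dots> = ev (vir_coboundary \<alpha> \<beta> \<alpha>' \<beta>' (smult (1 / (\<beta> - \<beta>')) (coeff F 0))) x l"
    unfolding ev_vir_coboundary poly_smult ev0 by (simp add: diff_divide_distrib)
  finally show "ev F x l = ev (vir_coboundary \<alpha> \<beta> \<alpha>' \<beta>' (smult (1 / (\<beta> - \<beta>')) (coeff F 0))) x l" .
qed

lemma vir_cocycle_classification_0:
  assumes F: "vir_cocycle \<alpha> 0 \<alpha>' 0 F" and "\<alpha> \<noteq> 0"
  shows "(\<exists>\<phi>. F = vir_coboundary \<alpha> 0 \<alpha>' 0 \<phi>) \<or>
    (\<exists>k cs \<phi>. subcase_params k \<alpha> \<alpha>' \<and> length cs = subcase_dim k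
       \<and> F = lincomb cs (subcase_basis k \<alpha> 0) + vir_coboundary \<alpha> 0 \<alpha>' 0 \<phi>)"
proof -
  obtain \<phi> G where FG: "F = G + vir_coboundary \<alpha> 0 \<alpha>' 0 \<phi>" and G: "vir_cocycle \<alpha> 0 \<alpha>' 0 G"
    and supp: "\<And>p i. cf G p i \<noteq> 0 \<Longrightarrow>
       i \<ge> 2 \<and> \<alpha>' = \<alpha> + of_nat (p + i - 1) \<or> p = 0 \<and> i \<le> 1 \<and> \<alpha>' = \<alpha>"
    by (rule cocycle_normal_form[OF F \<open>\<alpha> \<noteq> 0\<close>]) blast
  show ?thesis
  proof (cases "\<exists>n. \<alpha>' = \<alpha> + of_nat n")
    case False
    then have "\<alpha>' \<noteq> \<alpha>" by (metis add.right_neutral of_nat_0)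
    with False have "cf G p i = 0" for p i using supp by blast
    then have "G = 0" by (intro cf_eqI) simp
    then show ?thesis using FG by (intro disjI1 exI[of _ \<phi>]) simp
  next
    case True
    then obtain n where n: "\<alpha>' = \<alpha> + of_nat n" by blast
    show ?thesis
    proof (cases "n = 0")
      case True
      have G_cf: "cf G p i = cf (lincomb [cf G 0 0, cf G 0 1] [1, lam]) p i" for p i
      proof (cases "p = 0 \<and> i \<le> 1")
        case True
        then show ?thesis by (cases i) (auto simp: lincomb_def)
      next
        case False
        have "cf G p i = 0"
        proof (rule ccontr)
          assume "cf G p i \<noteq> 0"
          then have "i \<ge> 2 \<and> \<alpha>' = \<alpha> + of_nat (p + i - 1)" using supp False by blast
          then have "of_nat (p + i - 1) = (0 :: complex)" "i \<ge> 2" using n True by simp_all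
          then show False by (simp only: of_nat_eq_0_iff)
        qed
        moreover have "cf (lincomb [cf G 0 0, cf G 0 1] [1, lam]) p i = 0"
          using False by (cases p; cases i) (auto simp: lincomb_def coeff_pCons split: nat.splits)
        ultimately show ?thesis by simp
      qed
      have "G = lincomb [cf G 0 0, cf G 0 1] (subcase_basis Sub_i \<alpha> 0)"
        unfolding subcase_basis.simps by (rule cf_eqI) (rule G_cf)
      moreover have "subcase_params Sub_i \<alpha> \<alpha>'" using n True by simp
      ultimately show ?thesis using FG by (intro disjI2 exI[of _ Sub_i] exI[of _ "[cf G 0 0, cf G 0 1]"] exI[of _ \<phi>])
          (simp only: subcase_dim.simps, simp)
    next
      case False
      have "homogeneous n G"
        unfolding homogeneous_def
      proof (intro allI impI)
        fix p i
        assume "cf G p i \<noteq> 0"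
        then have "i \<ge> 2 \<and> \<alpha>' = \<alpha> + of_nat (p + i - 1)" using supp n False by force
        then have "i \<ge> 2" "p + i - 1 = n" using n by (simp_all only: add_left_cancel of_nat_eq_iff)
        then show "i \<ge> 2 \<and> p + i = n + 1" by simp
      qed
      then have "hcocycle n \<alpha> G" using G n by simp
      moreover have "n \<ge> 1" using False by simp
      ultimately consider (1) r where "G = cst r * basic_coboundary \<alpha> n"
        | (2) k s r where "k \<noteq> Sub_i" "subcase_params k \<alpha> (\<alpha> + of_nat n)"
            "G = cst s * hd (subcase_basis k \<alpha> 0) + cst r * basic_coboundary \<alpha> n"
        using hcocycle_classification[OF _ _ \<open>\<alpha> \<noteq> 0\<close>] by blast
      then show ?thesis
      proof cases
        case (1 r)
        have "F = vir_coboundary \<alpha> 0 \<alpha>' 0 (smult r (monom 1 n) + \<phi>)"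
          unfolding FG 1 vir_coboundary_linear n by simp
        then show ?thesis by blast
      next
        case (2 k s r)
        have "cst s * hd (subcase_basis k \<alpha> 0) = lincomb [s] (subcase_basis k \<alpha> 0)" "subcase_dim k = 1"
          using 2(1) by (cases k; simp add: lincomb_def)+
        then have "F = lincomb [s] (subcase_basis k \<alpha> 0) + vir_coboundary \<alpha> 0 \<alpha>' 0 (smult r (monom 1 n) + \<phi>)"
          unfolding FG 2(3) vir_coboundary_linear n by simp
        then show ?thesis using 2(2) \<open>subcase_dim k = 1\<close> n by (intro disjI2 exI[of _ k] exI[of _ "[s]"]) auto
      qed
    qed
  qed
qed

lemma shift_del_linear:
  "shift_del \<beta> (F + G) = shift_del \<beta> F + shift_del \<beta> G"
  "shift_del \<beta> (cst s * F) = cst s * shift_del \<beta> F"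
  "shift_del \<beta> 0 = 0" "shift_del \<beta> (shift_del (- \<beta>) F) = F" "shift_del (- \<beta>) (shift_del \<beta> F) = F"
  by (rule ev_eqI, simp)+

lemma lincomb_simps [simp]: "lincomb [] Hs = 0" "lincomb cs [] = 0"
  "lincomb (c # cs) (H # Hs) = cst c * H + lincomb cs Hs"
  by (simp_all add: lincomb_def)

lemma shift_del_lincomb: "shift_del \<beta> (lincomb cs Hs) = lincomb cs (map (shift_del \<beta>) Hs)"
proof (induction cs arbitrary: Hs)
  case (Cons c cs)
  then show ?case by (cases Hs) (simp_all only: lincomb_simps list.map shift_del_linear)
qed (simp add: shift_del_linear)

lemma lincomb_zero: "\<forall>s\<in>set cs. s = 0 \<Longrightarrow> lincomb cs Hs = 0"
proof (induction cs arbitrary: Hs)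
  case (Cons c cs)
  then show ?case by (cases Hs) simp_all
qed simp

lemma vir_cocycle_classification:
  assumes F: "vir_cocycle \<alpha> \<beta> \<alpha>' \<beta>' F" and "\<alpha> \<noteq> 0"
  shows "(\<exists>\<phi>. F = vir_coboundary \<alpha> \<beta> \<alpha>' \<beta>' \<phi>) \<or>
    (\<beta>' = \<beta> \<and> (\<exists>k f \<phi>. subcase_params k \<alpha> \<alpha>' \<and> f \<in> subcase_polys k \<alpha> \<beta>
       \<and> F = f + vir_coboundary \<alpha> \<beta> \<alpha>' \<beta>' \<phi>))"
proof (cases "\<beta>' = \<beta>")
  case False
  then show ?thesis using coboundary_different_shift[OF F] by blast
next
  case True
  then have "vir_cocycle \<alpha> 0 \<alpha>' 0 (shift_del (- \<beta>) F)"
    using F vir_cocycle_shift by blast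
  from vir_cocycle_classification_0[OF this \<open>\<alpha> \<noteq> 0\<close>]
  show ?thesis
  proof (elim disjE exE conjE)
    fix \<phi>
    assume "shift_del (- \<beta>) F = vir_coboundary \<alpha> 0 \<alpha>' 0 \<phi>"
    then have "F = shift_del \<beta> (vir_coboundary \<alpha> 0 \<alpha>' 0 \<phi>)" by (metis shift_del_linear(4))
    then show ?thesis using True by (auto simp: shift_coboundary)
  next
    fix k cs \<phi>
    assume k: "subcase_params k \<alpha> \<alpha>'" and cs: "length cs = subcase_dim k"
      and "shift_del (- \<beta>) F = lincomb cs (subcase_basis k \<alpha> 0) + vir_coboundary \<alpha> 0 \<alpha>' 0 \<phi>"
    then have "F = shift_del \<beta> (lincomb cs (subcase_basis k \<alpha> 0) + vir_coboundary \<alpha> 0 \<alpha>' 0 \<phi>)"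
      by (metis shift_del_linear(4))
    also have "\<dots> = lincomb cs (subcase_basis k \<alpha> \<beta>) + vir_coboundary \<alpha> \<beta> \<alpha>' \<beta> (pcompose \<phi> [:\<beta>, 1:])"
      by (simp only: shift_del_linear shift_del_lincomb shift_coboundary subcase_basis_shift[of k \<alpha> \<beta>])
    finally have F_eq: "F = lincomb cs (subcase_basis k \<alpha> \<beta>) + vir_coboundary \<alpha> \<beta> \<alpha>' \<beta>' (pcompose \<phi> [:\<beta>, 1:])"
      using True by simp
    show ?thesis
    proof (cases "\<exists>s\<in>set cs. s \<noteq> 0")
      case True
      then have "lincomb cs (subcase_basis k \<alpha> \<beta>) \<in> subcase_polys k \<alpha> \<beta>"
        using cs unfolding subcase_polys_eq by blast
      then show ?thesis using F_eq k \<open>\<beta>' = \<beta>\<close> by blast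
    next
      case False
      then show ?thesis using F_eq by (auto simp: lincomb_zero)
    qed
  qed
qed

text \<open>
  If a multiple of the listed cocycle is a coboundary, its coefficients at \<open>\<lambda>\<^sup>2\<close> and \<open>\<lambda>\<^sup>3\<close> are those of
  a multiple of the coboundary of \<open>\<partial>\<^sup>n\<close>, and the determinant of \<open>subcase_basis_facts\<close> is nonzero.  In the
  first subcase every coboundary has zero coefficients at \<open>1\<close> and \<open>\<lambda>\<close>.
\<close>

lemma subcase_basis_independent:
  assumes k: "subcase_params k \<alpha> \<alpha>'" and cs: "length cs = subcase_dim k"
    and eq: "lincomb cs (subcase_basis k \<alpha> \<beta>) = vir_coboundary \<alpha> \<beta> \<alpha>' \<beta> \<phi>"
  shows "\<forall>s\<in>set cs. s = 0"
proof -
  define \<psi> where "\<psi> = pcompose \<phi> [:- \<beta>, 1:]"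
  have "vir_coboundary \<alpha> \<beta> \<alpha>' \<beta> \<phi> = shift_del \<beta> (vir_coboundary \<alpha> 0 \<alpha>' 0 \<psi>)"
    by (rule ev_eqI) (simp add: \<psi>_def poly_pcompose algebra_simps)
  then have eq0: "lincomb cs (subcase_basis k \<alpha> 0) = vir_coboundary \<alpha> 0 \<alpha>' 0 \<psi>"
    using eq unfolding subcase_basis_shift[of k \<alpha> \<beta>] shift_del_lincomb[symmetric]
    by (metis shift_del_linear(5))
  show ?thesis
  proof (cases "k = Sub_i")
    case True
    then obtain s t where cs2: "cs = [s, t]" using cs by (auto simp: length_Suc_conv numeral_2_eq_2)
    have L: "lincomb cs (subcase_basis k \<alpha> 0) = [:[:s:], [:t:]:]" using True by (simp add: cs2)
    have "\<alpha>' = \<alpha>" using k True by simp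
    have "s = cf (vir_coboundary \<alpha> 0 \<alpha>' 0 \<psi>) 0 0" unfolding eq0[symmetric] L by simp
    moreover have "t = cf (vir_coboundary \<alpha> 0 \<alpha>' 0 \<psi>) 0 1" unfolding eq0[symmetric] L by simp
    ultimately show ?thesis unfolding cf_coboundary_0 cf_coboundary_1 using cs2 \<open>\<alpha>' = \<alpha>\<close> by simp
  next
    case False
    obtain n H where *: "subcase_basis k \<alpha> 0 = [H]" "\<alpha>' = \<alpha> + of_nat n" "n \<in> {2..6}"
      "coboundary_det \<alpha> n H \<noteq> 0"
      by (rule subcase_basis_facts[OF False k]) blast
    have "subcase_dim k = 1" using False by (cases k) simp_all
    then obtain s where cs1: "cs = [s]" using cs by (auto simp: length_Suc_conv)
    have sH: "vir_coboundary \<alpha> 0 (\<alpha> + of_nat n) 0 \<psi> = cst s * H"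
      using eq0 by (simp add: cs1 *(1,2))
    obtain m where m: "n = m + 2" using *(3) by (metis add.commute atLeastAtMost_iff le_Suc_ex)
    have "s * cf H (n - 1) 2 = coeff \<psi> n * cf (basic_coboundary \<alpha> n) (n - 1) 2"
      using cf_coboundary_ge2[where \<alpha> = \<alpha> and \<alpha>' = "\<alpha> + of_nat n" and \<phi> = \<psi> and p = "m + 1" and i = 0] cf_basic_coboundary[of 2 1 "m + 1" n \<alpha>]
      unfolding sH by (simp add: m numeral_2_eq_2 del: binomial_Suc_Suc)
    moreover have "s * cf H (n - 2) 3 = coeff \<psi> n * cf (basic_coboundary \<alpha> n) (n - 2) 3"
      using cf_coboundary_ge2[where \<alpha> = \<alpha> and \<alpha>' = "\<alpha> + of_nat n" and \<phi> = \<psi> and p = m and i = 1] cf_basic_coboundary[of 3 2 m n \<alpha>]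
      unfolding sH by (simp add: m numeral_2_eq_2 numeral_3_eq_3 del: binomial_Suc_Suc)
    ultimately have "s * coboundary_det \<alpha> n H = 0"
      unfolding coboundary_det_def by (simp add: algebra_simps) algebra
    then have "s = 0" using *(4) by simp
    then show ?thesis by (simp add: cs1)
  qed
qed

definition subcase_gap :: "subcase \<Rightarrow> nat" where
  "subcase_gap k = (case k of Sub_i \<Rightarrow> 0 | Sub_ii \<Rightarrow> 2 | Sub_iii \<Rightarrow> 3 | Sub_iv \<Rightarrow> 4 | Sub_v \<Rightarrow> 5 | Sub_vi \<Rightarrow> 6)"

lemma subcase_params_diff: "subcase_params k \<alpha> \<alpha>' \<Longrightarrow> \<alpha>' - \<alpha> = of_nat (subcase_gap k)"
proof (cases k)
  case Sub_vi
  assume "subcase_params k \<alpha> \<alpha>'"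
  then show ?thesis unfolding Sub_vi subcase_vi_params_iff by (simp add: subcase_gap_def)
qed (auto simp: subcase_gap_def)

lemma subcase_params_unique:
  assumes "subcase_params k \<alpha> \<alpha>'" "subcase_params k' \<alpha> \<alpha>'"
  shows "k = k'"
proof -
  have "subcase_gap k = subcase_gap k'"
    using subcase_params_diff[OF assms(1)] subcase_params_diff[OF assms(2)] by (metis of_nat_eq_iff)
  then show ?thesis by (cases k; cases k') (simp_all add: subcase_gap_def)
qed

lemma subcase_params_range: "subcase_params k \<alpha> \<alpha>' \<Longrightarrow> \<alpha>' - \<alpha> \<in> {0, 1, 2, 3, 4, 5, 6}"
  by (drule subcase_params_diff) (cases k; simp add: subcase_gap_def)

lemma cocycle_basis_decomposition:
  assumes k: "subcase_params k \<alpha> \<alpha>'" and "\<alpha> \<noteq> 0" and F: "vir_cocycle \<alpha> \<beta> \<alpha>' \<beta> F"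
  obtains cs \<phi> where "length cs = subcase_dim k"
    "F = lincomb cs (subcase_basis k \<alpha> \<beta>) + vir_coboundary \<alpha> \<beta> \<alpha>' \<beta> \<phi>"
proof -
  consider \<phi> where "F = vir_coboundary \<alpha> \<beta> \<alpha>' \<beta> \<phi>"
    | k' f \<phi> where "subcase_params k' \<alpha> \<alpha>'" "f \<in> subcase_polys k' \<alpha> \<beta>" "F = f + vir_coboundary \<alpha> \<beta> \<alpha>' \<beta> \<phi>"
    using vir_cocycle_classification[OF F \<open>\<alpha> \<noteq> 0\<close>] by blast
  then show thesis
  proof cases
    case (1 \<phi>)
    show ?thesis by (rule that[of "replicate (subcase_dim k) 0" \<phi>]) (simp_all add: 1 lincomb_zero)
  next
    case (2 k' f \<phi>)
    have "k' = k" by (rule subcase_params_unique[OF 2(1) k])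
    then show ?thesis using 2(2,3) that unfolding subcase_polys_eq by blast
  qed
qed

lemma subcase_polys_cocycle:
  assumes "subcase_params k \<alpha> \<alpha>'" "f \<in> subcase_polys k \<alpha> \<beta>"
  shows "vir_cocycle \<alpha> \<beta> \<alpha>' \<beta> f"
proof -
  have "vir_cocycle \<alpha> \<beta> \<alpha>' \<beta> (lincomb cs Hs)" if "\<forall>H\<in>set Hs. vir_cocycle \<alpha> \<beta> \<alpha>' \<beta> H" for cs Hs
    using that
  proof (induction cs arbitrary: Hs)
    case (Cons c cs)
    show ?case
    proof (cases Hs)
      case Hs: (Cons H Hs')
      show ?thesis unfolding Hs lincomb_simps using Cons.IH Cons.prems Hs
        by (intro vir_cocycle_linear) simp_all
    qed (simp add: vir_cocycle_linear)
  qed (simp add: vir_cocycle_linear)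
  then show ?thesis
    using assms subcase_basis_cocycle[OF assms(1)] unfolding subcase_polys_eq by blast
qed

lemma subcase_polys_not_coboundary:
  assumes "subcase_params k \<alpha> \<alpha>'" "f \<in> subcase_polys k \<alpha> \<beta>"
  shows "f \<noteq> vir_coboundary \<alpha> \<beta> \<alpha>' \<beta> \<phi>"
proof
  assume eq: "f = vir_coboundary \<alpha> \<beta> \<alpha>' \<beta> \<phi>"
  obtain cs where "length cs = subcase_dim k" "\<exists>s\<in>set cs. s \<noteq> 0" "f = lincomb cs (subcase_basis k \<alpha> \<beta>)"
    using assms(2) unfolding subcase_polys_eq by blast
  then show False using subcase_basis_independent[OF assms(1), of cs \<beta> \<phi>] eq by blast
qed

section \<open>Sesquilinear maps and conformal modules\<close>

lemma subst_lam_bound: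
  assumes "module sc" "degree p \<le> N"
  shows "subst_lam sc t p = (\<Sum>i\<le>N. sc (t ^ i) (coeff p i))"
proof -
  interpret module sc by (rule assms(1))
  show ?thesis unfolding subst_lam_def using assms(2)
    by (intro sum.mono_neutral_left) (auto simp: not_le coeff_eq_0)
qed

lemma subst_lam_0 [simp]: "module sc \<Longrightarrow> subst_lam sc t 0 = 0"
  by (simp add: subst_lam_def module.scale_zero_right)

lemma subst_lam_add:
  assumes "module sc"
  shows "subst_lam sc t (p + q) = subst_lam sc t p + subst_lam sc t q"
proof -
  interpret module sc by (rule assms)
  let ?N = "max (degree p) (degree q)"
  show ?thesis
    using subst_lam_bound[OF assms, of p ?N t] subst_lam_bound[OF assms, of q ?N t]
      subst_lam_bound[OF assms degree_add_le_max, of t p q]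
    by (simp add: scale_right_distrib sum.distrib)
qed

lemma subst_lam_map_poly:
  assumes "module_hom sc sc' h"
  shows "subst_lam sc' t (map_poly h p) = h (subst_lam sc t p)"
proof -
  interpret module_hom sc sc' h by (rule assms)
  have "degree (map_poly h p) \<le> degree p"
    by (rule degree_le) (simp add: coeff_map_poly zero coeff_eq_0)
  then show ?thesis
    using subst_lam_bound[OF m2.module_axioms, of "map_poly h p" "degree p" t]
    by (simp add: subst_lam_def coeff_map_poly zero sum scale)
qed

lemma subst_lam_app_poly:
  assumes "module sc"
  shows "subst_lam sc [:z:] (app_poly sc F v) = sc (poly F [:z:]) v"
proof -
  interpret module sc by (rule assms)
  have "degree (app_poly sc F v) \<le> degree F"
    by (rule degree_le) (simp add: app_poly_def coeff_map_poly coeff_eq_0)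
  then have "subst_lam sc [:z:] (app_poly sc F v) = (\<Sum>i\<le>degree F. sc ([:z:] ^ i) (sc (coeff F i) v))"
    using subst_lam_bound[OF assms, of "app_poly sc F v" "degree F" "[:z:]"]
    by (simp add: app_poly_def coeff_map_poly)
  also have "\<dots> = sc (poly F [:z:]) v"
    by (simp add: poly_altdef scale_sum_left mult.commute)
  finally show ?thesis .
qed

text \<open>
  The value of \<open>F(a, x) \<in> V[\<lambda>]\<close> at \<open>\<lambda> = z\<close>.  An element of \<open>V[\<lambda>]\<close> is determined by its values, so that
  identities are stated and proved for values throughout.
\<close>

abbreviation val :: "(complex poly \<Rightarrow> 'v \<Rightarrow> 'v) \<Rightarrow> ('r \<Rightarrow> 'w \<Rightarrow> 'v poly) \<Rightarrow> complex \<Rightarrow> 'r \<Rightarrow> 'w \<Rightarrow> 'v::ab_group_add" where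
  "val sc F z a x \<equiv> subst_lam sc [:z:] (F a x)"

text \<open>
  The laws common to the bracket, the action on a module and a cocycle: \<open>p(\<partial>)\<close> in the first
  argument acts as \<open>p(-\<lambda>)\<close>, and in the second argument as \<open>p(\<partial> + \<lambda>)\<close>.
\<close>

definition sesquilinear where
  "sesquilinear scr scw scv F \<longleftrightarrow>
    (\<forall>z a b x. val scv F z (a + b) x = val scv F z a x + val scv F z b x) \<and>
    (\<forall>z a x y. val scv F z a (x + y) = val scv F z a x + val scv F z a y) \<and>
    (\<forall>z p a x. val scv F z (scr p a) x = scv [:poly p (- z):] (val scv F z a x)) \<and>
    (\<forall>z p a x. val scv F z a (scw p x) = scv (pcompose p [:z, 1:]) (val scv F z a x))"

lemma sesquilinearD:
  assumes "sesquilinear scr scw scv F"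
  shows "val scv F z (a + b) x = val scv F z a x + val scv F z b x"
    "val scv F z a (x + y) = val scv F z a x + val scv F z a y"
    "val scv F z (scr p a) x = scv [:poly p (- z):] (val scv F z a x)"
    "val scv F z a (scw p x) = scv (pcompose p [:z, 1:]) (val scv F z a x)"
  using assms unfolding sesquilinear_def by blast+

lemma module_hom_const:
  assumes "module sc"
  shows "module_hom sc sc (sc p)"
proof -
  interpret module sc by (rule assms)
  show ?thesis by unfold_locales (simp_all add: scale_right_distrib mult.commute)
qed

text \<open>
  The general laws follow from the additive ones, those for complex numbers and those for \<open>\<partial>\<close>, by
  induction on the polynomial.
\<close>

lemma sesquilinear_iff:
  fixes scr :: "complex poly \<Rightarrow> 'r \<Rightarrow> 'r::ab_group_add" and sc :: "complex poly \<Rightarrow> 'm \<Rightarrow> 'm::ab_group_add"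
  assumes "module scr" "module sc"
  shows "sesquilinear scr sc sc F \<longleftrightarrow> poly_bilinear scr sc F \<and>
    (\<forall>z a x. val sc F z (scr [:0, 1:] a) x = sc [:-z:] (val sc F z a x)) \<and>
    (\<forall>z a x. val sc F z a (sc [:0, 1:] x) = sc [:z, 1:] (val sc F z a x))"
    (is "_ \<longleftrightarrow> ?B \<and> ?D1 \<and> ?D2")
proof
  interpret R: module scr by (rule assms(1))
  interpret M: module sc by (rule assms(2))
  note hom = subst_lam_map_poly[OF module_hom_const[OF assms(2)]]
  assume S: "sesquilinear scr sc sc F"
  note D = sesquilinearD[OF S]
  have ?B unfolding poly_bilinear_def
  proof (intro conjI allI)
    show "F (a + b) x = F a x + F b x" for a b x
      by (rule subst_lam_eqI[OF assms(2)]) (simp add: subst_lam_add[OF assms(2)] D)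
    show "F a (x + y) = F a x + F a y" for a x y
      by (rule subst_lam_eqI[OF assms(2)]) (simp add: subst_lam_add[OF assms(2)] D)
    show "F (scr [:c:] a) x = map_poly (sc [:c:]) (F a x)" for c a x
      by (rule subst_lam_eqI[OF assms(2)]) (simp add: hom D)
    show "F a (sc [:c:] x) = map_poly (sc [:c:]) (F a x)" for c a x
      by (rule subst_lam_eqI[OF assms(2)]) (simp add: hom D)
  qed
  then show "?B \<and> ?D1 \<and> ?D2" by (simp add: D pcompose_pCons)
next
  interpret R: module scr by (rule assms(1))
  interpret M: module sc by (rule assms(2))
  note hom = subst_lam_map_poly[OF module_hom_const[OF assms(2)]]
  assume A: "?B \<and> ?D1 \<and> ?D2"
  then have addl: "val sc F z (a + b) x = val sc F z a x + val sc F z b x"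
    and addr: "val sc F z a (x + y) = val sc F z a x + val sc F z a y"
    and cl: "val sc F z (scr [:c:] a) x = sc [:c:] (val sc F z a x)"
    and cr: "val sc F z a (sc [:c:] x) = sc [:c:] (val sc F z a x)"
    and dl: "val sc F z (scr [:0, 1:] a) x = sc [:-z:] (val sc F z a x)"
    and dr: "val sc F z a (sc [:0, 1:] x) = sc [:z, 1:] (val sc F z a x)" for z a b c x y
    by (simp_all add: poly_bilinear_def subst_lam_add[OF assms(2)] hom)
  have split: "pCons c p = [:c:] + [:0, 1:] * p" for c :: complex and p by simp
  have l: "val sc F z (scr p a) x = sc [:poly p (- z):] (val sc F z a x)" for z p a x
  proof (induction p)
    case 0
    then show ?case using cl[of z 0 a x] by (simp add: R.scale_zero_left M.scale_zero_left)
  next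
    case (pCons c p)
    have "scr (pCons c p) a = scr [:c:] a + scr [:0, 1:] (scr p a)"
      unfolding R.scale_scale R.scale_left_distrib[symmetric] split[symmetric] ..
    then have "val sc F z (scr (pCons c p) a) x = sc [:c:] (val sc F z a x) + sc [:-z:] (sc [:poly p (- z):] (val sc F z a x))"
      by (simp only: addl cl dl pCons.IH)
    also have "\<dots> = sc [:poly (pCons c p) (- z):] (val sc F z a x)"
      unfolding M.scale_scale M.scale_left_distrib[symmetric] by (simp add: mult.commute)
    finally show ?case .
  qed
  have r: "val sc F z a (sc p x) = sc (pcompose p [:z, 1:]) (val sc F z a x)" for z p a x
  proof (induction p)
    case 0
    then show ?case using cr[of z a 0 x] by (simp add: M.scale_zero_left)
  next
    case (pCons c p)
    have "sc (pCons c p) x = sc [:c:] x + sc [:0, 1:] (sc p x)"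
      unfolding M.scale_scale M.scale_left_distrib[symmetric] split[symmetric] ..
    then have "val sc F z a (sc (pCons c p) x) = sc [:c:] (val sc F z a x) + sc [:z, 1:] (sc (pcompose p [:z, 1:]) (val sc F z a x))"
      by (simp only: addr cr dr pCons.IH)
    also have "\<dots> = sc (pcompose (pCons c p) [:z, 1:]) (val sc F z a x)"
      unfolding M.scale_scale M.scale_left_distrib[symmetric] pcompose_pCons ..
    finally show ?case .
  qed
  show "sesquilinear scr sc sc F"
    unfolding sesquilinear_def using addl addr l r by blast
qed

abbreviation lact :: "('r::ab_group_add, 'm::ab_group_add) cmod \<Rightarrow> complex \<Rightarrow> 'r \<Rightarrow> 'm \<Rightarrow> 'm" where
  "lact M z a x \<equiv> val (mscale M) (act M) z a x"

abbreviation lbr :: "'r::ab_group_add lca \<Rightarrow> complex \<Rightarrow> 'r \<Rightarrow> 'r \<Rightarrow> 'r" where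
  "lbr R z a b \<equiv> val (rscale R) (bracket R) z a b"

lemma conformal_module_iff:
  assumes "module (rscale R)"
  shows "conformal_module R M \<longleftrightarrow> module (mscale M) \<and>
    sesquilinear (rscale R) (mscale M) (mscale M) (act M) \<and>
    (\<forall>z w a b x. lact M z a (lact M w b x) = lact M (z + w) (lbr R z a b) x + lact M w b (lact M z a x))"
  unfolding conformal_module_def Let_def using sesquilinear_iff[OF assms, of "mscale M" "act M"] by blast

lemma lie_conformal_algebra_sesquilinear:
  assumes "lie_conformal_algebra R"
  shows "module (rscale R)" "sesquilinear (rscale R) (rscale R) (rscale R) (bracket R)"
proof -
  show "module (rscale R)" using assms unfolding lie_conformal_algebra_def by blast
  then show "sesquilinear (rscale R) (rscale R) (rscale R) (bracket R)"
    using assms sesquilinear_iff[of "rscale R" "rscale R" "bracket R"]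
    unfolding lie_conformal_algebra_def Let_def by blast
qed

lemma conformal_hom_iff:
  assumes "module (mscale N)"
  shows "conformal_hom M N h \<longleftrightarrow> module_hom (mscale M) (mscale N) h \<and>
    (\<forall>z a x. lact N z a (h x) = h (lact M z a x))"
  unfolding conformal_hom_def
  using subst_lam_map_poly[of "mscale M" "mscale N" h] subst_lam_eqI[OF assms] by metis

section \<open>The cocycle identity\<close>

abbreviation cocycle_module where "cocycle_module W V \<phi> \<equiv> emod (cocycle_ext W V \<phi>)"

lemma mscale_cocycle_module [simp]:
  "mscale (cocycle_module W V \<phi>) p (x, y) = (mscale V p x, mscale W p y)"
  by (simp add: cocycle_ext_def)

lemma module_cocycle_module:
  assumes "module (mscale V)" "module (mscale W)"
  shows "module (mscale (cocycle_module W V \<phi>))"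
proof -
  interpret V: module "mscale V" by (rule assms)
  interpret W: module "mscale W" by (rule assms)
  show ?thesis
    by unfold_locales (auto simp: V.scale_right_distrib V.scale_left_distrib W.scale_right_distrib W.scale_left_distrib)
qed

lemma lact_cocycle_module:
  assumes "module (mscale V)" "module (mscale W)"
  shows "lact (cocycle_module W V \<phi>) z a (x, y) = (lact V z a x + val (mscale V) \<phi> z a y, lact W z a y)"
proof -
  interpret V: module "mscale V" by (rule assms)
  interpret W: module "mscale W" by (rule assms)
  let ?M = "cocycle_module W V \<phi>"
  interpret M: module "mscale ?M" by (rule module_cocycle_module[OF assms])
  have h1: "module_hom (mscale V) (mscale ?M) (\<lambda>x. (x, 0))"
    by unfold_locales simp_all
  have h2: "module_hom (mscale W) (mscale ?M) (\<lambda>y. (0, y))"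
    by unfold_locales simp_all
  have "act ?M a (x, y) = map_poly (\<lambda>x'. (x', 0)) (act V a x + \<phi> a y) + map_poly (\<lambda>y'. (0, y')) (act W a y)"
    by (simp add: cocycle_ext_def)
  then show ?thesis
    by (simp add: subst_lam_add[OF M.module_axioms] subst_lam_map_poly[OF h1] subst_lam_map_poly[OF h2]
        subst_lam_add[OF V.module_axioms])
qed

lemma val_zero:
  assumes "sesquilinear scr scw scv F" "module scr" "module scw" "module scv"
  shows "val scv F z 0 x = 0" "val scv F z a 0 = 0"
  using sesquilinearD(1)[OF assms(1), of z 0 0 x] sesquilinearD(2)[OF assms(1), of z a 0 0] by simp_all

text \<open>
  The first component of the Jacobi identity in \<open>V \<oplus> W\<close>, for the action twisted by \<open>\<phi>\<close>.
\<close>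

definition cocycle_identity where
  "cocycle_identity R W V \<phi> z w a b y \<longleftrightarrow>
     lact V z a (val (mscale V) \<phi> w b y) + val (mscale V) \<phi> z a (lact W w b y)
     = val (mscale V) \<phi> (z + w) (lbr R z a b) y + lact V w b (val (mscale V) \<phi> z a y)
       + val (mscale V) \<phi> w b (lact W z a y)"

lemma cocycles_iff:
  assumes R: "module (rscale R)" and V: "conformal_module R V" and W: "conformal_module R W"
  shows "\<phi> \<in> cocycles R W V \<longleftrightarrow> sesquilinear (rscale R) (mscale W) (mscale V) \<phi> \<and>
    (\<forall>z w a b y. cocycle_identity R W V \<phi> z w a b y)"
proof -
  note V' = V[unfolded conformal_module_iff[OF R]] and W' = W[unfolded conformal_module_iff[OF R]]
  have mods: "module (mscale V)" "module (mscale W)" using V' W' by blast+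
  interpret MV: module "mscale V" by (rule mods)
  interpret MW: module "mscale W" by (rule mods)
  have sV: "sesquilinear (rscale R) (mscale V) (mscale V) (act V)"
    and sW: "sesquilinear (rscale R) (mscale W) (mscale W) (act W)" using V' W' by blast+
  note DV = sesquilinearD[OF sV] and DW = sesquilinearD[OF sW]
  have zV: "lact V z a 0 = 0" for z a by (rule val_zero[OF sV R mods(1) mods(1)])
  let ?M = "cocycle_module W V \<phi>"
  note la = lact_cocycle_module[OF mods]
  have sM: "sesquilinear (rscale R) (mscale ?M) (mscale ?M) (act ?M) \<longleftrightarrow> sesquilinear (rscale R) (mscale W) (mscale V) \<phi>"
  proof
    assume S: "sesquilinear (rscale R) (mscale ?M) (mscale ?M) (act ?M)"
    note D = sesquilinearD[OF S]
    show "sesquilinear (rscale R) (mscale W) (mscale V) \<phi>"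
      unfolding sesquilinear_def
    proof (intro conjI allI)
      fix z a b x y p
      show "val (mscale V) \<phi> z (a + b) y = val (mscale V) \<phi> z a y + val (mscale V) \<phi> z b y"
        using D(1)[of z a b "(0, y)"] by (simp add: la zV)
      show "val (mscale V) \<phi> z a (x + y) = val (mscale V) \<phi> z a x + val (mscale V) \<phi> z a y"
        using D(2)[of z a "(0, x)" "(0, y)"] by (simp add: la zV)
      show "val (mscale V) \<phi> z (rscale R p a) y = mscale V [:poly p (- z):] (val (mscale V) \<phi> z a y)"
        using D(3)[of z p a "(0, y)"] by (simp add: la zV)
      show "val (mscale V) \<phi> z a (mscale W p y) = mscale V (pcompose p [:z, 1:]) (val (mscale V) \<phi> z a y)"
        using D(4)[of z a p "(0, y)"] by (simp add: la zV)
    qed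
  next
    assume S: "sesquilinear (rscale R) (mscale W) (mscale V) \<phi>"
    note D = sesquilinearD[OF S]
    show "sesquilinear (rscale R) (mscale ?M) (mscale ?M) (act ?M)"
      unfolding sesquilinear_def split_paired_All
      by (simp add: la D DV DW MV.scale_right_distrib)
  qed
  have "cocycle_identity R W V \<phi> z w a b y \<longleftrightarrow>
     lact ?M z a (lact ?M w b (x, y)) = lact ?M (z + w) (lbr R z a b) (x, y) + lact ?M w b (lact ?M z a (x, y))"
    for z w a b x y
  proof -
    have "lact V z a (lact V w b x) = lact V (z + w) (lbr R z a b) x + lact V w b (lact V z a x)"
      "lact W z a (lact W w b y) = lact W (z + w) (lbr R z a b) y + lact W w b (lact W z a y)"
      using V' W' by blast+
    then show ?thesis unfolding cocycle_identity_def by (simp add: la DV) (simp add: algebra_simps)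
  qed
  then have "(\<forall>z w a b y. cocycle_identity R W V \<phi> z w a b y) \<longleftrightarrow> (\<forall>z w a b x.
     lact ?M z a (lact ?M w b x) = lact ?M (z + w) (lbr R z a b) x + lact ?M w b (lact ?M z a x))"
    unfolding split_paired_All by blast
  then show ?thesis
    unfolding cocycles_def mem_Collect_eq conformal_module_iff[OF R] sM using module_cocycle_module[OF mods] by blast
qed

section \<open>Free modules of rank one and two\<close>

lemma free_basis_singleton:
  assumes "module sc"
  shows "free_basis sc {v} \<longleftrightarrow> (\<forall>x. \<exists>p. x = sc p v) \<and> (\<forall>p. sc p v = 0 \<longrightarrow> p = 0)"
proof -
  interpret module sc by (rule assms)
  have "dependent {v} \<longleftrightarrow> (\<exists>p. p \<noteq> 0 \<and> sc p v = 0)"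
    unfolding dependent_finite[of "{v}", simplified]
    by (auto intro: exI[of _ "\<lambda>_. p" for p])
  moreover have "span {v} = UNIV \<longleftrightarrow> (\<forall>x. \<exists>p. x = sc p v)"
    unfolding span_singleton by auto
  ultimately show ?thesis unfolding free_basis_def by blast
qed

lemma free_basis_pair:
  assumes "module sc" "A \<noteq> B"
  shows "free_basis sc {A, B} \<longleftrightarrow> (\<forall>x. \<exists>p q. x = sc p A + sc q B) \<and>
    (\<forall>p q. sc p A + sc q B = 0 \<longrightarrow> p = 0 \<and> q = 0)"
proof -
  interpret module sc by (rule assms)
  have "dependent {A, B} \<longleftrightarrow> (\<exists>p q. (p \<noteq> 0 \<or> q \<noteq> 0) \<and> sc p A + sc q B = 0)"
  proof
    assume "dependent {A, B}"
    then obtain k where "(\<exists>x\<in>{A, B}. k x \<noteq> 0)" "(\<Sum>x\<in>{A, B}. sc (k x) x) = 0"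
      unfolding dependent_finite[of "{A, B}", simplified] by auto
    then show "\<exists>p q. (p \<noteq> 0 \<or> q \<noteq> 0) \<and> sc p A + sc q B = 0"
      using \<open>A \<noteq> B\<close> by (intro exI[of _ "k A"] exI[of _ "k B"]) auto
  next
    assume "\<exists>p q. (p \<noteq> 0 \<or> q \<noteq> 0) \<and> sc p A + sc q B = 0"
    then obtain p q where "p \<noteq> 0 \<or> q \<noteq> 0" "sc p A + sc q B = 0" by blast
    then show "dependent {A, B}"
      using \<open>A \<noteq> B\<close> unfolding dependent_finite[of "{A, B}", simplified]
      by (intro exI[of _ "\<lambda>x. if x = A then p else q"]) auto
  qed
  moreover have "span {A, B} = UNIV \<longleftrightarrow> (\<forall>x. \<exists>p q. x = sc p A + sc q B)"
  proof -
    have "x \<in> span {A, B} \<longleftrightarrow> (\<exists>p q. x = sc p A + sc q B)" for x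
      unfolding span_insert[of A] span_singleton
      by (simp add: image_iff diff_eq_eq add.commute)
    then show ?thesis by auto
  qed
  ultimately show ?thesis unfolding free_basis_def by blast
qed

locale free_pair = M: module sc for sc :: "complex poly \<Rightarrow> 'm \<Rightarrow> 'm::ab_group_add" +
  fixes A B :: 'm
  assumes neq: "A \<noteq> B" and basis: "free_basis sc {A, B}"
begin

lemma independent: "sc p A + sc q B = 0 \<Longrightarrow> p = 0 \<and> q = 0"
  using basis unfolding free_basis_pair[OF M.module_axioms neq] by blast

definition coord1 where "coord1 x = (SOME p. \<exists>q. x = sc p A + sc q B)"
definition coord2 where "coord2 x = (SOME q. x = sc (coord1 x) A + sc q B)"

lemma expansion: "x = sc (coord1 x) A + sc (coord2 x) B"
proof -
  have "\<exists>p q. x = sc p A + sc q B"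
    using basis unfolding free_basis_pair[OF M.module_axioms neq] by blast
  then have "\<exists>q. x = sc (coord1 x) A + sc q B" unfolding coord1_def by (rule someI_ex)
  then show ?thesis unfolding coord2_def by (rule someI_ex)
qed

lemma unique: "sc p A + sc q B = sc p' A + sc q' B \<longleftrightarrow> p = p' \<and> q = q'"
proof
  assume "sc p A + sc q B = sc p' A + sc q' B"
  then have "sc (p - p') A + sc (q - q') B = 0"
    by (simp add: M.scale_left_diff_distrib algebra_simps)
  from independent[OF this] show "p = p' \<and> q = q'" by simp
qed simp

lemma coords: "coord1 (sc p A + sc q B) = p" "coord2 (sc p A + sc q B) = q"
  using iffD1[OF unique expansion[of "sc p A + sc q B"]] by (blast intro: sym)+

lemma coords_linear:
  "coord1 (x + y) = coord1 x + coord1 y" "coord2 (x + y) = coord2 x + coord2 y"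
  "coord1 (sc s x) = s * coord1 x" "coord2 (sc s x) = s * coord2 x"
proof -
  have "sc (coord1 x + coord1 y) A + sc (coord2 x + coord2 y) B
      = (sc (coord1 x) A + sc (coord2 x) B) + (sc (coord1 y) A + sc (coord2 y) B)"
    by (simp add: M.scale_left_distrib)
  then have "x + y = sc (coord1 x + coord1 y) A + sc (coord2 x + coord2 y) B"
    by (simp only: expansion[symmetric])
  then show "coord1 (x + y) = coord1 x + coord1 y" "coord2 (x + y) = coord2 x + coord2 y"
    using coords by metis+
  have "sc (s * coord1 x) A + sc (s * coord2 x) B = sc s (sc (coord1 x) A + sc (coord2 x) B)"
    by (simp add: M.scale_right_distrib)
  then have "sc s x = sc (s * coord1 x) A + sc (s * coord2 x) B"
    by (simp only: expansion[symmetric])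
  then show "coord1 (sc s x) = s * coord1 x" "coord2 (sc s x) = s * coord2 x"
    using coords by metis+
qed

lemma coords_basis: "coord1 A = 1" "coord2 A = 0" "coord1 B = 0" "coord2 B = 1"
  using coords[of 1 0] coords[of 0 1] by simp_all

end

locale free_single = M: module sc for sc :: "complex poly \<Rightarrow> 'm \<Rightarrow> 'm::ab_group_add" +
  fixes v :: 'm
  assumes basis: "free_basis sc {v}"
begin

lemma independent: "sc p v = 0 \<Longrightarrow> p = 0"
  using basis unfolding free_basis_singleton[OF M.module_axioms] by blast

definition coord where "coord x = (SOME p. x = sc p v)"

lemma expansion: "x = sc (coord x) v"
proof -
  have "\<exists>p. x = sc p v"
    using basis unfolding free_basis_singleton[OF M.module_axioms] by blast
  then show ?thesis unfolding coord_def by (rule someI_ex)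
qed

lemma unique: "sc p v = sc q v \<longleftrightarrow> p = q"
proof
  assume "sc p v = sc q v"
  then have "sc (p - q) v = 0" by (simp add: M.scale_left_diff_distrib)
  from independent[OF this] show "p = q" by simp
qed simp

lemma coord: "coord (sc p v) = p"
  using iffD1[OF unique expansion[of "sc p v"]] by (rule sym)

lemma coord_linear: "coord (x + y) = coord x + coord y" "coord (sc s x) = s * coord x" "coord 0 = 0" "coord v = 1"
proof -
  have "sc (coord x + coord y) v = sc (coord x) v + sc (coord y) v" "sc (s * coord x) v = sc s (sc (coord x) v)"
    by (simp_all add: M.scale_left_distrib)
  then have "x + y = sc (coord x + coord y) v" "sc s x = sc (s * coord x) v"
    by (simp_all only: expansion[symmetric])
  then show "coord (x + y) = coord x + coord y" "coord (sc s x) = s * coord x" using coord by metis+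
  show "coord 0 = 0" "coord v = 1" using coord[of 0] coord[of 1] by simp_all
qed

lemma app_poly_coord: "app_poly sc (map_poly coord P) v = P"
  by (rule poly_eqI) (simp add: app_poly_def coeff_map_poly coord_linear expansion[symmetric])

end

section \<open>The cocycle given by two polynomials\<close>

text \<open>
  The polynomial \<open>p(-\<lambda>)\<close>, constant in \<open>\<partial>\<close>.
\<close>

definition reflect :: "complex poly \<Rightarrow> complex poly poly" where
  "reflect p = map_poly (\<lambda>c. [:c:]) (pcompose p [:0, -1:])"

lemma poly_reflect: "poly (reflect p) [:z:] = [:poly p (- z):]"
proof -
  have "poly (map_poly (\<lambda>c. [:c:]) q) [:z:] = [:poly q z:]" for q :: "complex poly"
    by (induction q) (simp_all add: map_poly_pCons mult.commute)
  then show ?thesis by (simp add: reflect_def poly_pcompose)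
qed

lemma poly_translate: "poly (translate p) [:z:] = pcompose p [:z, 1:]"
  by (rule poly_ext) (use ev_translate[of p _ z] in \<open>simp add: ev_def poly_pcompose add.commute\<close>)

locale virasoro_pair =
  fixes R :: "'r::ab_group_add lca" and A B :: 'r
  assumes virasoro: "virasoro_sum R A B"
begin

lemma R_module: "module (rscale R)" and R_sesq: "sesquilinear (rscale R) (rscale R) (rscale R) (bracket R)"
  using virasoro lie_conformal_algebra_sesquilinear unfolding virasoro_sum_def by blast+

sublocale R: free_pair "rscale R" A B
  using R_module virasoro by (simp add: free_pair_def free_pair_axioms_def virasoro_sum_def)

lemma bracket_generators:
  "lbr R z A A = rscale R [:2 * z, 1:] A" "lbr R z B B = rscale R [:2 * z, 1:] B"
  "lbr R z A B = 0" "lbr R z B A = 0"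
proof -
  have p: "poly (del + 2 * lam) [:z:] = [:2 * z, 1:]"
    by (rule poly_ext) simp
  have v: "bracket R A A = app_poly (rscale R) (del + 2 * lam) A" "bracket R A B = 0"
     "bracket R B B = app_poly (rscale R) (del + 2 * lam) B" using virasoro unfolding virasoro_sum_def by blast+
  then show "lbr R z A A = rscale R [:2 * z, 1:] A" "lbr R z B B = rscale R [:2 * z, 1:] B" "lbr R z A B = 0"
    by (simp_all only: subst_lam_app_poly[OF R_module] p subst_lam_0[OF R_module])
  have "lbr R z B A = - subst_lam (rscale R) [:-z, -1:] (bracket R A B)"
    using virasoro unfolding virasoro_sum_def lie_conformal_algebra_def Let_def by blast
  then show "lbr R z B A = 0" by (simp add: v subst_lam_0[OF R_module])
qed

text \<open>
  Both sides of the condition are sesquilinear, so it suffices to check it on generators of the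
  algebra and of the module.
\<close>

lemma conformal_hom_on_generators:
  assumes M: "conformal_module R M" and N: "conformal_module R N"
    and h: "module_hom (mscale M) (mscale N) h"
    and gen: "\<And>x. \<exists>r s. x = mscale M r m + mscale M s n"
    and A: "\<And>z. lact N z A (h m) = h (lact M z A m)" "\<And>z. lact N z A (h n) = h (lact M z A n)"
    and B: "\<And>z. lact N z B (h m) = h (lact M z B m)" "\<And>z. lact N z B (h n) = h (lact M z B n)"
  shows "conformal_hom M N h"
proof -
  note M' = M[unfolded conformal_module_iff[OF R_module]] and N' = N[unfolded conformal_module_iff[OF R_module]]
  note DM = sesquilinearD[OF conjunct1[OF conjunct2[OF M']]] and DN = sesquilinearD[OF conjunct1[OF conjunct2[OF N']]]
  interpret h: module_hom "mscale M" "mscale N" h by (rule h)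
  have "lact N z a (h x) = h (lact M z a x)" for z a x
  proof -
    obtain r s where x: "x = mscale M r m + mscale M s n" using gen by blast
    show ?thesis
      by (subst (1 2) R.expansion[of a]) (simp add: x h.add h.scale DM DN A B)
  qed
  then show ?thesis using h conformal_hom_iff[of N M h] N' by blast
qed

end

text \<open>
  The Jacobi identities for \<open>(A, A)\<close>, \<open>(A, B)\<close> and \<open>(B, B)\<close> on the lift \<open>u\<close>, where
  \<open>A\<^sub>\<lambda>v = a v\<close>, \<open>B\<^sub>\<lambda>v = b v\<close>, \<open>A\<^sub>\<lambda>u = a' u + f v\<close> and \<open>B\<^sub>\<lambda>u = b' u + g v\<close>.  The one for \<open>(B, A)\<close> is that for
  \<open>(A, B)\<close> with \<open>\<lambda>\<close> and \<open>\<mu>\<close> exchanged.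
\<close>

definition pair_cocycle_for :: "complex poly poly \<Rightarrow> complex poly poly \<Rightarrow> complex poly poly \<Rightarrow> complex poly poly
    \<Rightarrow> complex poly poly \<Rightarrow> complex poly poly \<Rightarrow> bool" where
  "pair_cocycle_for a b a' b' f g \<longleftrightarrow> (\<forall>x l m.
     ev f (x + l) m * ev a x l + ev f x l * ev a' (x + l) m
       = (l - m) * ev f x (l + m) + ev f (x + m) l * ev a x m + ev f x m * ev a' (x + m) l \<and>
     ev g (x + l) m * ev a x l + ev f x l * ev b' (x + l) m
       = ev f (x + m) l * ev b x m + ev g x m * ev a' (x + m) l \<and>
     ev g (x + l) m * ev b x l + ev g x l * ev b' (x + l) m
       = (l - m) * ev g x (l + m) + ev g (x + m) l * ev b x m + ev g x m * ev b' (x + m) l)"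

locale ext_setting = virasoro_pair R A B
  for R :: "'r::ab_group_add lca" and A B :: 'r +
  fixes V :: "('r, 'v::ab_group_add) cmod" and v :: 'v and W :: "('r, 'w::ab_group_add) cmod" and w :: 'w
    and a b a' b' :: "complex poly poly"
  assumes V: "conformal_module R V" "free_basis (mscale V) {v}"
    "act V A v = app_poly (mscale V) a v" "act V B v = app_poly (mscale V) b v"
    and W: "conformal_module R W" "free_basis (mscale W) {w}"
    "act W A w = app_poly (mscale W) a' w" "act W B w = app_poly (mscale W) b' w"
begin

lemma V_module: "module (mscale V)" and W_module: "module (mscale W)"
  and V_sesq: "sesquilinear (rscale R) (mscale V) (mscale V) (act V)"
  and W_sesq: "sesquilinear (rscale R) (mscale W) (mscale W) (act W)"
  using V(1) W(1) unfolding conformal_module_iff[OF R_module] by blast+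

sublocale V: free_single "mscale V" v
  using V_module V(2) by (simp add: free_single_def free_single_axioms_def)
sublocale W: free_single "mscale W" w
  using W_module W(2) by (simp add: free_single_def free_single_axioms_def)

lemma lact_generators:
  "lact V z A v = mscale V (poly a [:z:]) v" "lact V z B v = mscale V (poly b [:z:]) v"
  "lact W z A w = mscale W (poly a' [:z:]) w" "lact W z B w = mscale W (poly b' [:z:]) w"
  by (simp_all add: V W subst_lam_app_poly V_module W_module)

abbreviation "pair_cocycle \<equiv> pair_cocycle_for a b a' b'"

text \<open>
  The sesquilinear map with the values \<open>f v\<close> at \<open>(A, w)\<close> and \<open>g v\<close> at \<open>(B, w)\<close>.
\<close>

definition cocycle_map :: "complex poly poly \<Rightarrow> complex poly poly \<Rightarrow> 'r \<Rightarrow> 'w \<Rightarrow> 'v poly" where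
  "cocycle_map f g c y =
     app_poly (mscale V) ((reflect (R.coord1 c) * f + reflect (R.coord2 c) * g) * translate (W.coord y)) v"

lemma val_cocycle_map: "val (mscale V) (cocycle_map f g) z c y =
    mscale V (([:poly (R.coord1 c) (- z):] * poly f [:z:] + [:poly (R.coord2 c) (- z):] * poly g [:z:])
      * pcompose (W.coord y) [:z, 1:]) v"
  by (simp add: cocycle_map_def subst_lam_app_poly[OF V_module] poly_reflect poly_translate)

lemma sesquilinear_cocycle_map: "sesquilinear (rscale R) (mscale W) (mscale V) (cocycle_map f g)"
  unfolding sesquilinear_def val_cocycle_map
proof (intro conjI allI)
  fix z c d x y p
  let ?L = "\<lambda>c z. [:poly (R.coord1 c) (- z):] * poly f [:z:] + [:poly (R.coord2 c) (- z):] * poly g [:z:]"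
  have L: "?L (c + d) z = ?L c z + ?L d z" "?L (rscale R p c) z = [:poly p (- z):] * ?L c z"
    by (simp_all add: R.coords_linear algebra_simps smult_add_left smult_add_right)
  show "mscale V (?L (c + d) z * pcompose (W.coord y) [:z, 1:]) v
     = mscale V (?L c z * pcompose (W.coord y) [:z, 1:]) v + mscale V (?L d z * pcompose (W.coord y) [:z, 1:]) v"
    unfolding L V.M.scale_left_distrib[symmetric] by (simp only: distrib_right)
  show "mscale V (?L c z * pcompose (W.coord (x + y)) [:z, 1:]) v
     = mscale V (?L c z * pcompose (W.coord x) [:z, 1:]) v + mscale V (?L c z * pcompose (W.coord y) [:z, 1:]) v"
    unfolding W.coord_linear pcompose_add V.M.scale_left_distrib[symmetric] by (simp only: distrib_left)
  show "mscale V (?L (rscale R p c) z * pcompose (W.coord y) [:z, 1:]) v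
     = mscale V [:poly p (- z):] (mscale V (?L c z * pcompose (W.coord y) [:z, 1:]) v)"
    unfolding L V.M.scale_scale by (simp only: mult.assoc)
  show "mscale V (?L c z * pcompose (W.coord (mscale W p y)) [:z, 1:]) v
     = mscale V (pcompose p [:z, 1:]) (mscale V (?L c z * pcompose (W.coord y) [:z, 1:]) v)"
    unfolding W.coord_linear pcompose_mult V.M.scale_scale by (simp only: mult.assoc mult.left_commute)
qed

end

section \<open>Reduction of the cocycle identity to generators\<close>

context ext_setting
begin

lemma val_cocycle_map_generators:
  "val (mscale V) (cocycle_map f g) z A w = mscale V (poly f [:z:]) v"
  "val (mscale V) (cocycle_map f g) z B w = mscale V (poly g [:z:]) v"
  by (simp_all add: val_cocycle_map R.coords_basis W.coord_linear pcompose_1 flip: one_pCons)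

text \<open>
  Both sides are additive in all three arguments.  Scaling an argument by a polynomial multiplies both
  sides by the same polynomial: \<open>p(-z)\<close>, \<open>p(-m)\<close> and \<open>p(\<partial> + z + m)\<close>, respectively.
\<close>

lemma cocycle_identity_from_generators:
  assumes S: "sesquilinear (rscale R) (mscale W) (mscale V) \<phi>"
    and gen: "\<And>z m c d. c \<in> {A, B} \<Longrightarrow> d \<in> {A, B} \<Longrightarrow> cocycle_identity R W V \<phi> z m c d w"
  shows "cocycle_identity R W V \<phi> z m c d y"
proof -
  note DV = sesquilinearD[OF V_sesq] and DW = sesquilinearD[OF W_sesq] and DR = sesquilinearD[OF R_sesq]
    and D = sesquilinearD[OF S]
  note [simp] = V.M.scale_right_distrib
  let ?C = "cocycle_identity R W V \<phi> z m"
  have add1: "?C (c + c') d y" if "?C c d y" "?C c' d y" for c c' d y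
    using arg_cong2[OF that[unfolded cocycle_identity_def], of "(+)"]
    unfolding cocycle_identity_def by (simp add: DV DW DR D add_ac)
  have add2: "?C c (d + d') y" if "?C c d y" "?C c d' y" for c d d' y
    using arg_cong2[OF that[unfolded cocycle_identity_def], of "(+)"]
    unfolding cocycle_identity_def by (simp add: DV DW DR D add_ac)
  have scale1: "?C (rscale R p c) d y" if "?C c d y" for p c d y
    using arg_cong[OF that[unfolded cocycle_identity_def], of "mscale V [:poly p (- z):]"]
    unfolding cocycle_identity_def by (simp add: DV DW DR D)
  have scale2: "?C c (rscale R p d) y" if "?C c d y" for p c d y
    using arg_cong[OF that[unfolded cocycle_identity_def], of "mscale V [:poly p (- m):]"]
    unfolding cocycle_identity_def by (simp add: DV DW DR D poly_pcompose)
  have scale3: "?C c d (mscale W p y)" if "?C c d y" for p c d y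
  proof -
    have "pcompose (pcompose p [:m, 1:]) [:z, 1:] = pcompose p [:z + m, 1:]"
      "pcompose (pcompose p [:z, 1:]) [:m, 1:] = pcompose p [:z + m, 1:]"
      by (simp_all add: pcompose_assoc[symmetric] pcompose_pCons add.commute)
    then show ?thesis
      using arg_cong[OF that[unfolded cocycle_identity_def], of "mscale V (pcompose p [:z + m, 1:])"]
      unfolding cocycle_identity_def by (simp add: DV DW DR D)
  qed
  have "?C c d w" if "d \<in> {A, B}" for c d
    by (subst R.expansion[of c]) (intro add1 scale1 gen that; simp)
  then have "?C c d w" for c d
    by (subst R.expansion[of d]) (intro add2 scale2; simp)
  then show ?thesis by (subst W.expansion[of y]) (rule scale3)
qed

lemma cocycle_map_in_cocycles:
  assumes "pair_cocycle f g"
  shows "cocycle_map f g \<in> cocycles R W V"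
proof -
  let ?\<phi> = "cocycle_map f g"
  note S = sesquilinear_cocycle_map[of f g]
  note DV = sesquilinearD[OF V_sesq] and DW = sesquilinearD[OF W_sesq] and DR = sesquilinearD[OF R_sesq]
    and D = sesquilinearD[OF S]
  note pc = assms[unfolded pair_cocycle_for_def, rule_format]
  have eqI: "mscale V p v + mscale V q v = mscale V p1 v + mscale V p2 v + mscale V p3 v"
    if "\<And>x. poly p x + poly q x = poly p1 x + poly p2 x + poly p3 x" for p q p1 p2 p3
  proof -
    have "p + q = p1 + p2 + p3" by (rule poly_ext) (simp add: that)
    then show ?thesis by (simp only: V.M.scale_left_distrib[symmetric])
  qed
  have z: "val (mscale V) ?\<phi> z 0 y = mscale V 0 v" for z y
    using val_zero(1)[OF S R_module W_module V_module] by simp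
  note expand = cocycle_identity_def val_cocycle_map_generators lact_generators bracket_generators DV(3,4) DW(3,4) D(3,4) z
    V.M.scale_scale
  have "cocycle_identity R W V ?\<phi> z m c d w" if "c \<in> {A, B}" "d \<in> {A, B}" for z m c d
  proof -
    have AA: "cocycle_identity R W V ?\<phi> z m A A w"
      unfolding expand
    proof (rule eqI, goal_cases)
      case (1 x)
      then show ?case using pc[of x z m] by (simp add: ev_def poly_pcompose algebra_simps)
    qed
    have BB: "cocycle_identity R W V ?\<phi> z m B B w"
      unfolding expand
    proof (rule eqI, goal_cases)
      case (1 x)
      then show ?case using pc[of x z m] by (simp add: ev_def poly_pcompose algebra_simps)
    qed
    have AB: "cocycle_identity R W V ?\<phi> z m A B w"
      unfolding expand
    proof (rule eqI, goal_cases)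
      case (1 x)
      then show ?case using pc[of x z m] by (simp add: ev_def poly_pcompose algebra_simps)
    qed
    have BA: "cocycle_identity R W V ?\<phi> z m B A w"
      unfolding expand
    proof (rule eqI, goal_cases)
      case (1 x)
      then show ?case using pc[of x m z] by (simp add: ev_def poly_pcompose algebra_simps)
    qed
    show ?thesis using that AA AB BA BB by auto
  qed
  then have "cocycle_identity R W V ?\<phi> z m c d y" for z m c d y
    by (rule cocycle_identity_from_generators[OF S])
  then show ?thesis using S cocycles_iff[OF R_module V(1) W(1)] by blast
qed

section \<open>Extensions and lifts of the generator of the quotient\<close>

text \<open>
  A witness \<open>u\<close> for \<^term>\<open>given_by\<close>, with arbitrary polynomials in place of the actions on \<open>v\<close> and \<open>w\<close>.
\<close>

definition is_lift where
  "is_lift E u f g \<longleftrightarrow> eproj E u = w \<and>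
      (let sc = mscale (emod E); ac = act (emod E); v' = einj E v in
        v' \<noteq> u \<and> free_basis sc {v', u} \<and>
        ac A v' = app_poly sc a v' \<and> ac B v' = app_poly sc b v' \<and>
        ac A u = app_poly sc a' u + app_poly sc f v' \<and>
        ac B u = app_poly sc b' u + app_poly sc g v')"

lemma map_poly_app_poly: "module_hom sc sc' h \<Longrightarrow> map_poly h (app_poly sc f x) = app_poly sc' f (h x)"
proof -
  assume "module_hom sc sc' h"
  then interpret module_hom sc sc' h .
  show ?thesis by (rule poly_eqI) (simp add: app_poly_def coeff_map_poly zero scale)
qed

text \<open>
  Any preimage \<open>u\<close> of \<open>w\<close> will do.  The difference of \<open>A\<^sub>\<lambda>u\<close> and \<open>a' u\<close> has its coefficients in the
  kernel of the projection, which is \<open>\<complex>[\<partial>]v\<close>; this gives \<open>f\<close>, and \<open>g\<close> is found in the same way.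
\<close>

lemma extension_has_lift:
  fixes E :: "('r, 'v, 'w, 'e::ab_group_add) extension"
  assumes E: "is_extension R W V E"
  shows "\<exists>u f g. is_lift E u f g"
proof -
  let ?sc = "mscale (emod E)" and ?v = "einj E v"
  have cE: "conformal_module R (emod E)" and inj: "inj (einj E)" and range: "range (einj E) = {x. eproj E x = 0}"
    and hi: "conformal_hom V (emod E) (einj E)" and hp: "conformal_hom (emod E) W (eproj E)" and "surj (eproj E)"
    using E unfolding is_extension_def by blast+
  have mE: "module ?sc" using cE unfolding conformal_module_def by blast
  interpret M: module ?sc by (rule mE)
  interpret i: module_hom "mscale V" ?sc "einj E" using hi unfolding conformal_hom_def by blast
  interpret p: module_hom ?sc "mscale W" "eproj E" using hp unfolding conformal_hom_def by blast
  have i_act: "act (emod E) c (einj E x) = map_poly (einj E) (act V c x)" for c x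
    using hi unfolding conformal_hom_def by blast
  have p_act: "act W c (eproj E x) = map_poly (eproj E) (act (emod E) c x)" for c x
    using hp unfolding conformal_hom_def by blast
  obtain u where u: "eproj E u = w" using \<open>surj (eproj E)\<close> by (metis surjD)
  have pi: "eproj E (einj E x) = 0" for x using rangeI[of "einj E" x] unfolding range by simp
  have w_ne: "w \<noteq> 0" using W.independent[of 1] by auto
  have ne: "?v \<noteq> u" using pi[of v] u w_ne by auto
  have kernel: "\<exists>r. x = ?sc r ?v" if "eproj E x = 0" for x
  proof -
    have "x \<in> range (einj E)" unfolding range using that by simp
    then obtain x' where "x = einj E x'" by (rule rangeE)
    then have "x = ?sc (V.coord x') ?v" by (metis V.expansion i.scale)
    then show ?thesis by blast
  qed
  have v_indep: "r = 0" if "?sc r ?v = 0" for r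
  proof -
    have "einj E (mscale V r v) = einj E 0" using that by (simp add: i.scale i.zero)
    then show ?thesis using V.independent injD[OF inj] by blast
  qed
  have "\<exists>r s. x = ?sc r ?v + ?sc s u" for x
  proof -
    have "eproj E (x - ?sc (W.coord (eproj E x)) u) = 0"
      using W.expansion[of "eproj E x"] by (simp add: p.diff p.scale u)
    from kernel[OF this] obtain r where "x - ?sc (W.coord (eproj E x)) u = ?sc r ?v" by blast
    then show ?thesis by (metis diff_add_cancel)
  qed
  moreover have "r = 0 \<and> s = 0" if eq: "?sc r ?v + ?sc s u = 0" for r s
  proof -
    have "mscale W s w = 0" using arg_cong[OF eq, of "eproj E"] by (simp add: p.add p.scale pi u p.zero)
    then have "s = 0" by (rule W.independent)
    then show ?thesis using eq v_indep by simp
  qed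
  ultimately have basis: "free_basis ?sc {?v, u}" unfolding free_basis_pair[OF mE ne] by blast
  have act_v: "act (emod E) A ?v = app_poly ?sc a ?v" "act (emod E) B ?v = app_poly ?sc b ?v"
    unfolding i_act V(3,4) by (rule map_poly_app_poly, rule i.module_hom_axioms)+
  have complement: "\<exists>h. act (emod E) c u = app_poly ?sc k u + app_poly ?sc h ?v"
    if c: "act W c w = app_poly (mscale W) k w" for c k
  proof -
    let ?d = "act (emod E) c u - app_poly ?sc k u"
    have "coeff ?d i \<in> range (einj E)" for i
    proof -
      have "map_poly (eproj E) (act (emod E) c u) = map_poly (eproj E) (app_poly ?sc k u)"
        unfolding p_act[symmetric] map_poly_app_poly[OF p.module_hom_axioms] u c ..
      then have "eproj E (coeff (act (emod E) c u) i) = eproj E (coeff (app_poly ?sc k u) i)"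
        by (metis coeff_map_poly p.zero)
      then show ?thesis unfolding range by (simp add: p.diff)
    qed
    then have ex: "\<exists>r. coeff ?d i = ?sc r ?v" for i unfolding range mem_Collect_eq by (rule kernel)
    \<comment> \<open>The value at \<open>0\<close> is fixed because \<^const>\<open>map_poly\<close> commutes with coefficients only for maps that preserve \<open>0\<close>.\<close>
    define co where "co x = (if x = 0 then 0 else SOME r. x = ?sc r ?v)" for x
    have co: "?sc (co (coeff ?d i)) ?v = coeff ?d i" for i
      using someI_ex[OF ex[of i]] by (auto simp: co_def)
    have "app_poly ?sc (map_poly co ?d) ?v = ?d"
      by (rule poly_eqI) (use co in \<open>simp add: app_poly_def coeff_map_poly co_def\<close>)
    then have "act (emod E) c u = app_poly ?sc k u + app_poly ?sc (map_poly co ?d) ?v" by simp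
    then show ?thesis by blast
  qed
  show ?thesis
    unfolding is_lift_def Let_def using u ne basis act_v complement[OF W(3)] complement[OF W(4)] by blast
qed

end

section \<open>Equivalence of extensions\<close>

text \<open>
  The change of the \<open>v\<close>-component of \<open>A\<^sub>\<lambda>u\<close> when \<open>u\<close> is replaced by \<open>u + \<psi> v\<close>.
\<close>

definition action_coboundary where
  "action_coboundary a a' \<psi> = a * translate \<psi> - a' * [:\<psi>:]"

lemma poly_coboundary:
  "poly (action_coboundary a a' \<psi>) [:z:] = poly a [:z:] * pcompose \<psi> [:z, 1:] - poly a' [:z:] * \<psi>"
  by (simp add: action_coboundary_def poly_translate)

lemma ev_action_coboundary [simp]:
  "ev (action_coboundary a a' \<psi>) x l = ev a x l * poly \<psi> (x + l) - ev a' x l * poly \<psi> x"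
  by (simp add: action_coboundary_def)

locale lifted_extension = ext_setting R A B V v W w a b a' b'
  for R :: "'r::ab_group_add lca" and A B and V :: "('r, 'v::ab_group_add) cmod" and v
    and W :: "('r, 'w::ab_group_add) cmod" and w and a b a' b' +
  fixes E :: "('r, 'v, 'w, 'e::ab_group_add) extension" and u f g
  assumes extension: "is_extension R W V E" and lift: "is_lift E u f g"
begin

abbreviation "sc \<equiv> mscale (emod E)"
abbreviation "v' \<equiv> einj E v"

lemma E_module: "module sc" and E_sesq: "sesquilinear (rscale R) sc sc (act (emod E))"
  and E_jacobi: "lact (emod E) z c (lact (emod E) m d x)
    = lact (emod E) (z + m) (lbr R z c d) x + lact (emod E) m d (lact (emod E) z c x)"
  using extension unfolding is_extension_def conformal_module_iff[OF R_module] by blast+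

sublocale E: free_pair sc v' u
  using E_module lift by (simp add: free_pair_def free_pair_axioms_def is_lift_def Let_def)

lemma lact_E:
  "lact (emod E) z A v' = sc (poly a [:z:]) v'" "lact (emod E) z B v' = sc (poly b [:z:]) v'"
  "lact (emod E) z A u = sc (poly f [:z:]) v' + sc (poly a' [:z:]) u"
  "lact (emod E) z B u = sc (poly g [:z:]) v' + sc (poly b' [:z:]) u"
  using lift unfolding is_lift_def Let_def
  by (simp_all add: subst_lam_app_poly[OF E_module] subst_lam_add[OF E_module] add.commute)

text \<open>
  The \<open>v\<close>-components of the Jacobi identities on \<open>u\<close>.
\<close>

lemma lift_pair_cocycle: "pair_cocycle f g"
proof -
  note D = sesquilinearD[OF E_sesq]
  have zero: "lact (emod E) z 0 x = 0" for z x
    by (rule val_zero[OF E_sesq R_module E_module E_module])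
  have regroup: "(sc p v' + sc q u) + (sc p' v' + sc q' u) = sc (p + p') v' + sc (q + q') u" for p q p' q'
    by (simp add: E.M.scale_left_distrib)
  have collect: "sc r v' + (sc p v' + sc q u) = sc (r + p) v' + sc q u" for p q r
    by (simp add: E.M.scale_left_distrib)
  note expand = lact_E D(2,3,4) bracket_generators zero E.M.scale_scale E.M.scale_right_distrib add_0_left regroup collect E.unique
  note polys = ev_def poly_pcompose algebra_simps
  show ?thesis
    unfolding pair_cocycle_for_def
  proof (intro allI conjI)
    fix x l m
    from arg_cong[OF E_jacobi[of l A m A u, unfolded expand, THEN conjunct1], of "\<lambda>p. poly p x"]
    show "ev f (x + l) m * ev a x l + ev f x l * ev a' (x + l) m
       = (l - m) * ev f x (l + m) + ev f (x + m) l * ev a x m + ev f x m * ev a' (x + m) l"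
      by (simp add: polys)
    from arg_cong[OF E_jacobi[of l B m B u, unfolded expand, THEN conjunct1], of "\<lambda>p. poly p x"]
    show "ev g (x + l) m * ev b x l + ev g x l * ev b' (x + l) m
       = (l - m) * ev g x (l + m) + ev g (x + m) l * ev b x m + ev g x m * ev b' (x + m) l"
      by (simp add: polys)
    from arg_cong[OF E_jacobi[of l A m B u, unfolded expand, THEN conjunct1], of "\<lambda>p. poly p x"]
    show "ev g (x + l) m * ev a x l + ev f x l * ev b' (x + l) m
       = ev f (x + m) l * ev b x m + ev g x m * ev a' (x + m) l"
      by (simp add: polys)
  qed
qed

end

context ext_setting
begin

abbreviation "coboundary_A \<equiv> action_coboundary a a'"
abbreviation "coboundary_B \<equiv> action_coboundary b b'"

lemma cocycle_ext_is_extension: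
  assumes \<phi>: "\<phi> \<in> cocycles R W V"
  shows "is_extension R W V (cocycle_ext W V \<phi>)"
proof -
  let ?E = "cocycle_ext W V \<phi>"
  have M: "conformal_module R (emod ?E)" using \<phi> unfolding cocycles_def by simp
  have S: "sesquilinear (rscale R) (mscale W) (mscale V) \<phi>"
    using \<phi> cocycles_iff[OF R_module V(1) W(1)] by blast
  have mE: "module (mscale (emod ?E))" by (rule module_cocycle_module[OF V_module W_module])
  interpret E: module "mscale (emod ?E)" by (rule mE)
  note la = lact_cocycle_module[OF V_module W_module]
  have inj: "einj ?E = (\<lambda>x. (x, 0))" and proj: "eproj ?E = snd" by (simp_all add: cocycle_ext_def)
  have "module_hom (mscale V) (mscale (emod ?E)) (einj ?E)"
    unfolding inj by unfold_locales simp_all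
  moreover have "module_hom (mscale (emod ?E)) (mscale W) (eproj ?E)"
    unfolding proj by unfold_locales auto
  ultimately have "conformal_hom V (emod ?E) (einj ?E)" "conformal_hom (emod ?E) W (eproj ?E)"
    unfolding conformal_hom_iff[OF mE] conformal_hom_iff[OF W_module] inj proj split_paired_All
    by (simp_all add: la val_zero[OF S R_module W_module V_module] val_zero[OF W_sesq R_module W_module W_module])
  then show ?thesis
    unfolding is_extension_def using M by (auto simp: inj proj inj_def)
qed

lemma cocycle_map_lift: "is_lift (cocycle_ext W V (cocycle_map f g)) (0, w) f g"
proof -
  let ?E = "cocycle_ext W V (cocycle_map f g)"
  let ?sc = "mscale (emod ?E)"
  note la = lact_cocycle_module[OF V_module W_module]
  have mE: "module ?sc" by (rule module_cocycle_module[OF V_module W_module])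
  have inj: "einj ?E = (\<lambda>x. (x, 0))" and proj: "eproj ?E = snd" by (simp_all add: cocycle_ext_def)
  have v0: "v \<noteq> 0" using V.independent[of 1] by auto
  have z: "lact W z c 0 = 0" "val (mscale V) (cocycle_map f g) z c 0 = 0" "lact V z c 0 = 0" for z c
    by (rule val_zero[OF W_sesq R_module W_module W_module] val_zero[OF V_sesq R_module V_module V_module]
        val_zero[OF sesquilinear_cocycle_map R_module W_module V_module])+
  have "\<exists>p q. x = ?sc p (v, 0) + ?sc q (0, w)" for x
    by (cases x) (use V.expansion W.expansion in auto)
  moreover have "p = 0 \<and> q = 0" if "?sc p (v, 0) + ?sc q (0, w) = 0" for p q
    using that V.independent W.independent by (simp add: zero_prod_def)
  ultimately have "free_basis ?sc {(v, 0), (0, w)}"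
    using v0 by (subst free_basis_pair[OF mE]) auto
  moreover have "act (emod ?E) A (v, 0) = app_poly ?sc a (v, 0)" "act (emod ?E) B (v, 0) = app_poly ?sc b (v, 0)"
    "act (emod ?E) A (0, w) = app_poly ?sc a' (0, w) + app_poly ?sc f (v, 0)"
    "act (emod ?E) B (0, w) = app_poly ?sc b' (0, w) + app_poly ?sc g (v, 0)"
    by (rule subst_lam_eqI[OF mE], simp add: la lact_generators z val_cocycle_map_generators
        subst_lam_app_poly[OF mE] subst_lam_add[OF mE])+
  ultimately show ?thesis
    unfolding is_lift_def Let_def inj proj using v0 by simp
qed

end

context lifted_extension
begin

text \<open>
  The equivalence maps \<open>v\<close> to \<open>(v, 0)\<close> and \<open>u\<close> to \<open>(\<psi> v, w)\<close>.  It commutes with the action of \<open>A\<close> on \<open>u\<close> if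
  and only if \<open>f + a' \<psi> = f0 + a \<psi>(\<partial> + \<lambda>)\<close>, and likewise for \<open>B\<close>.
\<close>

lemma equivalent_cocycle_ext:
  assumes pc: "pair_cocycle f0 g0"
    and f: "f = f0 + coboundary_A \<psi>" and g: "g = g0 + coboundary_B \<psi>"
  shows "equivalent_ext E (cocycle_ext W V (cocycle_map f0 g0))"
proof -
  let ?F = "cocycle_ext W V (cocycle_map f0 g0)"
  define h where "h x = (mscale V (E.coord1 x + E.coord2 x * \<psi>) v, mscale W (E.coord2 x) w)" for x
  note la = lact_cocycle_module[OF V_module W_module]
  have \<phi>: "cocycle_map f0 g0 \<in> cocycles R W V" by (rule cocycle_map_in_cocycles[OF pc])
  have F: "conformal_module R (emod ?F)" using \<phi> unfolding cocycles_def by simp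
  have cE: "conformal_module R (emod E)" using extension unfolding is_extension_def by blast
  have mF: "module (mscale (emod ?F))" by (rule module_cocycle_module[OF V_module W_module])
  interpret F: module "mscale (emod ?F)" by (rule mF)
  interpret i: module_hom "mscale V" sc "einj E"
    using extension unfolding is_extension_def conformal_hom_def by blast
  interpret p: module_hom sc "mscale W" "eproj E"
    using extension unfolding is_extension_def conformal_hom_def by blast
  have hom: "module_hom sc (mscale (emod ?F)) h"
    by unfold_locales (simp_all add: h_def E.coords_linear V.M.scale_left_distrib W.M.scale_left_distrib algebra_simps)
  then interpret h: module_hom sc "mscale (emod ?F)" h .
  have hv: "h v' = (v, 0)" and hu: "h u = (mscale V \<psi> v, w)"
    by (simp_all add: h_def E.coords_basis)
  have z: "lact W z c 0 = 0" "val (mscale V) (cocycle_map f0 g0) z c 0 = 0" for z c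
    by (rule val_zero[OF W_sesq R_module W_module W_module]
        val_zero[OF sesquilinear_cocycle_map R_module W_module V_module])+
  have "conformal_hom (emod E) (emod ?F) h"
  proof (rule conformal_hom_on_generators[OF cE F hom])
    show "\<exists>r s. x = sc r v' + sc s u" for x using E.expansion by blast
    show "lact (emod ?F) z A (h v') = h (lact (emod E) z A v')"
      "lact (emod ?F) z B (h v') = h (lact (emod E) z B v')" for z
      by (simp_all add: hv la z lact_E h.scale lact_generators)
    show "lact (emod ?F) z A (h u) = h (lact (emod E) z A u)" for z
      unfolding lact_E h.add h.scale hu hv la mscale_cocycle_module lact_generators val_cocycle_map_generators
        sesquilinearD[OF V_sesq] f
      by (simp add: poly_coboundary algebra_simps V.M.scale_left_distrib[symmetric] del: V.M.scale_left_distrib)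
    show "lact (emod ?F) z B (h u) = h (lact (emod E) z B u)" for z
      unfolding lact_E h.add h.scale hu hv la mscale_cocycle_module lact_generators val_cocycle_map_generators
        sesquilinearD[OF V_sesq] g
      by (simp add: poly_coboundary algebra_simps V.M.scale_left_distrib[symmetric] del: V.M.scale_left_distrib)
  qed
  moreover have "h (einj E x) = einj ?F x" for x
  proof -
    have "h (einj E x) = h (sc (V.coord x) v')" by (metis V.expansion i.scale)
    also have "\<dots> = (mscale V (V.coord x) v, 0)" by (simp add: h.scale hv)
    finally show ?thesis by (simp add: V.expansion[symmetric] cocycle_ext_def)
  qed
  moreover have "eproj ?F (h x) = eproj E x" for x
  proof -
    have "eproj E v' = 0" using extension unfolding is_extension_def by blast
    moreover have "eproj E u = w" using lift unfolding is_lift_def by blast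
    ultimately have "eproj E (sc (E.coord1 x) v' + sc (E.coord2 x) u) = mscale W (E.coord2 x) w"
      by (simp add: p.add p.scale)
    then show ?thesis by (simp add: E.expansion[symmetric] h_def cocycle_ext_def)
  qed
  ultimately show ?thesis unfolding equivalent_ext_def by blast
qed

text \<open>
  A splitting sends \<open>u\<close> to some \<open>(\<psi> v, w)\<close>, and then the condition that it commutes with \<open>A\<close> and \<open>B\<close> on \<open>u\<close>
  says that the pair is the coboundary of \<open>\<psi>\<close>.
\<close>

lemma trivial_ext_imp_coboundary:
  assumes "trivial_ext W V E"
  obtains \<psi> where "f = coboundary_A \<psi>" "g = coboundary_B \<psi>"
proof -
  let ?F = "direct_sum_ext W V"
  obtain h where hom: "conformal_hom (emod E) (emod ?F) h" and hi: "\<And>x. h (einj E x) = einj ?F x"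
    and hp: "\<And>x. eproj ?F (h x) = eproj E x"
    using assms unfolding trivial_ext_def equivalent_ext_def by blast
  note la = lact_cocycle_module[OF V_module W_module]
  have mF: "module (mscale (emod ?F))" by (rule module_cocycle_module[OF V_module W_module])
  interpret F: module "mscale (emod ?F)" by (rule mF)
  interpret h: module_hom sc "mscale (emod ?F)" h using hom unfolding conformal_hom_def by blast
  have h_act: "lact (emod ?F) z c (h x) = h (lact (emod E) z c x)" for z c x
    using hom unfolding conformal_hom_iff[OF mF] by blast
  have hv: "h v' = (v, 0)" using hi by (simp add: cocycle_ext_def)
  define \<psi> where "\<psi> = V.coord (fst (h u))"
  have "snd (h u) = w" using hp[of u] lift by (simp add: cocycle_ext_def is_lift_def)
  then have hu: "h u = (mscale V \<psi> v, w)"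
    by (metis V.expansion \<psi>_def prod.collapse)
  have key: "poly h' [:z:] = poly (action_coboundary k k' \<psi>) [:z:]"
    if "lact V z c v = mscale V (poly k [:z:]) v" "lact W z c w = mscale W (poly k' [:z:]) w"
      "lact (emod E) z c u = sc (poly h' [:z:]) v' + sc (poly k' [:z:]) u" for z c h' k k'
  proof -
    have "mscale V (pcompose \<psi> [:z, 1:] * poly k [:z:]) v = mscale V (poly h' [:z:] + poly k' [:z:] * \<psi>) v"
      using h_act[of z c u]
      by (simp add: that hu hv la h.add h.scale sesquilinearD[OF V_sesq] V.M.scale_left_distrib subst_lam_0[OF V_module])
    then have "pcompose \<psi> [:z, 1:] * poly k [:z:] = poly h' [:z:] + poly k' [:z:] * \<psi>"
      by (simp only: V.unique)
    then show ?thesis by (simp add: poly_coboundary algebra_simps)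
  qed
  have "poly f [:z:] = poly (coboundary_A \<psi>) [:z:]" "poly g [:z:] = poly (coboundary_B \<psi>) [:z:]" for z
    by (rule key[OF lact_generators(1,3) lact_E(3)], rule key[OF lact_generators(2,4) lact_E(4)])
  then show thesis by (intro that[of \<psi>] ev_eqI) (simp_all add: ev_def)
qed

end

section \<open>The space Ext\<close>

lemma action_coboundary_linear:
  "action_coboundary a a' (\<phi> + \<psi>) = action_coboundary a a' \<phi> + action_coboundary a a' \<psi>"
  "action_coboundary a a' (\<phi> - \<psi>) = action_coboundary a a' \<phi> - action_coboundary a a' \<psi>"
  "action_coboundary a a' (smult s \<phi>) = cst s * action_coboundary a a' \<phi>"
  "action_coboundary a a' 0 = 0"
  by (rule ev_eqI, simp add: algebra_simps)+

context ext_setting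
begin

lemma sesquilinear_eqI:
  assumes "sesquilinear (rscale R) (mscale W) (mscale V) \<phi>" "sesquilinear (rscale R) (mscale W) (mscale V) \<chi>"
    and "\<And>z. val (mscale V) \<phi> z A w = val (mscale V) \<chi> z A w"
    and "\<And>z. val (mscale V) \<phi> z B w = val (mscale V) \<chi> z B w"
  shows "\<phi> = \<chi>"
proof (intro ext)
  fix c y
  show "\<phi> c y = \<chi> c y"
  proof (rule subst_lam_eqI[OF V_module])
    fix z
    show "val (mscale V) \<phi> z c y = val (mscale V) \<chi> z c y"
      by (subst (1 2) R.expansion[of c], subst (1 2) W.expansion[of y])
        (simp only: sesquilinearD[OF assms(1)] sesquilinearD[OF assms(2)] assms(3,4))
  qed
qed

lemma cocycle_map_add: "cocycle_map (f + f') (g + g') = cocycle_map f g + cocycle_map f' g'"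
proof (intro ext)
  fix c y
  show "cocycle_map (f + f') (g + g') c y = (cocycle_map f g + cocycle_map f' g') c y"
    by (rule subst_lam_eqI[OF V_module])
      (simp add: subst_lam_add[OF V_module] val_cocycle_map V.M.scale_left_distrib[symmetric] algebra_simps
        smult_add_right del: V.M.scale_left_distrib)
qed

lemma cocycle_map_scale:
  "(\<lambda>c y. map_poly (mscale V [:s:]) (cocycle_map f g c y)) = cocycle_map (cst s * f) (cst s * g)"
proof (intro ext)
  fix c y
  show "map_poly (mscale V [:s:]) (cocycle_map f g c y) = cocycle_map (cst s * f) (cst s * g) c y"
    by (rule subst_lam_eqI[OF V_module])
      (simp add: subst_lam_map_poly[OF module_hom_const[OF V_module]] val_cocycle_map algebra_simps)
qed

lemma cocycle_map_0: "cocycle_map 0 0 = (\<lambda>c y. 0)"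
  by (intro ext) (simp add: cocycle_map_def app_poly_def)

lemma cocycle_map_eq_iff: "cocycle_map f g = cocycle_map f' g' \<longleftrightarrow> f = f' \<and> g = g'"
proof
  assume eq: "cocycle_map f g = cocycle_map f' g'"
  have "mscale V (poly f [:z:]) v = mscale V (poly f' [:z:]) v" "mscale V (poly g [:z:]) v = mscale V (poly g' [:z:]) v" for z
    using val_cocycle_map_generators[where f = f and g = g and z = z]
      val_cocycle_map_generators[where f = f' and g = g' and z = z] unfolding eq by simp_all
  then have "poly f [:z:] = poly f' [:z:]" "poly g [:z:] = poly g' [:z:]" for z
    unfolding V.unique by blast+
  then show "f = f' \<and> g = g'" by (intro conjI ev_eqI) (simp_all add: ev_def)
qed simp

text \<open>
  A sesquilinear map is determined by its values on generators, which are polynomial multiples of \<open>v\<close>.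
\<close>

lemma cocycle_is_cocycle_map:
  assumes \<phi>: "\<phi> \<in> cocycles R W V"
  obtains f g where "\<phi> = cocycle_map f g"
proof -
  have S: "sesquilinear (rscale R) (mscale W) (mscale V) \<phi>"
    using \<phi> cocycles_iff[OF R_module V(1) W(1)] by blast
  have "val (mscale V) \<phi> z c w = mscale V (poly (map_poly V.coord (\<phi> c w)) [:z:]) v" for z c
    by (subst subst_lam_app_poly[OF V_module, symmetric]) (simp only: V.app_poly_coord)
  then have "\<phi> = cocycle_map (map_poly V.coord (\<phi> A w)) (map_poly V.coord (\<phi> B w))"
    by (intro sesquilinear_eqI[OF S sesquilinear_cocycle_map]) (simp_all only: val_cocycle_map_generators)
  then show thesis by (rule that)
qed

lemma cocycle_map_in_cocycles_iff: "cocycle_map f g \<in> cocycles R W V \<longleftrightarrow> pair_cocycle f g"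
proof
  assume "cocycle_map f g \<in> cocycles R W V"
  then interpret lifted_extension R A B V v W w a b a' b' "cocycle_ext W V (cocycle_map f g)" "(0, w)" f g
    by unfold_locales (simp_all add: cocycle_ext_is_extension cocycle_map_lift)
  show "pair_cocycle f g" by (rule lift_pair_cocycle)
qed (rule cocycle_map_in_cocycles)

lemma cocycles_eq: "cocycles R W V = {cocycle_map f g | f g. pair_cocycle f g}"
proof (intro equalityI subsetI)
  fix \<phi>
  assume \<phi>: "\<phi> \<in> cocycles R W V"
  then obtain f g where fg: "\<phi> = cocycle_map f g" by (rule cocycle_is_cocycle_map)
  then have "pair_cocycle f g" using \<phi> unfolding fg cocycle_map_in_cocycles_iff by simp
  then show "\<phi> \<in> {cocycle_map f g | f g. pair_cocycle f g}" using fg by blast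
qed (auto simp: cocycle_map_in_cocycles)

lemma pair_cocycle_0: "pair_cocycle 0 0"
  by (simp add: pair_cocycle_for_def)

lemma lifted_trivial_ext_iff:
  assumes E: "is_extension R W V E" "is_lift E u f g"
  shows "trivial_ext W V E \<longleftrightarrow> (\<exists>\<psi>. f = coboundary_A \<psi> \<and> g = coboundary_B \<psi>)"
proof -
  interpret lifted_extension R A B V v W w a b a' b' E u f g
    by unfold_locales (rule E)+
  show ?thesis
  proof
    assume "\<exists>\<psi>. f = coboundary_A \<psi> \<and> g = coboundary_B \<psi>"
    then show "trivial_ext W V E"
      using equivalent_cocycle_ext[OF pair_cocycle_0] unfolding trivial_ext_def cocycle_map_0 by auto
  qed (metis trivial_ext_imp_coboundary)
qed

context
  assumes coboundary_cocycle: "\<And>\<psi>. pair_cocycle (coboundary_A \<psi>) (coboundary_B \<psi>)"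
begin

lemma trivial_cocycles_eq: "trivial_cocycles R W V = range (\<lambda>\<psi>. cocycle_map (coboundary_A \<psi>) (coboundary_B \<psi>))"
proof -
  have "trivial_ext W V (cocycle_ext W V (cocycle_map f g)) \<longleftrightarrow> (\<exists>\<psi>. f = coboundary_A \<psi> \<and> g = coboundary_B \<psi>)"
    if "pair_cocycle f g" for f g
    by (rule lifted_trivial_ext_iff[OF cocycle_ext_is_extension cocycle_map_lift])
      (use that in \<open>simp add: cocycle_map_in_cocycles\<close>)
  then show ?thesis
    unfolding trivial_cocycles_def cocycles_eq using coboundary_cocycle by blast
qed

definition ext_class where "ext_class f g = cocycle_map f g +o trivial_cocycles R W V"

lemma ext_class_eq: "ext_class f g = range (\<lambda>\<psi>. cocycle_map (f + coboundary_A \<psi>) (g + coboundary_B \<psi>))"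
  unfolding ext_class_def trivial_cocycles_eq elt_set_plus_def cocycle_map_add by blast

lemma ext_class_0: "ext_class 0 0 = trivial_cocycles R W V"
  unfolding ext_class_eq trivial_cocycles_eq by simp

lemma ext_class_eq_iff:
  "ext_class f g = ext_class f' g' \<longleftrightarrow> (\<exists>\<psi>. f = f' + coboundary_A \<psi> \<and> g = g' + coboundary_B \<psi>)"
proof
  assume "ext_class f g = ext_class f' g'"
  moreover have "cocycle_map f g \<in> ext_class f g"
    unfolding ext_class_eq by (rule range_eqI[of _ _ 0]) (simp add: action_coboundary_linear)
  ultimately show "\<exists>\<psi>. f = f' + coboundary_A \<psi> \<and> g = g' + coboundary_B \<psi>"
    unfolding ext_class_eq by (auto simp: cocycle_map_eq_iff)
next
  assume "\<exists>\<psi>. f = f' + coboundary_A \<psi> \<and> g = g' + coboundary_B \<psi>"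
  then obtain \<psi> where eq: "f = f' + coboundary_A \<psi>" "g = g' + coboundary_B \<psi>" by blast
  have shift: "cocycle_map (f + coboundary_A \<chi>) (g + coboundary_B \<chi>)
      = cocycle_map (f' + coboundary_A (\<psi> + \<chi>)) (g' + coboundary_B (\<psi> + \<chi>))" for \<chi>
    by (simp add: eq action_coboundary_linear add.assoc)
  let ?G = "\<lambda>\<chi>. cocycle_map (f' + coboundary_A \<chi>) (g' + coboundary_B \<chi>)"
  have "?G \<chi> = ?G (\<psi> + (\<chi> - \<psi>))" for \<chi> by simp
  then have "?G \<chi> \<in> range (\<lambda>\<chi>. ?G (\<psi> + \<chi>))" for \<chi> by (rule range_eqI)
  then have "range (\<lambda>\<chi>. ?G (\<psi> + \<chi>)) = range ?G" by (intro equalityI image_subsetI) simp_all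
  then show "ext_class f g = ext_class f' g'" unfolding ext_class_eq shift .
qed

lemma ext_class_add: "ext_class f g + ext_class f' g' = ext_class (f + f') (g + g')"
proof (intro equalityI subsetI)
  have sum: "cocycle_map (f + coboundary_A \<psi>) (g + coboundary_B \<psi>) + cocycle_map (f' + coboundary_A \<chi>) (g' + coboundary_B \<chi>)
      = cocycle_map (f + f' + coboundary_A (\<psi> + \<chi>)) (g + g' + coboundary_B (\<psi> + \<chi>))" for \<psi> \<chi>
    unfolding cocycle_map_add[symmetric] action_coboundary_linear by (simp add: algebra_simps)
  {
    fix \<phi>
    assume "\<phi> \<in> ext_class f g + ext_class f' g'"
    then show "\<phi> \<in> ext_class (f + f') (g + g')"
      unfolding ext_class_eq by (elim set_plus_elim rangeE) (simp add: sum)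
  next
    fix \<phi>
    assume "\<phi> \<in> ext_class (f + f') (g + g')"
    then obtain \<psi> where "\<phi> = cocycle_map (f + f' + coboundary_A (\<psi> + 0)) (g + g' + coboundary_B (\<psi> + 0))"
      unfolding ext_class_eq by auto
    then show "\<phi> \<in> ext_class f g + ext_class f' g'"
      unfolding sum[symmetric] ext_class_eq by (blast intro: set_plus_intro)
  }
qed

lemma ext_class_scale: "Ext_scale R W V s (ext_class f g) = ext_class (cst s * f) (cst s * g)"
proof -
  let ?S = "(\<lambda>\<phi> c y. map_poly (mscale V [:s:]) (\<phi> c y)) ` ext_class f g"
  have S: "?S = range (\<lambda>\<psi>. cocycle_map (cst s * f + coboundary_A (smult s \<psi>)) (cst s * g + coboundary_B (smult s \<psi>)))"
    unfolding ext_class_eq image_image cocycle_map_scale distrib_left action_coboundary_linear(3) ..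
  have sub: "?S \<subseteq> ext_class (cst s * f) (cst s * g)" unfolding S unfolding ext_class_eq by auto
  have mem: "cocycle_map (cst s * f) (cst s * g) \<in> ?S"
    unfolding S by (rule range_eqI[of _ _ 0]) (simp add: action_coboundary_linear)
  have absorb: "ext_class (cst s * f) (cst s * g) + trivial_cocycles R W V = ext_class (cst s * f) (cst s * g)"
    using ext_class_add[of "cst s * f" "cst s * g" 0 0] by (simp add: ext_class_0)
  show ?thesis
    unfolding Ext_scale_def
  proof (rule equalityI)
    show "?S + trivial_cocycles R W V \<subseteq> ext_class (cst s * f) (cst s * g)"
      using set_plus_mono2[OF sub subset_refl[of "trivial_cocycles R W V"]] unfolding absorb .
    show "ext_class (cst s * f) (cst s * g) \<subseteq> ?S + trivial_cocycles R W V"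
      by (subst ext_class_def[of "cst s * f" "cst s * g"]) (rule set_plus_mono3[OF mem])
  qed
qed

text \<open>
  The sum in the definition of the dimension, which is folded from the right and starts with the zero
  class.
\<close>

lemma linear_combination_of_classes:
  "foldr (+) (map2 (Ext_scale R W V) cs (map (\<lambda>(f, g). ext_class f g) bs)) (trivial_cocycles R W V)
    = ext_class (lincomb cs (map fst bs)) (lincomb cs (map snd bs))"
proof (induction cs arbitrary: bs)
  case Nil
  then show ?case by (simp add: ext_class_0)
next
  case (Cons c cs)
  show ?case
  proof (cases bs)
    case Nil
    then show ?thesis by (simp add: ext_class_0)
  next
    case bs: (Cons b bs')
    obtain f g where b: "b = (f, g)" by (cases b)
    show ?thesis
      unfolding bs b
      by (simp only: list.map zip_Cons_Cons prod.case foldr.simps o_apply Cons.IH ext_class_scale ext_class_add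
          lincomb_simps fst_conv snd_conv)
  qed
qed

text \<open>
  Classes are added and scaled like the pairs of polynomials which represent them, so a basis of the
  pairs modulo coboundaries gives a basis of Ext.
\<close>

lemma dim_Ext_from_basis:
  assumes n: "length bs = n" and bs: "\<And>f g. (f, g) \<in> set bs \<Longrightarrow> pair_cocycle f g"
    and ex: "\<And>f g. pair_cocycle f g \<Longrightarrow> \<exists>cs \<psi>. length cs = n \<and>
      f = lincomb cs (map fst bs) + coboundary_A \<psi> \<and> g = lincomb cs (map snd bs) + coboundary_B \<psi>"
    and indep: "\<And>cs cs' \<psi>. length cs = n \<Longrightarrow> length cs' = n \<Longrightarrow>
      lincomb cs (map fst bs) = lincomb cs' (map fst bs) + coboundary_A \<psi> \<Longrightarrow>
      lincomb cs (map snd bs) = lincomb cs' (map snd bs) + coboundary_B \<psi> \<Longrightarrow> cs = cs'"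
  shows "dim_Ext_is R W V n"
  unfolding dim_Ext_is_def has_dimension_def
proof (intro exI[of _ "map (\<lambda>(f, g). ext_class f g) bs"] conjI ballI)
  have Ext: "Ext R W V = {ext_class f g | f g. pair_cocycle f g}"
    unfolding Ext_def cocycles_eq ext_class_def by blast
  show "set (map (\<lambda>(f, g). ext_class f g) bs) \<subseteq> Ext R W V"
    unfolding Ext using bs by auto
  fix X
  assume "X \<in> Ext R W V"
  then obtain f g where X: "X = ext_class f g" and "pair_cocycle f g" unfolding Ext by blast
  from ex[OF this(2)] obtain cs \<psi> where cs: "length cs = n"
    "f = lincomb cs (map fst bs) + coboundary_A \<psi>" "g = lincomb cs (map snd bs) + coboundary_B \<psi>" by blast
  then have X': "X = ext_class (lincomb cs (map fst bs)) (lincomb cs (map snd bs))"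
    unfolding X ext_class_eq_iff by blast
  show "\<exists>!cs. length cs = n \<and> X = foldr (+) (map2 (Ext_scale R W V) cs (map (\<lambda>(f, g). ext_class f g) bs)) (trivial_cocycles R W V)"
    unfolding linear_combination_of_classes X'
  proof (rule ex1I[of _ cs])
    fix cs'
    assume "length cs' = n \<and> ext_class (lincomb cs (map fst bs)) (lincomb cs (map snd bs))
      = ext_class (lincomb cs' (map fst bs)) (lincomb cs' (map snd bs))"
    then show "cs' = cs" using indep[OF cs(1), of cs'] unfolding ext_class_eq_iff by blast
  qed (simp add: cs(1))
qed (simp add: n)

end

end

section \<open>The actions of the two summands\<close>

abbreviation action_poly :: "complex \<Rightarrow> complex \<Rightarrow> complex \<Rightarrow> complex poly poly" where
  "action_poly \<delta> \<alpha> \<beta> \<equiv> cst \<delta> * (del + cst \<alpha> * lam + cst \<beta>)"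

lemma ev_action_poly: "ev (action_poly \<delta> \<alpha> \<beta>) x l = \<delta> * (x + \<alpha> * l + \<beta>)"
  by (simp add: algebra_simps)

lemma pair_cocycle_swap: "pair_cocycle_for a b a' b' f g \<Longrightarrow> pair_cocycle_for b a b' a' g f"
  unfolding pair_cocycle_for_def by (metis add.commute)

text \<open>
  As \<open>B\<close> acts by zero on both modules, the identity for \<open>[B, B]\<close> reads \<open>(\<lambda> - \<mu>)g(\<partial>, \<lambda> + \<mu>) = 0\<close>.
\<close>

lemma pair_cocycle_same_summand:
  "pair_cocycle_for (action_poly 1 \<alpha> \<beta>) (action_poly 0 \<alpha>2 \<beta>2) (action_poly 1 \<alpha>' \<beta>') (action_poly 0 \<alpha>2' \<beta>2') f g
    \<longleftrightarrow> vir_cocycle \<alpha> \<beta> \<alpha>' \<beta>' f \<and> g = 0"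
  (is "?L \<longleftrightarrow> ?C \<and> _")
proof
  assume pc: ?L
  note pc' = pc[unfolded pair_cocycle_for_def ev_action_poly, rule_format]
  have "ev g x t = 0" for x t
  proof -
    \<comment> \<open>With these values, \<open>\<lambda> + \<mu> = t\<close> and \<open>\<lambda> - \<mu> = 1\<close>.\<close>
    have "((t + 1) / 2 - (t - 1) / 2) * ev g x ((t + 1) / 2 + (t - 1) / 2) = 0"
      using pc'[of x "(t + 1) / 2" "(t - 1) / 2"] by simp
    moreover have "(t + 1) / 2 - (t - 1) / 2 = 1" "(t + 1) / 2 + (t - 1) / 2 = t"
      by (simp_all add: field_simps)
    ultimately show ?thesis by simp
  qed
  then have "g = 0" by (intro ev_eqI) simp
  moreover have ?C
    unfolding vir_cocycle_def
  proof (intro allI, goal_cases)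
    case (1 x l m)
    then show ?case using pc'[of x l m] by (simp add: algebra_simps)
  qed
  ultimately show "?C \<and> g = 0" by blast
next
  assume fg: "?C \<and> g = 0"
  show ?L
    unfolding pair_cocycle_for_def ev_action_poly
  proof (intro allI, goal_cases)
    case (1 x l m)
    then show ?case
      using fg[THEN conjunct1, unfolded vir_cocycle_def, rule_format, of x l m] fg[THEN conjunct2]
      by (simp add: algebra_simps)
  qed
qed

lemma action_coboundary_same_summand:
  "action_coboundary (action_poly 1 \<alpha> \<beta>) (action_poly 1 \<alpha>' \<beta>') \<psi> = vir_coboundary \<alpha> \<beta> \<alpha>' \<beta>' \<psi>"
  "action_coboundary (action_poly 0 \<alpha> \<beta>) (action_poly 0 \<alpha>' \<beta>') \<psi> = 0"
  by (rule ev_eqI, simp only: ev_action_coboundary ev_action_poly, simp)+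

text \<open>
  The identity for \<open>[A, B]\<close> is
  \<open>f(\<partial>, \<lambda>)(\<partial> + \<lambda> + \<alpha>'\<mu> + \<beta>') = - g(\<partial> + \<lambda>, \<mu>)(\<partial> + \<alpha>\<lambda> + \<beta>)\<close>.  At \<open>\<lambda> = 0\<close> it shows that \<open>\<partial> + \<beta>\<close> divides
  \<open>f(\<partial>, 0)\<close>, because \<open>\<alpha>' \<noteq> 0\<close>.  The quotient \<open>\<psi>\<close> gives \<open>g\<close>, and then the identity gives \<open>f\<close>.
\<close>

lemma mixed_summands_coboundary:
  assumes pc: "pair_cocycle_for (action_poly 1 \<alpha> \<beta>) (action_poly 0 \<alpha>2 \<beta>2) (action_poly 0 \<alpha>1' \<beta>1') (action_poly 1 \<alpha>' \<beta>') f g"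
    and "\<alpha>' \<noteq> 0"
  shows "\<exists>\<psi>. f = action_coboundary (action_poly 1 \<alpha> \<beta>) (action_poly 0 \<alpha>1' \<beta>1') \<psi>
    \<and> g = action_coboundary (action_poly 0 \<alpha>2 \<beta>2) (action_poly 1 \<alpha>' \<beta>') \<psi>"
proof -
  have rel: "ev g (x + l) m * (x + \<alpha> * l + \<beta>) + ev f x l * (x + l + \<alpha>' * m + \<beta>') = 0" for x l m
    using pc[unfolded pair_cocycle_for_def ev_action_poly, rule_format, of x l m] by simp
  let ?p = "coeff f 0"
  have ev0: "ev f x 0 = poly ?p x" for x by (simp add: ev_def poly_0_coeff_0)
  have root: "ev f (- \<beta>) 0 * (\<alpha>' * m + (\<beta>' - \<beta>)) = 0" for m
    using rel[of "- \<beta>" 0 m] by (simp add: algebra_simps)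
  have "ev f (- \<beta>) 0 * \<alpha>' = ev f (- \<beta>) 0 * (\<alpha>' * 1 + (\<beta>' - \<beta>)) - ev f (- \<beta>) 0 * (\<alpha>' * 0 + (\<beta>' - \<beta>))"
    by (simp add: algebra_simps)
  then have "ev f (- \<beta>) 0 * \<alpha>' = 0" unfolding root by simp
  then have "poly ?p (- \<beta>) = 0" using \<open>\<alpha>' \<noteq> 0\<close> by (simp add: ev0)
  then obtain \<psi> where p: "?p = [:\<beta>, 1:] * \<psi>" by (auto simp: poly_eq_0_iff_dvd elim: dvdE)
  have g: "ev g x m = - (x + \<alpha>' * m + \<beta>') * poly \<psi> x" for x m
  proof -
    have "[:\<beta>, 1:] * (poly g [:m:] + [:\<alpha>' * m + \<beta>', 1:] * \<psi>) = 0"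
      using rel[of _ 0 m] unfolding ev0 p by (intro poly_ext) (simp add: ev_def algebra_simps)
    then have "poly g [:m:] + [:\<alpha>' * m + \<beta>', 1:] * \<psi> = 0"
      unfolding mult_eq_0_iff by simp
    from arg_cong[OF this, of "\<lambda>q. poly q x"] show ?thesis
      by (simp add: ev_def algebra_simps eq_neg_iff_add_eq_0)
  qed
  have f: "ev f x l = (x + \<alpha> * l + \<beta>) * poly \<psi> (x + l)" for x l
  proof -
    \<comment> \<open>The value of \<open>\<mu>\<close> for which the factor of \<open>f\<close> is one.\<close>
    define m where "m = (1 - x - l - \<beta>') / \<alpha>'"
    have m: "x + l + \<alpha>' * m + \<beta>' = 1" using \<open>\<alpha>' \<noteq> 0\<close> by (simp add: m_def)
    show ?thesis using rel[of x l m] unfolding g m by (simp add: algebra_simps)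
  qed
  show ?thesis
    by (intro exI[of _ \<psi>] conjI ev_eqI) (simp_all only: ev_action_coboundary ev_action_poly f g, simp_all add: algebra_simps)
qed

section \<open>Classification of the extensions\<close>

lemma irreducible_params_cases:
  assumes "irreducible_params \<delta>1 \<alpha>1 \<delta>2 \<alpha>2"
  obtains "\<delta>1 = 1" "\<delta>2 = 0" "\<alpha>1 \<noteq> 0" | "\<delta>1 = 0" "\<delta>2 = 1" "\<alpha>2 \<noteq> 0"
  using assms unfolding irreducible_params_def by auto

lemma classification_first_summand:
  assumes pc: "pair_cocycle_for (action_poly 1 \<alpha>1 \<beta>1) (action_poly 0 \<alpha>2 \<beta>2)
      (action_poly \<delta>1' \<alpha>1' \<beta>1') (action_poly \<delta>2' \<alpha>2' \<beta>2') f g"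
    and "\<alpha>1 \<noteq> 0" and irr: "irreducible_params \<delta>1' \<alpha>1' \<delta>2' \<alpha>2'"
  shows "(\<exists>\<psi>. f = action_coboundary (action_poly 1 \<alpha>1 \<beta>1) (action_poly \<delta>1' \<alpha>1' \<beta>1') \<psi>
      \<and> g = action_coboundary (action_poly 0 \<alpha>2 \<beta>2) (action_poly \<delta>2' \<alpha>2' \<beta>2') \<psi>)
    \<or> (\<exists>k f0 \<psi>. extension_case 1 \<alpha>1 \<beta>1 \<delta>1' \<alpha>1' \<beta>1' 0 \<delta>2' k \<and> f0 \<in> subcase_polys k \<alpha>1 \<beta>1
      \<and> f = f0 + action_coboundary (action_poly 1 \<alpha>1 \<beta>1) (action_poly \<delta>1' \<alpha>1' \<beta>1') \<psi>
      \<and> g = action_coboundary (action_poly 0 \<alpha>2 \<beta>2) (action_poly \<delta>2' \<alpha>2' \<beta>2') \<psi>)"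
  using irr
proof (cases rule: irreducible_params_cases)
  case 1
  have f: "vir_cocycle \<alpha>1 \<beta>1 \<alpha>1' \<beta>1' f" and g: "g = 0"
    using pc unfolding 1 pair_cocycle_same_summand by blast+
  from vir_cocycle_classification[OF f \<open>\<alpha>1 \<noteq> 0\<close>] show ?thesis
    unfolding 1 action_coboundary_same_summand g extension_case_def
    using 1 \<open>\<alpha>1 \<noteq> 0\<close> subcase_params_range by blast
next
  case 2
  show ?thesis
    using mixed_summands_coboundary[of \<alpha>1 \<beta>1 \<alpha>2 \<beta>2 \<alpha>1' \<beta>1' \<alpha>2' \<beta>2' f g] pc \<open>\<alpha>2' \<noteq> 0\<close> unfolding 2 by blast
qed

text \<open>
  The case in which the summand of \<open>B\<close> acts on the submodule is reduced to the case of \<open>A\<close> by exchanging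
  the two summands.
\<close>

lemma pair_cocycle_classification:
  fixes \<delta>1 \<alpha>1 \<beta>1 \<delta>2 \<alpha>2 \<beta>2 \<delta>1' \<alpha>1' \<beta>1' \<delta>2' \<alpha>2' \<beta>2' :: complex
  defines "a \<equiv> action_poly \<delta>1 \<alpha>1 \<beta>1" and "b \<equiv> action_poly \<delta>2 \<alpha>2 \<beta>2"
    and "a' \<equiv> action_poly \<delta>1' \<alpha>1' \<beta>1'" and "b' \<equiv> action_poly \<delta>2' \<alpha>2' \<beta>2'"
  assumes pc: "pair_cocycle_for a b a' b' f g"
    and irr: "irreducible_params \<delta>1 \<alpha>1 \<delta>2 \<alpha>2" "irreducible_params \<delta>1' \<alpha>1' \<delta>2' \<alpha>2'"
  shows "(\<exists>\<psi>. f = action_coboundary a a' \<psi> \<and> g = action_coboundary b b' \<psi>)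
    \<or> (\<exists>k f0 g0 \<psi>. (extension_case \<delta>1 \<alpha>1 \<beta>1 \<delta>1' \<alpha>1' \<beta>1' \<delta>2 \<delta>2' k \<and> f0 \<in> subcase_polys k \<alpha>1 \<beta>1 \<and> g0 = 0 \<or>
         extension_case \<delta>2 \<alpha>2 \<beta>2 \<delta>2' \<alpha>2' \<beta>2' \<delta>1 \<delta>1' k \<and> f0 = 0 \<and> g0 \<in> subcase_polys k \<alpha>2 \<beta>2)
      \<and> f = f0 + action_coboundary a a' \<psi> \<and> g = g0 + action_coboundary b b' \<psi>)"
  using irr(1)
proof (cases rule: irreducible_params_cases)
  case 1
  then show ?thesis
    using classification_first_summand[of \<alpha>1 \<beta>1 \<alpha>2 \<beta>2 \<delta>1' \<alpha>1' \<beta>1' \<delta>2' \<alpha>2' \<beta>2' f g] pc irr(2)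
    unfolding a_def b_def a'_def b'_def by (metis add_0)
next
  case 2
  have "irreducible_params \<delta>2' \<alpha>2' \<delta>1' \<alpha>1'" using irr(2) unfolding irreducible_params_def by (auto simp: add.commute)
  then show ?thesis
    using classification_first_summand[of \<alpha>2 \<beta>2 \<alpha>1 \<beta>1 \<delta>2' \<alpha>2' \<beta>2' \<delta>1' \<alpha>1' \<beta>1' g f] pair_cocycle_swap[OF pc] 2
    unfolding a_def b_def a'_def b'_def by (metis add_0)
qed

lemma special_cocycle_first_summand:
  assumes "extension_case \<delta>1 \<alpha>1 \<beta>1 \<delta>1' \<alpha>1' \<beta>1' \<delta>2 \<delta>2' k" "f \<in> subcase_polys k \<alpha>1 \<beta>1"
  shows "pair_cocycle_for (action_poly \<delta>1 \<alpha>1 \<beta>1) (action_poly \<delta>2 \<alpha>2 \<beta>2)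
      (action_poly \<delta>1' \<alpha>1' \<beta>1') (action_poly \<delta>2' \<alpha>2' \<beta>2') f 0" (is ?cocycle)
    and "f \<noteq> action_coboundary (action_poly \<delta>1 \<alpha>1 \<beta>1) (action_poly \<delta>1' \<alpha>1' \<beta>1') \<psi>" (is ?nontrivial)
proof -
  have p: "\<delta>1 = 1" "\<delta>1' = 1" "\<delta>2 = 0" "\<delta>2' = 0" "\<beta>1' = \<beta>1" "subcase_params k \<alpha>1 \<alpha>1'"
    using assms(1) unfolding extension_case_def by auto
  show ?cocycle
    unfolding p(1-5) pair_cocycle_same_summand using subcase_polys_cocycle[OF p(6) assms(2)] by simp
  show ?nontrivial
    unfolding p(1-5) action_coboundary_same_summand using subcase_polys_not_coboundary[OF p(6) assms(2)] .
qed

lemma lincomb_diff: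
  "length cs = length cs' \<Longrightarrow> lincomb (map2 (-) cs cs') Hs = lincomb cs Hs - lincomb cs' Hs"
proof (induction cs cs' arbitrary: Hs rule: list_induct2)
  case (Cons c cs c' cs')
  show ?case
  proof (cases Hs)
    case Hs: (Cons H Hs')
    have "cst (c - c') * H = cst c * H - cst c' * H" by (rule ev_eqI) (simp add: algebra_simps)
    then show ?thesis unfolding Hs by (simp only: list.map zip_Cons_Cons prod.case lincomb_simps Cons.IH) simp
  qed simp
qed simp

lemma lincomb_zeros: "lincomb cs (map (\<lambda>_. 0) Hs) = 0"
proof (induction cs arbitrary: Hs)
  case (Cons c cs)
  then show ?case by (cases Hs) simp_all
qed simp

lemma subcase_basis_unique_combination:
  assumes k: "subcase_params k \<alpha> \<alpha>'" and len: "length cs = subcase_dim k" "length cs' = subcase_dim k"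
    and eq: "lincomb cs (subcase_basis k \<alpha> \<beta>) = lincomb cs' (subcase_basis k \<alpha> \<beta>) + vir_coboundary \<alpha> \<beta> \<alpha>' \<beta> \<psi>"
  shows "cs = cs'"
proof -
  have "lincomb (map2 (-) cs cs') (subcase_basis k \<alpha> \<beta>) = vir_coboundary \<alpha> \<beta> \<alpha>' \<beta> \<psi>"
    using eq len by (simp add: lincomb_diff)
  then have "\<forall>s\<in>set (map2 (-) cs cs'). s = 0"
    by (rule subcase_basis_independent[OF k, rotated]) (simp add: len)
  then have "\<forall>i<length cs. map2 (-) cs cs' ! i = 0" using len by (metis length_map length_zip min.idem nth_mem)
  then show ?thesis using len by (intro nth_equalityI) simp_all
qed

text \<open>
  The hypotheses of \<open>dim_Ext_from_basis\<close> for the pairs \<open>(H, 0)\<close>, where \<open>H\<close> runs through the basis of the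
  subcase.
\<close>

lemma subcase_basis_spans_first_summand:
  fixes \<delta>1 \<alpha>1 \<beta>1 \<delta>2 \<alpha>2 \<beta>2 \<delta>1' \<alpha>1' \<beta>1' \<delta>2' \<alpha>2' \<beta>2' :: complex
  assumes "extension_case \<delta>1 \<alpha>1 \<beta>1 \<delta>1' \<alpha>1' \<beta>1' \<delta>2 \<delta>2' k"
  defines "Hs \<equiv> subcase_basis k \<alpha>1 \<beta>1"
    and "pc \<equiv> pair_cocycle_for (action_poly \<delta>1 \<alpha>1 \<beta>1) (action_poly \<delta>2 \<alpha>2 \<beta>2)
      (action_poly \<delta>1' \<alpha>1' \<beta>1') (action_poly \<delta>2' \<alpha>2' \<beta>2')"
    and "cA \<equiv> action_coboundary (action_poly \<delta>1 \<alpha>1 \<beta>1) (action_poly \<delta>1' \<alpha>1' \<beta>1')"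
    and "cB \<equiv> action_coboundary (action_poly \<delta>2 \<alpha>2 \<beta>2) (action_poly \<delta>2' \<alpha>2' \<beta>2')"
  shows "pc (cA \<psi>) (cB \<psi>)" "H \<in> set Hs \<Longrightarrow> pc H 0"
    "pc f g \<Longrightarrow> \<exists>cs \<psi>. length cs = subcase_dim k \<and> f = lincomb cs Hs + cA \<psi> \<and> g = cB \<psi>"
    "\<lbrakk>length cs = subcase_dim k; length cs' = subcase_dim k; lincomb cs Hs = lincomb cs' Hs + cA \<psi>\<rbrakk> \<Longrightarrow> cs = cs'"
proof -
  have p: "\<delta>1 = 1" "\<delta>1' = 1" "\<delta>2 = 0" "\<delta>2' = 0" "\<beta>1' = \<beta>1" "subcase_params k \<alpha>1 \<alpha>1'" "\<alpha>1 \<noteq> 0"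
    using assms(1) unfolding extension_case_def by auto
  show "pc (cA \<psi>) (cB \<psi>)"
    unfolding pc_def cA_def cB_def p(1-5) pair_cocycle_same_summand action_coboundary_same_summand
    using vir_coboundary_is_cocycle by simp
  show "pc H 0" if "H \<in> set Hs"
    unfolding pc_def p(1-5) pair_cocycle_same_summand using subcase_basis_cocycle[OF p(6)] that by (simp add: Hs_def)
  show "\<exists>cs \<psi>. length cs = subcase_dim k \<and> f = lincomb cs Hs + cA \<psi> \<and> g = cB \<psi>" if "pc f g"
  proof -
    have "vir_cocycle \<alpha>1 \<beta>1 \<alpha>1' \<beta>1 f" "g = 0"
      using that unfolding pc_def p(1-5) pair_cocycle_same_summand by blast+
    then show ?thesis
      unfolding Hs_def cA_def cB_def p(1-5) action_coboundary_same_summand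
      using cocycle_basis_decomposition[OF p(6,7)] by metis
  qed
  show "cs = cs'" if "length cs = subcase_dim k" "length cs' = subcase_dim k" "lincomb cs Hs = lincomb cs' Hs + cA \<psi>"
    using subcase_basis_unique_combination[OF p(6) that(1,2)] that(3)
    unfolding Hs_def cA_def p(1-5) action_coboundary_same_summand by blast
qed

theorem theorem3p7:
  fixes R :: "'r::ab_group_add lca" and A B :: 'r
    and V :: "('r, 'v::ab_group_add) cmod" and v :: 'v
    and W :: "('r, 'w::ab_group_add) cmod" and w :: 'w
    and \<delta>1 \<alpha>1 \<beta>1 \<delta>2 \<alpha>2 \<beta>2 \<delta>1' \<alpha>1' \<beta>1' \<delta>2' \<alpha>2' \<beta>2' :: complex
  assumes "virasoro_sum R A B"
    and "irreducible_params \<delta>1 \<alpha>1 \<delta>2 \<alpha>2"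
    and "irreducible_params \<delta>1' \<alpha>1' \<delta>2' \<alpha>2'"
    and "rank_one_module R A B \<delta>1 \<alpha>1 \<beta>1 \<delta>2 \<alpha>2 \<beta>2 V v"
    and "rank_one_module R A B \<delta>1' \<alpha>1' \<beta>1' \<delta>2' \<alpha>2' \<beta>2' W w"
  shows
    "(\<forall>E :: ('r, 'v, 'w, 'e::ab_group_add) extension.
        is_extension R W V E \<longrightarrow>
        (\<exists>f g. given_by A B \<delta>1 \<alpha>1 \<beta>1 \<delta>2 \<alpha>2 \<beta>2 v \<delta>1' \<alpha>1' \<beta>1' \<delta>2' \<alpha>2' \<beta>2' w E f g))
     \<and>
     (\<forall>E :: ('r, 'v, 'w, 'e) extension.
        is_extension R W V E \<and> \<not> trivial_ext W V E \<longrightarrow>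
        (\<exists>k f g.
         (extension_case \<delta>1 \<alpha>1 \<beta>1 \<delta>1' \<alpha>1' \<beta>1' \<delta>2 \<delta>2' k \<and> f \<in> subcase_polys k \<alpha>1 \<beta>1 \<and> g = 0 \<or>
         extension_case \<delta>2 \<alpha>2 \<beta>2 \<delta>2' \<alpha>2' \<beta>2' \<delta>1 \<delta>1' k \<and> f = 0 \<and> g \<in> subcase_polys k \<alpha>2 \<beta>2) \<and>
         (\<exists>E' :: ('r, 'v, 'w, 'v \<times> 'w) extension.
            is_extension R W V E' \<and>
            given_by A B \<delta>1 \<alpha>1 \<beta>1 \<delta>2 \<alpha>2 \<beta>2 v \<delta>1' \<alpha>1' \<beta>1' \<delta>2' \<alpha>2' \<beta>2' w E' f g \<and>
            equivalent_ext E E')))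
     \<and>
     (\<forall>k f g.
         (extension_case \<delta>1 \<alpha>1 \<beta>1 \<delta>1' \<alpha>1' \<beta>1' \<delta>2 \<delta>2' k \<and> f \<in> subcase_polys k \<alpha>1 \<beta>1 \<and> g = 0 \<or>
         extension_case \<delta>2 \<alpha>2 \<beta>2 \<delta>2' \<alpha>2' \<beta>2' \<delta>1 \<delta>1' k \<and> f = 0 \<and> g \<in> subcase_polys k \<alpha>2 \<beta>2) \<longrightarrow>
         (\<exists>E' :: ('r, 'v, 'w, 'v \<times> 'w) extension.
            is_extension R W V E' \<and>
            given_by A B \<delta>1 \<alpha>1 \<beta>1 \<delta>2 \<alpha>2 \<beta>2 v \<delta>1' \<alpha>1' \<beta>1' \<delta>2' \<alpha>2' \<beta>2' w E' f g \<and>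
            \<not> trivial_ext W V E'))
     \<and>
     (\<forall>k.
         extension_case \<delta>1 \<alpha>1 \<beta>1 \<delta>1' \<alpha>1' \<beta>1' \<delta>2 \<delta>2' k \<or>
         extension_case \<delta>2 \<alpha>2 \<beta>2 \<delta>2' \<alpha>2' \<beta>2' \<delta>1 \<delta>1' k \<longrightarrow>
         dim_Ext_is R W V (subcase_dim k))"
proof -
  interpret S: ext_setting R A B V v W w "action_poly \<delta>1 \<alpha>1 \<beta>1" "action_poly \<delta>2 \<alpha>2 \<beta>2"
    "action_poly \<delta>1' \<alpha>1' \<beta>1'" "action_poly \<delta>2' \<alpha>2' \<beta>2'"
    using assms(1,4,5) by unfold_locales (simp_all only: rank_one_module_def)
  let ?case = "\<lambda>k f g. extension_case \<delta>1 \<alpha>1 \<beta>1 \<delta>1' \<alpha>1' \<beta>1' \<delta>2 \<delta>2' k \<and> f \<in> subcase_polys k \<alpha>1 \<beta>1 \<and> g = 0 \<or>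
         extension_case \<delta>2 \<alpha>2 \<beta>2 \<delta>2' \<alpha>2' \<beta>2' \<delta>1 \<delta>1' k \<and> f = 0 \<and> g \<in> subcase_polys k \<alpha>2 \<beta>2"
  let ?given = "given_by A B \<delta>1 \<alpha>1 \<beta>1 \<delta>2 \<alpha>2 \<beta>2 v \<delta>1' \<alpha>1' \<beta>1' \<delta>2' \<alpha>2' \<beta>2' w"
  have given: "given_by A B \<delta>1 \<alpha>1 \<beta>1 \<delta>2 \<alpha>2 \<beta>2 v \<delta>1' \<alpha>1' \<beta>1' \<delta>2' \<alpha>2' \<beta>2' w E f g \<longleftrightarrow> (\<exists>u. S.is_lift E u f g)"
    for E :: "('r, 'v, 'w, 'x::ab_group_add) extension" and f g
    unfolding given_by_def S.is_lift_def ..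
  have lift: "\<exists>u f g. S.is_lift E u f g" if "is_extension R W V E" for E :: "('r, 'v, 'w, 'e) extension"
    using S.extension_has_lift that by blast
  have case_pair: "S.pair_cocycle f g \<and> \<not> (\<exists>\<psi>. f = S.coboundary_A \<psi> \<and> g = S.coboundary_B \<psi>)" if "?case k f g" for k f g
    using that
  proof (elim disjE conjE)
    assume *: "extension_case \<delta>1 \<alpha>1 \<beta>1 \<delta>1' \<alpha>1' \<beta>1' \<delta>2 \<delta>2' k" "f \<in> subcase_polys k \<alpha>1 \<beta>1" "g = 0"
    show ?thesis using special_cocycle_first_summand[OF *(1,2)] *(3) by blast
  next
    assume *: "extension_case \<delta>2 \<alpha>2 \<beta>2 \<delta>2' \<alpha>2' \<beta>2' \<delta>1 \<delta>1' k" "f = 0" "g \<in> subcase_polys k \<alpha>2 \<beta>2"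
    show ?thesis using special_cocycle_first_summand[OF *(1,3)] *(2) pair_cocycle_swap by blast
  qed
  \<comment> \<open>Every solution of the identities is realised by an extension on \<open>V \<times> W\<close>.\<close>
  have model: "is_extension R W V (cocycle_ext W V (S.cocycle_map f g))"
      "?given (cocycle_ext W V (S.cocycle_map f g)) f g" if "S.pair_cocycle f g" for f g
    using S.cocycle_ext_is_extension[OF S.cocycle_map_in_cocycles[OF that]] S.cocycle_map_lift unfolding given by blast+
  show ?thesis
  proof (intro conjI allI impI)
    fix E :: "('r, 'v, 'w, 'e) extension"
    assume "is_extension R W V E"
    then show "\<exists>f g. ?given E f g" unfolding given using lift by blast
  next
    fix E :: "('r, 'v, 'w, 'e) extension"
    assume E: "is_extension R W V E \<and> \<not> trivial_ext W V E"
    then obtain u f g where l: "S.is_lift E u f g" using lift by blast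
    interpret L: lifted_extension R A B V v W w "action_poly \<delta>1 \<alpha>1 \<beta>1" "action_poly \<delta>2 \<alpha>2 \<beta>2"
      "action_poly \<delta>1' \<alpha>1' \<beta>1'" "action_poly \<delta>2' \<alpha>2' \<beta>2'" E u f g
      using E l by unfold_locales blast+
    have "\<not> (\<exists>\<psi>. f = S.coboundary_A \<psi> \<and> g = S.coboundary_B \<psi>)"
      using S.lifted_trivial_ext_iff[OF conjunct1[OF E] l] E by blast
    then obtain k f0 g0 \<psi> where k: "?case k f0 g0" and fg: "f = f0 + S.coboundary_A \<psi>" "g = g0 + S.coboundary_B \<psi>"
      using pair_cocycle_classification[OF L.lift_pair_cocycle assms(2,3)] by blast
    have pc: "S.pair_cocycle f0 g0" using case_pair[OF k] by blast
    show "\<exists>k f g. (?case k f g) \<and> (\<exists>E' :: ('r, 'v, 'w, 'v \<times> 'w) extension.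
            is_extension R W V E' \<and> ?given E' f g \<and> equivalent_ext E E')"
      using k model[OF pc] L.equivalent_cocycle_ext[OF pc fg] by blast
  next
    fix k f g
    assume k: "?case k f g"
    have pc: "S.pair_cocycle f g" using case_pair[OF k] by blast
    have "\<not> trivial_ext W V (cocycle_ext W V (S.cocycle_map f g))"
      using S.lifted_trivial_ext_iff[OF model(1)[OF pc] S.cocycle_map_lift] case_pair[OF k] by blast
    then show "\<exists>E' :: ('r, 'v, 'w, 'v \<times> 'w) extension. is_extension R W V E' \<and> ?given E' f g \<and> \<not> trivial_ext W V E'"
      using model[OF pc] by blast
  next
    fix k
    assume "extension_case \<delta>1 \<alpha>1 \<beta>1 \<delta>1' \<alpha>1' \<beta>1' \<delta>2 \<delta>2' k \<or> extension_case \<delta>2 \<alpha>2 \<beta>2 \<delta>2' \<alpha>2' \<beta>2' \<delta>1 \<delta>1' k"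
    then show "dim_Ext_is R W V (subcase_dim k)"
    proof
      assume k: "extension_case \<delta>1 \<alpha>1 \<beta>1 \<delta>1' \<alpha>1' \<beta>1' \<delta>2 \<delta>2' k"
      note spans = subcase_basis_spans_first_summand[OF k]
      let ?bs = "map (\<lambda>H. (H, 0)) (subcase_basis k \<alpha>1 \<beta>1)"
      have maps: "map fst ?bs = subcase_basis k \<alpha>1 \<beta>1" "map snd ?bs = map (\<lambda>_. 0) (subcase_basis k \<alpha>1 \<beta>1)"
        by (simp_all add: o_def)
      show ?thesis
      proof (rule S.dim_Ext_from_basis[of ?bs], unfold maps lincomb_zeros add_0)
        show "S.pair_cocycle (S.coboundary_A \<psi>) (S.coboundary_B \<psi>)" for \<psi> by (rule spans(1))
        show "S.pair_cocycle f g" if "(f, g) \<in> set ?bs" for f g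
          using that spans(2) by (auto simp del: mult_pCons_left)
        show "\<exists>cs \<psi>. length cs = subcase_dim k \<and> f = lincomb cs (subcase_basis k \<alpha>1 \<beta>1) + S.coboundary_A \<psi> \<and> g = S.coboundary_B \<psi>"
          if "S.pair_cocycle f g" for f g using that by (rule spans(3))
      qed (use spans(4) in \<open>simp, blast\<close>)
    next
      assume k: "extension_case \<delta>2 \<alpha>2 \<beta>2 \<delta>2' \<alpha>2' \<beta>2' \<delta>1 \<delta>1' k"
      note spans = subcase_basis_spans_first_summand[OF k]
      let ?bs = "map (\<lambda>H. (0, H)) (subcase_basis k \<alpha>2 \<beta>2)"
      have maps: "map fst ?bs = map (\<lambda>_. 0) (subcase_basis k \<alpha>2 \<beta>2)" "map snd ?bs = subcase_basis k \<alpha>2 \<beta>2"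
        by (simp_all add: o_def)
      show ?thesis
      proof (rule S.dim_Ext_from_basis[of ?bs], unfold maps lincomb_zeros add_0)
        show "S.pair_cocycle (S.coboundary_A \<psi>) (S.coboundary_B \<psi>)" for \<psi>
          by (rule pair_cocycle_swap[OF spans(1)])
        show "S.pair_cocycle f g" if "(f, g) \<in> set ?bs" for f g
          using that pair_cocycle_swap[OF spans(2)] by (auto simp del: mult_pCons_left)
        show "\<exists>cs \<psi>. length cs = subcase_dim k \<and> f = S.coboundary_A \<psi> \<and> g = lincomb cs (subcase_basis k \<alpha>2 \<beta>2) + S.coboundary_B \<psi>"
          if "S.pair_cocycle f g" for f g using spans(3)[OF pair_cocycle_swap[OF that]] by blast
      qed (use spans(4) in \<open>simp, blast\<close>)
    qed
  qed
qed

end
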